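(* The fundamental group $\pi_1(X_{\mathrm{Gal}}^{\mathrm{Aff}})$ (identified with the group $\mathcal{A}=\ker\psi$) is generated by the elements $X_{ij},A_{ij}$ ($1\le i\ne j\le 6$), and has the presentation on these generators with the relations \begin{align*} X_{ji}A_{ji}^n&=(X_{ij}A_{ij}^n)^{-1},\\ (X_{ij}A_{ij}^n)(X_{jk}A_{jk}^n)(X_{ki}A_{ki}^n)&=1,\\ (X_{jk}A_{jk}^n)(X_{ij}A_{ij}^n)(X_{ki}A_{ki}^n)&=1,\\ A_{ij}A_{ik}^{-1}&=A_{k\ell}A_{j\ell}^{-1} \end{align*} for every $n\in\mathbb{Z}$ and all distinct indices $i,j,k,\ell\in\{1,\dots,6\}$.
   Context: $T\subset\mathbb{CP}^2$ is a complex projective torus (smooth plane cubic), $X=\mathbb{CP}^1\times T\subset\mathbb{CP}^5$ via the Segre embedding, and $f\colon X\to\mathbb{CP}^2$ is the projection from a general plane in $\mathbb{CP}^5$ disjoint from $X$ (degree $6$), with branch curve $S$. The Galois cover $X_{\mathrm{Gal}}$ is the closure of $X\times_f\cdots\times_f X-\Delta$ (6 factors, $\Delta$ the generalized diagonal), and $X_{\mathrm{Gal}}^{\mathrm{Aff}}$ is its affine part, the part lying over $\mathbb{C}^2=\mathbb{CP}^2$ minus a generic line. $\tilde\Pi_1$ is the quotient of $\pi_1(\mathbb{C}^2-S)$ by the normal subgroup generated by the squares of the standard generators $\Gamma_j,\Gamma_{j'}$, $1\le j\le 6$. It has the following presentation, which may be taken as its definition: generators $\Gamma_j,\Gamma_{j'}$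 ($1\le j\le6$); relations $\Gamma_j^2=\Gamma_{j'}^2=1$; $\Gamma_{3'}=\Gamma_1\Gamma_{1'}\Gamma_3\Gamma_{1'}\Gamma_1$, $\Gamma_{5'}=\Gamma_4\Gamma_{4'}\Gamma_5\Gamma_{4'}\Gamma_4$, $\Gamma_2=\Gamma_{6'}\Gamma_6\Gamma_{2'}\Gamma_6\Gamma_{6'}$, $\Gamma_{2'}=\Gamma_1\Gamma_{1'}\Gamma_2\Gamma_{1'}\Gamma_1$, $\Gamma_3=\Gamma_{4'}\Gamma_4\Gamma_{3'}\Gamma_4\Gamma_{4'}$, $\Gamma_5=\Gamma_{6'}\Gamma_6\Gamma_{5'}\Gamma_6\Gamma_{6'}$; for $\{i,j\}\in E=\{\{1,3\},\{3,4\},\{4,5\},\{5,6\},\{2,6\},\{1,2\}\}$ and all $p,q\in\mathbb{Z}$, $aba=bab$ where $a=(\Gamma_i\Gamma_{i'})^p\Gamma_i$, $b=(\Gamma_j\Gamma_{j'})^q\Gamma_j$; for $i\neq j$ with $\{i,j\}\notin E$, each of $\Gamma_i,\Gamma_{i'}$ commutes with each of $\Gamma_j,\Gamma_{j'}$. $\psi\colon\tilde\Pi_1\to S_6$ is the homomorphism with $\psi(\Gamma_j)=\psi(\Gamma_{j'})$ equal to $(13),(15),(23),(26),(46),(45)$ for $j=1,\dots,6$ respectively, and $\mathcal{A}=\ker\psi$. It is known that $\pi_1(X_{\mathrm{Gal}}^{\mathrm{Aff}})\cong\mathcal{A}$. Permutations are multiplied from left to right (e.g. $(13)(15)=(135)$),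 and $\sigma(k)$ is the image of $k$ under $\sigma$. $S_6$ is identified with the subgroup $\langle\Gamma_2,\dots,\Gamma_6\rangle$ of $\tilde\Pi_1$ (on which $\psi$ restricts to an isomorphism onto $S_6$). For $k\neq\ell$ in $\{1,\dots,6\}$, $$X_{k\ell}=\sigma\,\Gamma_2\Gamma_6\Gamma_5\Gamma_4\Gamma_3\Gamma_4\Gamma_5\Gamma_6\Gamma_2\Gamma_1\,\sigma^{-1},\qquad A_{k\ell}=\sigma\,\Gamma_1\Gamma_{1'}\,\sigma^{-1},$$ where $\sigma\in S_6=\langle\Gamma_2,\dots,\Gamma_6\rangle$ is any permutation with $\sigma(k)=1$, $\sigma(\ell)=3$ (the result does not depend on the choice). *)

theory Defs
  imports "HOL-Algebra.Generated_Groups" "HOL-Combinatorics.Permutations"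
begin

section \<open>Group presentations\<close>

text \<open>A letter \<open>(g, True)\<close> stands for the generator \<open>g\<close>, and \<open>(g, False)\<close> for its formal inverse.\<close>

type_synonym 'g word = "('g \<times> bool) list"

definition words :: "'g set \<Rightarrow> 'g word set" where
  "words S = lists (S \<times> UNIV)"

definition letter :: "'g \<Rightarrow> 'g word" where
  "letter g = [(g, True)]"

definition word_inv :: "'g word \<Rightarrow> 'g word" where
  "word_inv w = rev (map (\<lambda>(g, b). (g, \<not> b)) w)"

definition word_pow :: "'g word \<Rightarrow> int \<Rightarrow> 'g word" where
  "word_pow w n = (if n \<ge> 0 then concat (replicate (nat n) w)
                   else concat (replicate (nat (- n)) (word_inv w)))"

text \<open>A pair \<open>(l, r)\<close> in \<open>R\<close> is the relation \<open>l = r\<close>. The classes of words modulo \<open>pres_eq S R\<close> are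
  the elements of the quotient of the free group on \<open>S\<close> by the normal closure of all
  \<open>l r\<^sup>-\<^sup>1\<close>.\<close>

inductive pres_eq :: "'g set \<Rightarrow> ('g word \<times> 'g word) set \<Rightarrow> 'g word \<Rightarrow> 'g word \<Rightarrow> bool"
  for S :: "'g set" and R :: "('g word \<times> 'g word) set" where
  refl: "w \<in> words S \<Longrightarrow> pres_eq S R w w"
| sym: "pres_eq S R v w \<Longrightarrow> pres_eq S R w v"
| trans: "pres_eq S R u v \<Longrightarrow> pres_eq S R v w \<Longrightarrow> pres_eq S R u w"
| cancel: "u \<in> words S \<Longrightarrow> v \<in> words S \<Longrightarrow> g \<in> S \<Longrightarrow>
    pres_eq S R (u @ [(g, b), (g, \<not> b)] @ v) (u @ v)"
| rel: "u \<in> words S \<Longrightarrow> v \<in> words S \<Longrightarrow> (l, r) \<in> R \<Longrightarrow> l \<in> words S \<Longrightarrow> r \<in> words S \<Longrightarrow>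
    pres_eq S R (u @ l @ v) (u @ r @ v)"

definition pres_class :: "'g set \<Rightarrow> ('g word \<times> 'g word) set \<Rightarrow> 'g word \<Rightarrow> 'g word set" where
  "pres_class S R w = {v. pres_eq S R w v}"

definition pres_group :: "'g set \<Rightarrow> ('g word \<times> 'g word) set \<Rightarrow> 'g word set monoid" where
  "pres_group S R =
    \<lparr> carrier = pres_class S R ` words S,
      monoid.mult = (\<lambda>A B. \<Union>a\<in>A. \<Union>b\<in>B. pres_class S R (a @ b)),
      one = pres_class S R [] \<rparr>"

definition has_presentation ::
  "('a, 'b) monoid_scheme \<Rightarrow> 'g set \<Rightarrow> ('g word \<times> 'g word) set \<Rightarrow> ('g \<Rightarrow> 'a) \<Rightarrow> bool" where
  "has_presentation G S R f \<longleftrightarrow>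
    (\<exists>\<phi> \<in> iso (pres_group S R) G. \<forall>g\<in>S. \<phi> (pres_class S R (letter g)) = f g)"

primrec word_eval :: "('a, 'b) monoid_scheme \<Rightarrow> ('g \<Rightarrow> 'a) \<Rightarrow> 'g word \<Rightarrow> 'a" where
  "word_eval H f [] = \<one>\<^bsub>H\<^esub>"
| "word_eval H f (x # w) =
    (if snd x then f (fst x) else inv\<^bsub>H\<^esub> f (fst x)) \<otimes>\<^bsub>H\<^esub> word_eval H f w"

text \<open>The homomorphism out of a presented group with prescribed values on the generators
  (meaningful if \<open>f\<close> respects the relations, so that the image below is a singleton).\<close>

definition pres_lift :: "('a, 'b) monoid_scheme \<Rightarrow> ('g \<Rightarrow> 'a) \<Rightarrow> 'g word set \<Rightarrow> 'a" where
  "pres_lift H f C = the_elem (word_eval H f ` C)"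

lemma words_simps [simp]:
  "[] \<in> words S"
  "x # w \<in> words S \<longleftrightarrow> fst x \<in> S \<and> w \<in> words S"
  "u @ v \<in> words S \<longleftrightarrow> u \<in> words S \<and> v \<in> words S"
  by (auto simp: words_def mem_Times_iff)

lemma word_inv_words [simp]: "word_inv w \<in> words S \<longleftrightarrow> w \<in> words S"
  by (induction w) (auto simp: word_inv_def)

lemma pres_eq_words:
  assumes "pres_eq S R u v" shows "u \<in> words S \<and> v \<in> words S"
  using assms by induction auto

lemma pres_eq_context:
  assumes "pres_eq S R u v" "a \<in> words S" "b \<in> words S"
  shows "pres_eq S R (a @ u @ b) (a @ v @ b)"
  using assms
proof induction
  case (cancel u v g c)
  then show ?case using pres_eq.cancel[of "a @ u" S "v @ b" g R c] by simp
next
  case (rel u v l r)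
  then show ?case using pres_eq.rel[of "a @ u" S "v @ b" l r R] by simp
next
  case (trans u v w)
  then show ?case by (meson pres_eq.trans)
qed (simp_all add: pres_eq.refl pres_eq.sym)

lemma pres_eq_append:
  assumes "pres_eq S R u u'" "pres_eq S R v v'"
  shows "pres_eq S R (u @ v) (u' @ v')"
proof (rule pres_eq.trans)
  show "pres_eq S R (u @ v) (u' @ v)"
    using pres_eq_context[OF assms(1), of "[]" v] pres_eq_words[OF assms(2)] by simp
  show "pres_eq S R (u' @ v) (u' @ v')"
    using pres_eq_context[OF assms(2), of u' "[]"] pres_eq_words[OF assms(1)] by simp
qed

lemma pres_class_eq_iff:
  assumes "u \<in> words S"
  shows "pres_class S R u = pres_class S R v \<longleftrightarrow> pres_eq S R u v"
proof
  assume "pres_class S R u = pres_class S R v"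
  moreover have "u \<in> pres_class S R u" using assms by (simp add: pres_class_def pres_eq.refl)
  ultimately show "pres_eq S R u v" by (simp add: pres_class_def pres_eq.sym)
next
  assume "pres_eq S R u v"
  then show "pres_class S R u = pres_class S R v"
    unfolding pres_class_def by (blast intro: pres_eq.sym pres_eq.trans)
qed

lemma pres_group_mult:
  assumes "u \<in> words S" "v \<in> words S"
  shows "pres_class S R u \<otimes>\<^bsub>pres_group S R\<^esub> pres_class S R v = pres_class S R (u @ v)"
proof -
  have "pres_class S R (a @ b) = pres_class S R (u @ v)"
    if "a \<in> pres_class S R u" "b \<in> pres_class S R v" for a b
  proof -
    have "pres_eq S R (u @ v) (a @ b)"
      using that by (intro pres_eq_append) (auto simp: pres_class_def)
    then show ?thesis using pres_class_eq_iff[of "u @ v" S R "a @ b"] assms by simp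
  qed
  moreover have "u \<in> pres_class S R u" "v \<in> pres_class S R v"
    using assms by (auto simp: pres_class_def intro: pres_eq.refl)
  ultimately have "(\<Union>a\<in>pres_class S R u. \<Union>b\<in>pres_class S R v. pres_class S R (a @ b))
      = pres_class S R (u @ v)"
    by blast
  then show ?thesis by (simp add: pres_group_def)
qed

lemma pres_group_one: "\<one>\<^bsub>pres_group S R\<^esub> = pres_class S R []"
  by (simp add: pres_group_def)

lemma pres_group_carrier: "carrier (pres_group S R) = pres_class S R ` words S"
  by (simp add: pres_group_def)

lemma word_inv_left: "w \<in> words S \<Longrightarrow> pres_eq S R (word_inv w @ w) []"
proof (induction w)
  case Nil
  then show ?case by (simp add: word_inv_def pres_eq.refl)
next
  case (Cons x w)
  obtain g b where x: "x = (g, b)" by (cases x)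
  have "pres_eq S R (word_inv w @ [(g, \<not> b), (g, \<not> \<not> b)] @ w) (word_inv w @ w)"
    using Cons.prems x by (intro pres_eq.cancel) auto
  then have "pres_eq S R (word_inv (x # w) @ x # w) (word_inv w @ w)"
    using x by (simp add: word_inv_def)
  moreover have "pres_eq S R (word_inv w @ w) []" using Cons by simp
  ultimately show ?case by (rule pres_eq.trans)
qed

lemma group_pres_group: "group (pres_group S R)"
proof (rule groupI)
  fix x assume "x \<in> carrier (pres_group S R)"
  then obtain w where w: "w \<in> words S" "x = pres_class S R w" by (auto simp: pres_group_carrier)
  have "pres_class S R (word_inv w) \<otimes>\<^bsub>pres_group S R\<^esub> x = \<one>\<^bsub>pres_group S R\<^esub>"
    using w word_inv_left[OF w(1), of R] pres_class_eq_iff[of "word_inv w @ w" S R "[]"]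
    by (simp add: pres_group_mult pres_group_one pres_group_carrier)
  moreover have "pres_class S R (word_inv w) \<in> carrier (pres_group S R)"
    using w by (simp add: pres_group_carrier)
  ultimately show "\<exists>y\<in>carrier (pres_group S R). y \<otimes>\<^bsub>pres_group S R\<^esub> x = \<one>\<^bsub>pres_group S R\<^esub>"
    by blast
next
  show "\<one>\<^bsub>pres_group S R\<^esub> \<in> carrier (pres_group S R)"
    by (simp add: pres_group_carrier pres_group_one)
next
  fix x y assume "x \<in> carrier (pres_group S R)" "y \<in> carrier (pres_group S R)"
  then obtain u v where "u \<in> words S" "x = pres_class S R u" "v \<in> words S" "y = pres_class S R v"
    by (auto simp: pres_group_carrier)
  then show "x \<otimes>\<^bsub>pres_group S R\<^esub> y \<in> carrier (pres_group S R)"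
    by (simp add: pres_group_mult pres_group_one pres_group_carrier)
next
  fix x y z
  assume "x \<in> carrier (pres_group S R)" "y \<in> carrier (pres_group S R)"
    "z \<in> carrier (pres_group S R)"
  then obtain u v w where "u \<in> words S" "x = pres_class S R u" "v \<in> words S"
    "y = pres_class S R v" "w \<in> words S" "z = pres_class S R w"
    by (auto simp: pres_group_carrier)
  then show "x \<otimes>\<^bsub>pres_group S R\<^esub> y \<otimes>\<^bsub>pres_group S R\<^esub> z
      = x \<otimes>\<^bsub>pres_group S R\<^esub> (y \<otimes>\<^bsub>pres_group S R\<^esub> z)"
    by (simp add: pres_group_mult)
next
  fix x assume "x \<in> carrier (pres_group S R)"
  then obtain w where w: "w \<in> words S" "x = pres_class S R w" by (auto simp: pres_group_carrier)
  then show "\<one>\<^bsub>pres_group S R\<^esub> \<otimes>\<^bsub>pres_group S R\<^esub> x = x"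
    by (simp add: pres_group_mult pres_group_one)
qed

lemma word_eval_closed:
  assumes "group H" "\<And>g. g \<in> S \<Longrightarrow> f g \<in> carrier H" "w \<in> words S"
  shows "word_eval H f w \<in> carrier H"
  using assms(3)
  by (induction w) (auto simp: assms(1,2) group.is_monoid monoid.m_closed group.inv_closed)

lemma word_eval_append:
  assumes "group H" "\<And>g. g \<in> S \<Longrightarrow> f g \<in> carrier H" "u \<in> words S" "v \<in> words S"
  shows "word_eval H f (u @ v) = word_eval H f u \<otimes>\<^bsub>H\<^esub> word_eval H f v"
proof -
  interpret group H by fact
  show ?thesis
    using assms(3)
    by (induction u) (auto simp: assms(2,4) m_assoc word_eval_closed[OF assms(1,2)])
qed

lemma pres_eq_word_eval:
  assumes H: "group H" and f: "\<And>g. g \<in> S \<Longrightarrow> f g \<in> carrier H"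
    and R: "\<And>l r. (l, r) \<in> R \<Longrightarrow> l \<in> words S \<Longrightarrow> r \<in> words S \<Longrightarrow> word_eval H f l = word_eval H f r"
    and "pres_eq S R u v"
  shows "word_eval H f u = word_eval H f v"
  using assms(4)
proof induction
  case (cancel u v g b)
  interpret group H by (rule H)
  have "word_eval H f [(g, b), (g, \<not> b)] = \<one>\<^bsub>H\<^esub>" using cancel f by simp
  then show ?case using cancel f
    by (simp add: word_eval_append[OF H f] word_eval_closed[OF H f] m_assoc[symmetric] del: append.simps)
next
  case (rel u v l r)
  then show ?case using R by (simp add: word_eval_append[OF H f])
qed auto

lemma pres_lift_class:
  assumes H: "group H" and f: "\<And>g. g \<in> S \<Longrightarrow> f g \<in> carrier H"
    and R: "\<And>l r. (l, r) \<in> R \<Longrightarrow> l \<in> words S \<Longrightarrow> r \<in> words S \<Longrightarrow> word_eval H f l = word_eval H f r"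
    and w: "w \<in> words S"
  shows "pres_lift H f (pres_class S R w) = word_eval H f w"
proof -
  have "word_eval H f ` pres_class S R w = {word_eval H f w}"
    using pres_eq_word_eval[of H S f R, OF H f R] w
    by (force simp: pres_class_def intro: pres_eq.refl)
  then show ?thesis by (simp add: pres_lift_def)
qed

lemma pres_lift_hom:
  assumes H: "group H" and f: "\<And>g. g \<in> S \<Longrightarrow> f g \<in> carrier H"
    and R: "\<And>l r. (l, r) \<in> R \<Longrightarrow> l \<in> words S \<Longrightarrow> r \<in> words S \<Longrightarrow> word_eval H f l = word_eval H f r"
  shows "pres_lift H f \<in> hom (pres_group S R) H"
proof (rule homI)
  fix x assume "x \<in> carrier (pres_group S R)"
  then obtain u where "u \<in> words S" "x = pres_class S R u" by (auto simp: pres_group_carrier)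
  then show "pres_lift H f x \<in> carrier H"
    using pres_lift_class[of H S f R, OF H f R] by (simp add: word_eval_closed[OF H f])
next
  fix x y assume "x \<in> carrier (pres_group S R)" "y \<in> carrier (pres_group S R)"
  then obtain u v where "u \<in> words S" "x = pres_class S R u" "v \<in> words S" "y = pres_class S R v"
    by (auto simp: pres_group_carrier)
  then show "pres_lift H f (x \<otimes>\<^bsub>pres_group S R\<^esub> y) = pres_lift H f x \<otimes>\<^bsub>H\<^esub> pres_lift H f y"
    using pres_lift_class[of H S f R, OF H f R]
    by (simp add: pres_group_mult word_eval_append[OF H f])
qed


section \<open>The group \<open>Pi1\<close>\<close>

text \<open>\<open>Gam j\<close> and \<open>Gam' j\<close> are the symbols \<open>\<Gamma>\<^sub>j\<close> and \<open>\<Gamma>\<^sub>j\<^sub>'\<close>; \<open>gam j\<close> and \<open>gam' j\<close> are the corresponding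
  one-letter words.\<close>

datatype pi_gen = Gam nat | Gam' nat

abbreviation gam :: "nat \<Rightarrow> pi_gen word" where "gam j \<equiv> letter (Gam j)"
abbreviation gam' :: "nat \<Rightarrow> pi_gen word" where "gam' j \<equiv> letter (Gam' j)"

definition pi_gens :: "pi_gen set" where
  "pi_gens = Gam ` {1..6} \<union> Gam' ` {1..6}"

definition pi_edges :: "nat set set" where
  "pi_edges = {{1,3}, {3,4}, {4,5}, {5,6}, {2,6}, {1,2}}"

definition pi_rels :: "(pi_gen word \<times> pi_gen word) set" where
  "pi_rels =
     {(gam j @ gam j, []) | j. j \<in> {1..6}}
   \<union> {(gam' j @ gam' j, []) | j. j \<in> {1..6}}
   \<union> {(gam' 3, gam 1 @ gam' 1 @ gam 3 @ gam' 1 @ gam 1),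
      (gam' 5, gam 4 @ gam' 4 @ gam 5 @ gam' 4 @ gam 4),
      (gam 2, gam' 6 @ gam 6 @ gam' 2 @ gam 6 @ gam' 6),
      (gam' 2, gam 1 @ gam' 1 @ gam 2 @ gam' 1 @ gam 1),
      (gam 3, gam' 4 @ gam 4 @ gam' 3 @ gam 4 @ gam' 4),
      (gam 5, gam' 6 @ gam 6 @ gam' 5 @ gam 6 @ gam' 6)}
   \<union> {(a @ b @ a, b @ a @ b) | a b i j p q.
        i \<in> {1..6} \<and> j \<in> {1..6} \<and> {i, j} \<in> pi_edges \<and>
        a = word_pow (gam i @ gam' i) p @ gam i \<and> b = word_pow (gam j @ gam' j) q @ gam j}
   \<union> {(a @ b, b @ a) | a b i j.
        i \<in> {1..6} \<and> j \<in> {1..6} \<and> i \<noteq> j \<and> {i, j} \<notin> pi_edges \<and>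
        a \<in> {gam i, gam' i} \<and> b \<in> {gam j, gam' j}}"

definition Pi1 :: "pi_gen word set monoid" where
  "Pi1 = pres_group pi_gens pi_rels"

definition pi_elem :: "pi_gen word \<Rightarrow> pi_gen word set" where
  "pi_elem w = pres_class pi_gens pi_rels w"


section \<open>The homomorphism to \<open>S\<^sub>6\<close> and its kernel\<close>

text \<open>Permutations are multiplied from left to right, which is the opposite of the
  library's \<open>sym_group\<close>.\<close>

definition S6 :: "(nat \<Rightarrow> nat) monoid" where
  "S6 = \<lparr> carrier = {p. p permutes {1..6}}, monoid.mult = (\<lambda>p q. q \<circ> p), one = id \<rparr>"

definition psi_transp :: "nat \<Rightarrow> nat \<Rightarrow> nat" where
  "psi_transp j =
    (if j = 1 then transpose 1 3
     else if j = 2 then transpose 1 5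
     else if j = 3 then transpose 2 3
     else if j = 4 then transpose 2 6
     else if j = 5 then transpose 4 6
     else transpose 4 5)"

definition psi :: "pi_gen word set \<Rightarrow> nat \<Rightarrow> nat" where
  "psi = pres_lift S6 (\<lambda>x. case x of Gam j \<Rightarrow> psi_transp j | Gam' j \<Rightarrow> psi_transp j)"

definition A_group :: "pi_gen word set monoid" where
  "A_group = Pi1 \<lparr> carrier := kernel Pi1 S6 psi \<rparr>"

text \<open>The copy \<open>\<langle>\<Gamma>\<^sub>2, \<dots>, \<Gamma>\<^sub>6\<rangle>\<close> of \<open>S\<^sub>6\<close> in \<open>Pi1\<close>.\<close>

definition S6_lift :: "pi_gen word set set" where
  "S6_lift = generate Pi1 ((\<lambda>j. pi_elem (gam j)) ` {2..6})"

text \<open>\<open>X_elem s\<close> and \<open>A_elem s\<close> are \<open>X\<^sub>k\<^sub>l\<close> and \<open>A\<^sub>k\<^sub>l\<close> as computed from a choice \<open>s\<close> of \<open>\<sigma>\<close>, that is,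
  an \<open>s\<close> with \<open>is_sigma k l s\<close>.\<close>

definition is_sigma :: "nat \<Rightarrow> nat \<Rightarrow> pi_gen word set \<Rightarrow> bool" where
  "is_sigma k l s \<longleftrightarrow> s \<in> S6_lift \<and> psi s k = 1 \<and> psi s l = 3"

definition X_elem :: "pi_gen word set \<Rightarrow> pi_gen word set" where
  "X_elem s = s \<otimes>\<^bsub>Pi1\<^esub>
     pi_elem (gam 2 @ gam 6 @ gam 5 @ gam 4 @ gam 3 @ gam 4 @ gam 5 @ gam 6 @ gam 2 @ gam 1) \<otimes>\<^bsub>Pi1\<^esub> inv\<^bsub>Pi1\<^esub> s"

definition A_elem :: "pi_gen word set \<Rightarrow> pi_gen word set" where
  "A_elem s = s \<otimes>\<^bsub>Pi1\<^esub> pi_elem (gam 1 @ gam' 1) \<otimes>\<^bsub>Pi1\<^esub> inv\<^bsub>Pi1\<^esub> s"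


section \<open>The presentation of the kernel\<close>

datatype xa_gen = Xg nat nat | Ag nat nat

definition xa_gens :: "xa_gen set" where
  "xa_gens = {Xg i j | i j. i \<in> {1..6} \<and> j \<in> {1..6} \<and> i \<noteq> j}
           \<union> {Ag i j | i j. i \<in> {1..6} \<and> j \<in> {1..6} \<and> i \<noteq> j}"

definition XA :: "nat \<Rightarrow> nat \<Rightarrow> int \<Rightarrow> xa_gen word" where
  "XA i j n = letter (Xg i j) @ word_pow (letter (Ag i j)) n"

definition xa_rels :: "(xa_gen word \<times> xa_gen word) set" where
  "xa_rels =
     {(XA j i n, word_inv (XA i j n)) | i j n. {i, j} \<subseteq> {1..6} \<and> distinct [i, j]}
   \<union> {(XA i j n @ XA j k n @ XA k i n, []) | i j k n. {i, j, k} \<subseteq> {1..6} \<and> distinct [i, j, k]}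
   \<union> {(XA j k n @ XA i j n @ XA k i n, []) | i j k n. {i, j, k} \<subseteq> {1..6} \<and> distinct [i, j, k]}
   \<union> {(letter (Ag i j) @ word_inv (letter (Ag i k)), letter (Ag k l) @ word_inv (letter (Ag j l)))
        | i j k l. {i, j, k, l} \<subseteq> {1..6} \<and> distinct [i, j, k, l]}"


section \<open>Well-definedness of the homomorphism\<close>

lemma group_S6: "group S6"
proof (rule groupI)
  fix p assume "p \<in> carrier S6"
  then show "\<exists>q\<in>carrier S6. q \<otimes>\<^bsub>S6\<^esub> p = \<one>\<^bsub>S6\<^esub>"
    by (intro bexI[of _ "Hilbert_Choice.inv p"])
      (auto simp: S6_def permutes_inv permutes_inv_o)
qed (auto simp: S6_def permutes_compose comp_assoc permutes_id)

lemma psi_transp_closed: "psi_transp j \<in> carrier S6"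
  by (auto simp: S6_def psi_transp_def intro!: permutes_swap_id)

lemma psi_transp_square [simp]: "psi_transp j \<otimes>\<^bsub>S6\<^esub> psi_transp j = \<one>\<^bsub>S6\<^esub>"
  by (auto simp: S6_def psi_transp_def)

abbreviation psi_gen :: "pi_gen \<Rightarrow> nat \<Rightarrow> nat" where
  "psi_gen x \<equiv> (case x of Gam j \<Rightarrow> psi_transp j | Gam' j \<Rightarrow> psi_transp j)"

lemma psi_gen_closed: "psi_gen x \<in> carrier S6"
  by (cases x) (auto simp: psi_transp_closed)

lemma word_eval_psi_append [simp]:
  "word_eval S6 psi_gen (u @ v) = word_eval S6 psi_gen u \<otimes>\<^bsub>S6\<^esub> word_eval S6 psi_gen v"
  using word_eval_append[of S6 UNIV psi_gen u v] group_S6 psi_gen_closed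
  by (auto simp: words_def)

lemma word_eval_psi_letter [simp]:
  "word_eval S6 psi_gen (gam j) = psi_transp j" "word_eval S6 psi_gen (gam' j) = psi_transp j"
  using group.is_monoid[OF group_S6]
  by (auto simp: letter_def psi_transp_closed monoid.r_one)

lemma word_eval_psi_concat:
  "word_eval S6 psi_gen w = \<one>\<^bsub>S6\<^esub> \<Longrightarrow> word_eval S6 psi_gen (concat (replicate n w)) = \<one>\<^bsub>S6\<^esub>"
  using group.is_monoid[OF group_S6]
  by (induction n) (auto simp: monoid.l_one monoid.one_closed)

lemma word_eval_psi_pow:
  "word_eval S6 psi_gen (word_pow (gam j @ gam' j) n) = \<one>\<^bsub>S6\<^esub>"
proof -
  have "psi_transp j \<otimes>\<^bsub>S6\<^esub> psi_transp j = \<one>\<^bsub>S6\<^esub>" by simp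
  then have i: "inv\<^bsub>S6\<^esub> (psi_transp j) = psi_transp j"
    using group.inv_equality[OF group_S6] psi_transp_closed by blast
  have "word_eval S6 psi_gen (word_inv (gam j @ gam' j)) = \<one>\<^bsub>S6\<^esub>"
    using group.is_monoid[OF group_S6]
    by (simp add: word_inv_def letter_def i psi_transp_closed monoid.r_one)
  then show ?thesis by (simp add: word_pow_def word_eval_psi_concat)
qed

lemma S6_eqI:
  assumes "p \<in> carrier S6" "q \<in> carrier S6"
    "p 1 = q 1" "p 2 = q 2" "p 3 = q 3" "p 4 = q 4" "p 5 = q 5" "p 6 = q 6"
  shows "p = q"
proof
  fix x
  show "p x = q x"
  proof (cases "x \<in> {1..6}")
    case True
    then have "x \<in> {1,2,3,4,5,6}" by auto
    then show ?thesis using assms(3-8) by auto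
  next
    case False
    then show ?thesis using assms(1,2) by (simp add: S6_def permutes_not_in)
  qed
qed

lemma psi_transp_braid:
  assumes "{i, j} \<in> pi_edges"
  shows "psi_transp i \<otimes>\<^bsub>S6\<^esub> (psi_transp j \<otimes>\<^bsub>S6\<^esub> psi_transp i)
      = psi_transp j \<otimes>\<^bsub>S6\<^esub> (psi_transp i \<otimes>\<^bsub>S6\<^esub> psi_transp j)" (is "?P i j")
proof -
  have *: "?P i j" if "(i, j) \<in> {(1,3), (3,4), (4,5), (5,6), (2,6), (1,2)}" for i j
  proof (rule S6_eqI)
    show "psi_transp i \<otimes>\<^bsub>S6\<^esub> (psi_transp j \<otimes>\<^bsub>S6\<^esub> psi_transp i) \<in> carrier S6"
      "psi_transp j \<otimes>\<^bsub>S6\<^esub> (psi_transp i \<otimes>\<^bsub>S6\<^esub> psi_transp j) \<in> carrier S6"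
      using group.is_monoid[OF group_S6] by (simp_all add: monoid.m_closed psi_transp_closed)
  qed (use that in \<open>auto simp: psi_transp_def S6_def transpose_def\<close>)
  have "(i, j) \<in> {(1,3), (3,4), (4,5), (5,6), (2,6), (1,2)} \<or>
      (j, i) \<in> {(1,3), (3,4), (4,5), (5,6), (2,6), (1,2)}"
    using assms unfolding pi_edges_def insert_iff doubleton_eq_iff
    by (elim disjE conjE; simp)
  then show ?thesis using *[of i j] *[of j i] by metis
qed

lemma psi_transp_commute:
  assumes "i \<in> {1..6}" "j \<in> {1..6}" "i \<noteq> j" "{i, j} \<notin> pi_edges"
  shows "psi_transp i \<otimes>\<^bsub>S6\<^esub> psi_transp j = psi_transp j \<otimes>\<^bsub>S6\<^esub> psi_transp i" (is "?P i j")
proof -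
  let ?N = "{(1,4), (1,5), (1,6), (2,3), (2,4), (2,5), (3,5), (3,6), (4,6)} :: (nat \<times> nat) set"
  have *: "?P i j" if "(i, j) \<in> ?N" for i j
  proof (rule S6_eqI)
    show "psi_transp i \<otimes>\<^bsub>S6\<^esub> psi_transp j \<in> carrier S6" "psi_transp j \<otimes>\<^bsub>S6\<^esub> psi_transp i \<in> carrier S6"
      using group.is_monoid[OF group_S6] by (simp_all add: monoid.m_closed psi_transp_closed)
  qed (use that in \<open>auto simp: psi_transp_def S6_def transpose_def\<close>)
  have "i \<in> {1,2,3,4,5,6}" "j \<in> {1,2,3,4,5,6}" using assms(1,2) by auto
  then have "(i, j) \<in> ?N \<or> (j, i) \<in> ?N"
    using assms(3,4) unfolding pi_edges_def by (elim insertE emptyE; simp add: insert_commute)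
  then show ?thesis using *[of i j] *[of j i] by metis
qed

lemma psi_rels:
  assumes "(l, r) \<in> pi_rels"
  shows "word_eval S6 psi_gen l = word_eval S6 psi_gen r"
proof -
  have "p \<otimes>\<^bsub>S6\<^esub> \<one>\<^bsub>S6\<^esub> = p" "\<one>\<^bsub>S6\<^esub> \<otimes>\<^bsub>S6\<^esub> p = p" for p by (simp_all add: S6_def)
  moreover have "psi_transp j \<otimes>\<^bsub>S6\<^esub> (psi_transp j \<otimes>\<^bsub>S6\<^esub> p) = p" for p j
    using psi_transp_square[of j] by (simp add: S6_def comp_assoc)
  ultimately show ?thesis
    using assms unfolding pi_rels_def
    by (elim UnE insertE CollectE exE conjE emptyE)
      (simp_all add: word_eval_psi_pow, (rule psi_transp_braid, assumption),
        (rule psi_transp_commute; simp)+)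
qed

lemma psi_class:
  assumes "w \<in> words pi_gens"
  shows "psi (pi_elem w) = word_eval S6 psi_gen w"
  using pres_lift_class[of S6 pi_gens psi_gen pi_rels w] group_S6 psi_gen_closed psi_rels assms
  by (simp add: psi_def pi_elem_def)

lemma psi_hom: "psi \<in> hom Pi1 S6"
  using pres_lift_hom[of S6 pi_gens psi_gen pi_rels] group_S6 psi_gen_closed psi_rels
  by (simp add: psi_def Pi1_def)

lemma psi_values:
  assumes "j \<in> {1..6}"
  shows "psi (pi_elem (gam j)) = psi_transp j" "psi (pi_elem (gam' j)) = psi_transp j"
proof -
  have "gam j \<in> words pi_gens" "gam' j \<in> words pi_gens"
    using assms by (auto simp: letter_def pi_gens_def)
  then show "psi (pi_elem (gam j)) = psi_transp j" "psi (pi_elem (gam' j)) = psi_transp j"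
    by (simp_all add: psi_class)
qed

end

theory Submission
  imports Defs
begin

text \<open>The group \<open>Pi1\<close> is identified with a semidirect product of the group \<open>K\<close> presented by the
\<open>X\<^sub>i\<^sub>j\<close>, \<open>A\<^sub>i\<^sub>j\<close> with the symmetric group \<open>S\<^sub>6\<close>, in such a way that the kernel of \<open>psi\<close>
corresponds to \<open>K\<close>.

The transpositions \<open>psi (\<Gamma>\<^sub>j)\<close> join consecutive vertices of a hexagon on the six points. Without
\<open>\<Gamma>\<^sub>1\<close> the hexagon becomes the path \<open>3, 2, 6, 4, 5, 1\<close>, so \<open>\<Gamma>\<^sub>3, \<Gamma>\<^sub>4, \<Gamma>\<^sub>5, \<Gamma>\<^sub>6, \<Gamma>\<^sub>2\<close> satisfy the Coxeter
relations of \<open>S\<^sub>6\<close>. A coset decomposition along the path (locale \<open>braid_path\<close>) shows that \<open>psi\<close>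
maps the subgroup \<open>H\<close> that they generate isomorphically onto \<open>S\<^sub>6\<close> and that the stabilizers of
points are generated by the expected transpositions. Consequently an element that commutes with
\<open>\<Gamma>\<^sub>4, \<Gamma>\<^sub>5, \<Gamma>\<^sub>6\<close> has well-defined conjugates indexed by ordered pairs of points, permuted by
\<open>H\<close> as the pairs are. Since \<open>S\<^sub>6\<close> is highly transitive, each of the relations between the
\<open>X\<^sub>i\<^sub>j A\<^sub>i\<^sub>j\<^sup>n\<close> and \<open>A\<^sub>i\<^sub>j\<close> needs to be checked for one choice of the indices only
(\<open>kernel_family\<close>). The triangle relations come from the fact that the involution
\<open>B\<^sub>1\<^sup>m \<Gamma>\<^sub>1\<close>, where \<open>B\<^sub>j = \<Gamma>\<^sub>j \<Gamma>\<^sub>j\<^sub>'\<close>, braids with \<open>\<Gamma>\<^sub>3\<close> and with a conjugate of \<open>\<Gamma>\<^sub>2\<close>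
(\<open>triangle_relations\<close>). The last relation comes from the twisting relations, by which those of
the \<open>B\<^sub>2, \<dots>, B\<^sub>6\<close> that belong to adjacent edges of the path are conjugate under \<open>H\<close>
(\<open>twist_conjugate\<close>): travelling from \<open>B\<^sub>2\<close> to \<open>B\<^sub>3\<close> gives two expressions of \<open>B\<^sub>3\<close> as a quotient of two elements \<open>A\<^sub>i\<^sub>j\<close>.
As a by-product all \<open>\<Gamma>\<^sub>j\<close> and \<open>\<Gamma>\<^sub>j\<^sub>'\<close> are products of elements \<open>X\<^sub>i\<^sub>j\<close>, \<open>A\<^sub>i\<^sub>j\<close> and
elements of \<open>H\<close>, whence the kernel is generated by the \<open>X\<^sub>i\<^sub>j\<close> and \<open>A\<^sub>i\<^sub>j\<close>
(\<open>kernel_generated\<close>). So there is a surjection \<open>to_Pi1\<close> from \<open>K\<close> onto the kernel.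

For its injectivity, \<open>S\<^sub>6\<close> acts on \<open>K\<close> by permuting indices, and in the semidirect product the
elements \<open>\<Gamma>\<^sub>j \<mapsto> (1, psi (\<Gamma>\<^sub>j))\<close> for \<open>j \<noteq> 1\<close>, \<open>\<Gamma>\<^sub>1 \<mapsto> (X\<^sub>3\<^sub>1, (1 3))\<close>, together with suitable
images of the \<open>\<Gamma>\<^sub>j\<^sub>'\<close>, satisfy all relations of \<open>Pi1\<close> (\<open>pi_family_SD\<close>). The point of the
calculation is that the quotients \<open>C\<^sub>k\<^sub>j = A\<^sub>k\<^sub>l A\<^sub>j\<^sub>l\<^sup>-\<^sup>1 = A\<^sub>i\<^sub>j A\<^sub>i\<^sub>k\<^sup>-\<^sup>1\<close> depend on \<open>k, j\<close> only,
commute with each other, and are interchanged with the \<open>A\<^sub>i\<^sub>j\<close> under conjugation by the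
\<open>X\<^sub>i\<^sub>j A\<^sub>i\<^sub>j\<^sup>n\<close>. The resulting homomorphism \<open>to_model\<close> sends the image of \<open>x \<in> K\<close> back to
\<open>(x, 1)\<close>, so \<open>to_Pi1\<close> is injective.\<close>

section \<open>Words\<close>

lemma word_eval_letter:
  assumes "group H" "f g \<in> carrier H"
  shows "word_eval H f (letter g) = f g"
  using assms by (simp add: letter_def group.is_monoid monoid.r_one)

lemma word_eval_inv:
  assumes H: "group H" and f: "\<And>g. g \<in> S \<Longrightarrow> f g \<in> carrier H" and w: "w \<in> words S"
  shows "word_eval H f (word_inv w) = inv\<^bsub>H\<^esub> word_eval H f w"
  using w
proof (induction w)
  case Nil
  then show ?case using group.is_monoid[OF H] by (simp add: word_inv_def monoid.inv_one)
next
  case (Cons x w)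
  interpret group H by fact
  have x: "f (fst x) \<in> carrier H" and w: "w \<in> words S" using Cons f by auto
  have "word_inv (x # w) = word_inv w @ [(fst x, \<not> snd x)]"
    by (simp add: word_inv_def case_prod_beta)
  then have "word_eval H f (word_inv (x # w)) =
      inv\<^bsub>H\<^esub> word_eval H f w \<otimes>\<^bsub>H\<^esub> word_eval H f [(fst x, \<not> snd x)]"
    using word_eval_append[of H S f "word_inv w" "[(fst x, \<not> snd x)]", OF H f] Cons by simp
  then show ?case
    using x word_eval_closed[of H S f w, OF H f w] by (auto simp: inv_mult_group)
qed

lemma word_eval_pow:
  assumes H: "group H" and f: "\<And>g. g \<in> S \<Longrightarrow> f g \<in> carrier H" and w: "w \<in> words S"
  shows "word_eval H f (word_pow w n) = word_eval H f w [^]\<^bsub>H\<^esub> (n::int)"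
proof -
  interpret group H by fact
  have c: "concat (replicate k v) \<in> words S \<and>
      word_eval H f (concat (replicate k v)) = word_eval H f v [^]\<^bsub>H\<^esub> k"
    if v: "v \<in> words S" for v and k :: nat
  proof (induction k)
    case (Suc k)
    have e: "word_eval H f v \<in> carrier H" using word_eval_closed[of H S f v, OF H f v] .
    show ?case
      using Suc v word_eval_append[of H S f v "concat (replicate k v)", OF H f v] nat_pow_Suc2[OF e] by simp
  qed simp
  have e: "word_eval H f w \<in> carrier H" using word_eval_closed[of H S f w, OF H f w] .
  show ?thesis
  proof (cases "n \<ge> 0")
    case True
    then obtain k where k: "n = int k" using zero_le_imp_eq_int by blast
    then show ?thesis using c[OF w, of k] by (simp add: word_pow_def int_pow_int)
  next
    case False
    then obtain k where k: "n = - int k" "k > 0"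
      by (metis int_cases2 neg_equal_0_iff_equal of_nat_0_le_iff of_nat_eq_0_iff not_gr0)
    have "word_eval H f (concat (replicate k (word_inv w))) = (inv\<^bsub>H\<^esub> word_eval H f w) [^]\<^bsub>H\<^esub> k"
      using c[of "word_inv w" k] w word_eval_inv[of H S f w, OF H f w] by simp
    then show ?thesis
      using k e by (simp add: word_pow_def int_pow_neg_int nat_pow_inv)
  qed
qed

lemma pres_group_letter_closed:
  "g \<in> S \<Longrightarrow> pres_class S R (letter g) \<in> carrier (pres_group S R)"
  by (simp add: pres_group_carrier letter_def)

lemma word_eval_pres_group:
  assumes "w \<in> words S"
  shows "word_eval (pres_group S R) (\<lambda>g. pres_class S R (letter g)) w = pres_class S R w"
  using assms
proof (induction w)
  case Nil
  then show ?case by (simp add: pres_group_one)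
next
  case (Cons x w)
  interpret P: group "pres_group S R" by (rule group_pres_group)
  obtain g b where x: "x = (g, b)" by (cases x)
  then have g: "g \<in> S" and w: "w \<in> words S" using Cons.prems by auto
  have l: "pres_class S R [(g, b)] = (if b then pres_class S R (letter g)
      else inv\<^bsub>pres_group S R\<^esub> pres_class S R (letter g))"
  proof (cases b)
    case True
    then show ?thesis by (simp add: letter_def)
  next
    case False
    have "pres_eq S R ([(g, False)] @ [(g, True)]) []"
      using pres_eq.cancel[of "[]" S "[]" g R False] g by simp
    then have "pres_class S R [(g, False)] \<otimes>\<^bsub>pres_group S R\<^esub> pres_class S R (letter g) =
        \<one>\<^bsub>pres_group S R\<^esub>"
      using g pres_class_eq_iff[of "[(g, False), (g, True)]" S R "[]"]
      by (simp add: letter_def pres_group_mult pres_group_one)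
    then have "inv\<^bsub>pres_group S R\<^esub> pres_class S R (letter g) = pres_class S R [(g, False)]"
      using P.inv_equality g pres_group_letter_closed[OF g] by (simp add: pres_group_carrier)
    then show ?thesis using False by simp
  qed
  have "pres_class S R (x # w) =
      pres_class S R [(g, b)] \<otimes>\<^bsub>pres_group S R\<^esub> pres_class S R w"
    using g w pres_group_mult[of "[(g, b)]" S w R] x by simp
  then show ?case using Cons.IH[OF w] l x by simp
qed

lemma word_eval_pres_group_rel:
  assumes "(l, r) \<in> R" "l \<in> words S" "r \<in> words S"
  shows "word_eval (pres_group S R) (\<lambda>g. pres_class S R (letter g)) l =
    word_eval (pres_group S R) (\<lambda>g. pres_class S R (letter g)) r"
proof -
  have "pres_eq S R l r"
    using pres_eq.rel[of "[]" S "[]" l r R] assms by simp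
  then show ?thesis
    using assms word_eval_pres_group pres_class_eq_iff by metis
qed

lemma hom_word_eval:
  assumes G: "group G" and H: "group H" and h: "h \<in> hom G H"
    and f: "\<And>g. g \<in> S \<Longrightarrow> f g \<in> carrier G" and w: "w \<in> words S"
  shows "h (word_eval G f w) = word_eval H (\<lambda>g. h (f g)) w"
  using w
proof (induction w)
  case Nil
  then show ?case using hom_one[OF h G H] by simp
next
  case (Cons x w)
  interpret gh: group_hom G H h
    using G H h by (simp add: group_hom_def group_hom_axioms_def)
  show ?case
    using Cons f word_eval_closed[of G S f w, OF G f] by auto
qed

lemma pres_group_hom_eqI:
  assumes H: "group H" and h: "h \<in> hom (pres_group S R) H" and h': "h' \<in> hom (pres_group S R) H"
    and eq: "\<And>g. g \<in> S \<Longrightarrow> h (pres_class S R (letter g)) = h' (pres_class S R (letter g))"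
    and x: "x \<in> carrier (pres_group S R)"
  shows "h x = h' x"
proof -
  let ?f = "\<lambda>g. pres_class S R (letter g)"
  obtain w where w: "w \<in> words S" "x = pres_class S R w"
    using x by (auto simp: pres_group_carrier)
  have x': "x = word_eval (pres_group S R) ?f w" using w word_eval_pres_group by metis
  have e: "word_eval H (\<lambda>g. h (?f g)) w = word_eval H (\<lambda>g. h' (?f g)) w"
    using w(1) by (induction w) (auto simp: eq)
  have "h x = word_eval H (\<lambda>g. h (?f g)) w" "h' x = word_eval H (\<lambda>g. h' (?f g)) w"
    unfolding x'
    using hom_word_eval[OF group_pres_group H h pres_group_letter_closed w(1)]
      hom_word_eval[OF group_pres_group H h' pres_group_letter_closed w(1)] by auto
  then show ?thesis using e by simp
qed

section \<open>Chains of braiding involutions\<close>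

context group
begin

text \<open>No inverses occur because the generators are involutions, and induction over the last factor
  suits the right multiplications below better than the general products of \<open>generate.induct\<close>.\<close>

lemma generate_involutions_induct:
  assumes x: "x \<in> generate G S" and S: "S \<subseteq> carrier G" "\<And>s. s \<in> S \<Longrightarrow> s \<otimes> s = \<one>"
    and one: "P \<one>" and step: "\<And>y s. y \<in> generate G S \<Longrightarrow> s \<in> S \<Longrightarrow> P y \<Longrightarrow> P (y \<otimes> s)"
  shows "P x"
proof -
  have i: "inv s = s" if "s \<in> S" for s
    using S that inv_equality by blast
  have c: "generate G S \<subseteq> carrier G" using generate_in_carrier[OF S(1)] by blast
  have "\<forall>y \<in> generate G S. P y \<longrightarrow> P (y \<otimes> x)"
    using x
  proof (induction rule: generate.induct)
    case one
    then show ?case using c by auto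
  next
    case (incl h)
    then show ?case using step by blast
  next
    case (inv h)
    show ?case unfolding i[OF inv] using step[OF _ inv] by simp
  next
    case (eng h1 h2)
    show ?case
    proof (intro ballI impI)
      fix y assume y: "y \<in> generate G S" "P y"
      have "y \<otimes> h1 \<in> generate G S" using y(1) eng(1) by (rule generate.eng)
      moreover have "P (y \<otimes> h1)" using eng.IH(1) y by simp
      ultimately have "P (y \<otimes> h1 \<otimes> h2)" using eng.IH(2) by simp
      moreover have "y \<in> carrier G" "h1 \<in> carrier G" "h2 \<in> carrier G" using y eng c by auto
      ultimately show "P (y \<otimes> (h1 \<otimes> h2))" by (simp add: m_assoc)
    qed
  qed
  then have "P (\<one> \<otimes> x)" using one generate.one by blast
  moreover have "x \<in> carrier G" using x c by blast
  ultimately show ?thesis by simp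
qed

lemma generate_commute:
  assumes x: "x \<in> generate G S" and S: "S \<subseteq> carrier G" and y: "y \<in> carrier G"
    and comm: "\<And>s. s \<in> S \<Longrightarrow> s \<otimes> y = y \<otimes> s"
  shows "x \<otimes> y = y \<otimes> x"
  using x
proof (induction rule: generate.induct)
  case one
  then show ?case using y by simp
next
  case (incl h)
  then show ?case using comm by simp
next
  case (inv h)
  then have h: "h \<in> carrier G" using S by blast
  have "inv h \<otimes> y = inv h \<otimes> (y \<otimes> h) \<otimes> inv h" using h y by (simp add: m_assoc)
  also have "\<dots> = inv h \<otimes> (h \<otimes> y) \<otimes> inv h" using comm inv by simp
  also have "\<dots> = y \<otimes> inv h" using h y by (simp add: m_assoc[symmetric])
  finally show ?case .
next
  case (eng h1 h2)
  then have "h1 \<in> carrier G" "h2 \<in> carrier G" using generate_in_carrier[OF S] by auto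
  then show ?case using eng y m_assoc by metis
qed

end

text \<open>The elements \<open>s 0, \<dots>, s (n - 1)\<close> satisfy the Coxeter relations of type \<open>A\<close>, and \<open>\<theta>\<close>,
  multiplicative for the left-to-right product of permutations, sends them to the transpositions of
  consecutive points of the path \<open>p 0, \<dots>, p n\<close>. The subgroup generated by \<open>s a, \<dots>, s (n - 1)\<close>
  then turns out to be the symmetric group on the points from \<open>p a\<close> on.\<close>

locale braid_path = group G for G (structure) +
  fixes n :: nat and s :: "nat \<Rightarrow> 'a" and p :: "nat \<Rightarrow> 'b" and \<theta> :: "'a \<Rightarrow> 'b \<Rightarrow> 'b"
  assumes s_closed: "i < n \<Longrightarrow> s i \<in> carrier G"
    and s_square: "i < n \<Longrightarrow> s i \<otimes> s i = \<one>"
    and s_braid: "Suc i < n \<Longrightarrow> s i \<otimes> s (Suc i) \<otimes> s i = s (Suc i) \<otimes> s i \<otimes> s (Suc i)"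
    and s_commute: "j < n \<Longrightarrow> Suc i < j \<Longrightarrow> s i \<otimes> s j = s j \<otimes> s i"
    and \<theta>_one: "\<theta> \<one> = id"
    and \<theta>_mult: "x \<in> carrier G \<Longrightarrow> y \<in> carrier G \<Longrightarrow> \<theta> (x \<otimes> y) = \<theta> y \<circ> \<theta> x"
    and \<theta>_s: "i < n \<Longrightarrow> \<theta> (s i) = transpose (p i) (p (Suc i))"
    and p_inj: "inj_on p {..n}"
begin

abbreviation tail :: "nat \<Rightarrow> 'a set" where
  "tail a \<equiv> generate G (s ` {a..<n})"

primrec run :: "nat \<Rightarrow> nat \<Rightarrow> 'a" where
  "run a 0 = \<one>"
| "run a (Suc m) = run a m \<otimes> s (a + m)"

lemma run_closed: "a + m \<le> n \<Longrightarrow> run a m \<in> carrier G"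
  by (induction m) (auto simp: s_closed)

lemma tail_closed: "x \<in> tail a \<Longrightarrow> x \<in> carrier G"
  by (rule generate_in_carrier[of "s ` {a..<n}"]) (auto simp: s_closed)

lemma run_commute:
  assumes "a + m < j" "j < n"
  shows "s j \<otimes> run a m = run a m \<otimes> s j"
  using assms
proof (induction m)
  case 0
  then show ?case by (simp add: s_closed)
next
  case (Suc m)
  then have c: "s j \<in> carrier G" "run a m \<in> carrier G" "s (a + m) \<in> carrier G"
    by (auto simp: s_closed run_closed)
  have "s j \<otimes> (run a m \<otimes> s (a + m)) = run a m \<otimes> (s j \<otimes> s (a + m))"
    using Suc c by (simp add: m_assoc[symmetric])
  also have "\<dots> = run a m \<otimes> (s (a + m) \<otimes> s j)"
    using s_commute[of j "a + m"] Suc by simp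
  finally show ?case using c by (simp add: m_assoc)
qed

lemma run_shift:
  assumes "a \<le> j" "Suc j < a + m" "a + m \<le> n"
  shows "run a m \<otimes> s j = s (Suc j) \<otimes> run a m"
  using assms
proof (induction m)
  case 0
  then show ?case by simp
next
  case (Suc m)
  then have c: "run a m \<in> carrier G" "s (a + m) \<in> carrier G" "s j \<in> carrier G"
      "s (Suc j) \<in> carrier G"
    by (auto simp: s_closed run_closed)
  show ?case
  proof (cases "Suc j < a + m")
    case True
    have "run a m \<otimes> s (a + m) \<otimes> s j = run a m \<otimes> s j \<otimes> s (a + m)"
      using c s_commute[of "a + m" j] True Suc.prems by (simp add: m_assoc)
    then show ?thesis using Suc True c by (simp add: m_assoc)
  next
    case False
    then have am: "a + m = Suc j" using Suc by simp
    then obtain k where k: "m = Suc k" "a + k = j" using Suc.prems(1) by (cases m) auto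
    have ck: "run a k \<in> carrier G" using Suc k run_closed by simp
    have rm: "run a m = run a k \<otimes> s j" using k by auto
    have "run a (Suc m) \<otimes> s j = run a k \<otimes> (s j \<otimes> s (Suc j) \<otimes> s j)"
      using rm am c ck by (simp add: m_assoc)
    also have "\<dots> = run a k \<otimes> (s (Suc j) \<otimes> s j \<otimes> s (Suc j))"
      using s_braid[of j] Suc am by simp
    also have "\<dots> = (run a k \<otimes> s (Suc j)) \<otimes> (s j \<otimes> s (Suc j))"
      using c ck by (simp add: m_assoc)
    also have "\<dots> = (s (Suc j) \<otimes> run a k) \<otimes> (s j \<otimes> s (Suc j))"
      using run_commute[of a k "Suc j"] k am Suc by simp
    finally show ?thesis using rm am c ck by (simp add: m_assoc)
  qed
qed

text \<open>The runs \<open>s a \<cdots> s (a + m - 1)\<close> represent all right cosets of the subgroup generated by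
  the elements after \<open>s a\<close>: multiplication of a run by some \<open>s j\<close> on the right shortens it,
  lengthens it, or lets \<open>s j\<close> or \<open>s (j + 1)\<close> pass to the left.\<close>

lemma tail_decomp:
  assumes "w \<in> tail a" "a \<le> n"
  shows "\<exists>h\<in>tail (Suc a). \<exists>m. a + m \<le> n \<and> w = h \<otimes> run a m"
  using assms(1)
proof (rule generate_involutions_induct)
  show "s ` {a..<n} \<subseteq> carrier G" by (auto simp: s_closed)
  show "\<And>x. x \<in> s ` {a..<n} \<Longrightarrow> x \<otimes> x = \<one>" by (auto simp: s_square)
  show "\<exists>h\<in>tail (Suc a). \<exists>m. a + m \<le> n \<and> \<one> = h \<otimes> run a m"
    using assms(2) by (intro bexI[of _ \<one>] exI[of _ 0]) (auto intro: generate.one)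
next
  fix y x assume "x \<in> s ` {a..<n}" "\<exists>h\<in>tail (Suc a). \<exists>m. a + m \<le> n \<and> y = h \<otimes> run a m"
  then obtain h m j where h: "h \<in> tail (Suc a)" "a + m \<le> n" "y = h \<otimes> run a m"
    and j: "a \<le> j" "j < n" "x = s j" by auto
  have c: "h \<in> carrier G" "run a m \<in> carrier G" "s j \<in> carrier G"
    using h j by (auto simp: tail_closed run_closed s_closed)
  have in_tail: "h \<otimes> s i \<in> tail (Suc a)" if "a < i" "i < n" for i
    using h(1) that by (intro generate.eng[OF _ generate.incl]) auto
  consider "Suc j < a + m" | "Suc j = a + m" | "j = a + m" | "a + m < j" by linarith
  then show "\<exists>h\<in>tail (Suc a). \<exists>m. a + m \<le> n \<and> y \<otimes> x = h \<otimes> run a m"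
  proof cases
    case 1
    then have "s (Suc j) \<in> carrier G" using h s_closed by auto
    then have "y \<otimes> x = (h \<otimes> s (Suc j)) \<otimes> run a m"
      using run_shift[of a j m] 1 h j c by (simp add: m_assoc)
    then show ?thesis using in_tail[of "Suc j"] 1 h j by auto
  next
    case 2
    then obtain k where k: "m = Suc k" "a + k = j" using j by (cases m) auto
    have "run a k \<in> carrier G" using k h run_closed by simp
    then have "y \<otimes> x = h \<otimes> run a k" using h j k c s_square by (simp add: m_assoc)
    then show ?thesis using h k j by (metis Suc_leD add_Suc_right)
  next
    case 3
    have "y \<otimes> x = h \<otimes> run a (Suc m)" using 3 h j c by (simp add: m_assoc)
    then show ?thesis using h j 3 by (intro bexI[of _ h] exI[of _ "Suc m"]) auto
  next
    case 4
    have "y \<otimes> x = (h \<otimes> s j) \<otimes> run a m"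
      using run_commute[of a m j] 4 h j c by (simp add: m_assoc)
    then show ?thesis using in_tail[of j] 4 h j by (metis le_add1 le_less_trans)
  qed
qed

lemma \<theta>_run: "a + m \<le> n \<Longrightarrow> \<theta> (run a m) (p a) = p (a + m)"
  by (induction m) (auto simp: \<theta>_one \<theta>_mult run_closed s_closed \<theta>_s)

lemma \<theta>_tail_fixes:
  assumes "h \<in> tail a" "i < a"
  shows "\<theta> h (p i) = p i"
  using assms(1)
proof (rule generate_involutions_induct)
  show "s ` {a..<n} \<subseteq> carrier G" by (auto simp: s_closed)
  show "\<And>x. x \<in> s ` {a..<n} \<Longrightarrow> x \<otimes> x = \<one>" by (auto simp: s_square)
  show "\<theta> \<one> (p i) = p i" by (simp add: \<theta>_one)
next
  fix y x assume y: "y \<in> tail a" "x \<in> s ` {a..<n}" "\<theta> y (p i) = p i"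
  then obtain j where j: "a \<le> j" "j < n" "x = s j" by auto
  have "p i \<noteq> p j" "p i \<noteq> p (Suc j)"
    using inj_onD[OF p_inj, of i j] inj_onD[OF p_inj, of i "Suc j"] assms(2) j by auto
  then show "\<theta> (y \<otimes> x) (p i) = p i"
    using y j by (simp add: \<theta>_mult tail_closed s_closed \<theta>_s transpose_def)
qed

text \<open>The run in the coset decomposition moves \<open>p a\<close> by its length, so it is empty when \<open>p a\<close> is
  fixed.\<close>

lemma tail_stabilizer:
  assumes "w \<in> tail a" "a \<le> n" "\<theta> w (p a) = p a"
  shows "w \<in> tail (Suc a)"
proof -
  obtain h m where h: "h \<in> tail (Suc a)" "a + m \<le> n" "w = h \<otimes> run a m"
    using tail_decomp[OF assms(1,2)] by blast
  have "\<theta> w (p a) = \<theta> (run a m) (\<theta> h (p a))"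
    using h(3) \<theta>_mult[OF tail_closed[OF h(1)] run_closed[OF h(2)]] by simp
  then have "\<theta> w (p a) = p (a + m)"
    using \<theta>_tail_fixes[OF h(1), of a] \<theta>_run[OF h(2)] by simp
  then have "m = 0" using assms(3) inj_onD[OF p_inj, of "a + m" a] h(2) by auto
  then show ?thesis using h tail_closed[OF h(1)] by simp
qed

lemma tail_faithful:
  assumes "w \<in> tail a" "a \<le> n" "\<And>i. a \<le> i \<Longrightarrow> i < n \<Longrightarrow> \<theta> w (p i) = p i"
  shows "w = \<one>"
  using assms
proof (induction "n - a" arbitrary: a)
  case 0
  then show ?case using generate_empty by simp
next
  case (Suc d)
  then show ?case using tail_stabilizer[of w a] Suc.hyps(1)[of "Suc a"] by simp
qed

text \<open>A run carries \<open>p a\<close> to any prescribed later point; what remains is a permutation of the points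
  after \<open>p a\<close>.\<close>

lemma tail_surj:
  assumes "q permutes (p ` {a..n})" "a \<le> n"
  shows "\<exists>h\<in>tail a. \<theta> h = q"
  using assms
proof (induction "n - a" arbitrary: a q)
  case 0
  then have "q permutes {p n}" by simp
  then have "q = id" by simp
  then show ?case using generate.one[of G "s ` {a..<n}"] \<theta>_one by blast
next
  case (Suc d)
  have "q (p a) \<in> p ` {a..n}"
    using Suc.prems permutes_in_image[of q "p ` {a..n}" "p a"] by auto
  then obtain i where "a \<le> i" "i \<le> n" "q (p a) = p i" by auto
  then obtain m where m: "a + m \<le> n" "q (p a) = p (a + m)" by (metis le_Suc_ex)
  let ?r = "run a m"
  have r: "?r \<in> tail a" "\<theta> ?r permutes p ` {a..n}" using m(1)
  proof (induction m)
    case 0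
    { case 1 then show ?case by (simp add: generate.one) }
    { case 2 show ?case unfolding run.simps \<theta>_one by (rule permutes_id) }
  next
    case (Suc m)
    have c: "\<theta> (run a (Suc m)) = transpose (p (a+m)) (p (Suc (a+m))) \<circ> \<theta> (run a m)" if "a + Suc m \<le> n"
      using that by (simp add: \<theta>_mult run_closed s_closed \<theta>_s)
    { case 1
      then have "run a m \<otimes> s (a + m) \<in> tail a"
        using Suc(1) by (intro generate.eng[OF _ generate.incl]) auto
      then show ?case by simp }
    { case 2 then show ?case unfolding c[OF 2] using Suc(2)
        by (intro permutes_compose permutes_swap_id) auto }
  qed
  have bij: "bij (\<theta> ?r)" using r(2) by (rule permutes_bij)
  define q' where "q' = Hilbert_Choice.inv (\<theta> ?r) \<circ> q"
  have q': "q' permutes p ` {a..n}"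
    unfolding q'_def using r Suc.prems by (intro permutes_compose permutes_inv)
  have "q' (p a) = p a"
    unfolding q'_def using m bij \<theta>_run[OF m(1)] by (metis bij_inv_eq_iff comp_apply)
  moreover have "p ` {a..n} = insert (p a) (p ` {Suc a..n})"
    using Suc.prems by (metis atLeastAtMost_insertL image_insert)
  ultimately have "q' permutes p ` {Suc a..n}"
    using q' by (auto intro: permutes_superset)
  moreover have "d = n - Suc a" "Suc a \<le> n" using Suc.hyps(2) by auto
  ultimately obtain h where h: "h \<in> tail (Suc a)" "\<theta> h = q'"
    using Suc.hyps(1)[of "Suc a" q'] by blast
  have "tail (Suc a) \<subseteq> tail a" by (intro mono_generate image_mono) auto
  then have "h \<otimes> ?r \<in> tail a" using h r by (auto intro: generate.eng)
  moreover have "\<theta> (h \<otimes> ?r) = q"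
  proof
    fix x
    have "\<theta> (h \<otimes> ?r) x = \<theta> ?r (q' x)"
      using \<theta>_mult[OF tail_closed[OF h(1)] run_closed[OF m(1)]] h(2) by simp
    also have "\<dots> = q x"
      using bij by (simp add: q'_def bij_is_surj surj_f_inv_f)
    finally show "\<theta> (h \<otimes> ?r) x = q x" .
  qed
  ultimately show ?case by blast
qed

end

section \<open>Conjugation\<close>

context group
begin

definition conjugate :: "'a \<Rightarrow> 'a \<Rightarrow> 'a" where
  "conjugate h x = h \<otimes> x \<otimes> inv h"

lemma conjugate_closed [simp]:
  "h \<in> carrier G \<Longrightarrow> x \<in> carrier G \<Longrightarrow> conjugate h x \<in> carrier G"
  by (simp add: conjugate_def)

lemma inv_cancel_left:
  assumes "h \<in> carrier G" "x \<in> carrier G"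
  shows "inv h \<otimes> (h \<otimes> x) = x" "h \<otimes> (inv h \<otimes> x) = x"
  using assms by (simp_all add: m_assoc[symmetric])

lemma conjugate_mult:
  "\<lbrakk>h \<in> carrier G; x \<in> carrier G; y \<in> carrier G\<rbrakk> \<Longrightarrow>
    conjugate h (x \<otimes> y) = conjugate h x \<otimes> conjugate h y"
  by (simp add: conjugate_def m_assoc inv_cancel_left)

lemma conjugate_hom: "h \<in> carrier G \<Longrightarrow> conjugate h \<in> hom G G"
  by (simp add: hom_def conjugate_mult)

lemma conjugate_inv:
  "\<lbrakk>h \<in> carrier G; x \<in> carrier G\<rbrakk> \<Longrightarrow> conjugate h (inv x) = inv (conjugate h x)"
  by (simp add: conjugate_def inv_mult_group m_assoc)

lemma conjugate_one [simp]: "h \<in> carrier G \<Longrightarrow> conjugate h \<one> = \<one>"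
  by (simp add: conjugate_def)

lemma conjugate_int_pow:
  assumes "h \<in> carrier G" "x \<in> carrier G"
  shows "conjugate h (x [^] (n::int)) = conjugate h x [^] n"
  using hom_int_pow[OF conjugate_hom, of h x n] assms is_group by simp

lemma conjugate_conjugate:
  "\<lbrakk>h \<in> carrier G; k \<in> carrier G; x \<in> carrier G\<rbrakk> \<Longrightarrow>
    conjugate h (conjugate k x) = conjugate (h \<otimes> k) x"
  by (simp add: conjugate_def inv_mult_group m_assoc)

lemma conjugate_commuting:
  "\<lbrakk>h \<in> carrier G; x \<in> carrier G; h \<otimes> x = x \<otimes> h\<rbrakk> \<Longrightarrow> conjugate h x = x"
  by (simp add: conjugate_def m_assoc)

lemma conjugate_by_inverse:
  "\<lbrakk>h \<in> carrier G; k \<in> carrier G; x \<in> carrier G; k \<otimes> h = \<one>; y = conjugate h x\<rbrakk> \<Longrightarrow>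
    x = conjugate k y"
  by (simp add: conjugate_conjugate) (simp add: conjugate_def)

lemma involution_inv: "s \<in> carrier G \<Longrightarrow> s \<otimes> s = \<one> \<Longrightarrow> inv s = s"
  using inv_equality by blast

lemma involution_cancel:
  "\<lbrakk>s \<otimes> s = \<one>; s \<in> carrier G; x \<in> carrier G\<rbrakk> \<Longrightarrow> s \<otimes> (s \<otimes> x) = x"
  by (simp add: m_assoc[symmetric])

lemma commute_mult:
  assumes "x \<in> carrier G" "y \<in> carrier G" "z \<in> carrier G"
    and "z \<otimes> x = x \<otimes> z" "z \<otimes> y = y \<otimes> z"
  shows "z \<otimes> (x \<otimes> y) = (x \<otimes> y) \<otimes> z"
  using assms by (metis m_assoc)

lemma commute_inv:
  "\<lbrakk>x \<in> carrier G; z \<in> carrier G; z \<otimes> x = x \<otimes> z\<rbrakk> \<Longrightarrow> z \<otimes> inv x = inv x \<otimes> z"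
proof -
  assume c: "x \<in> carrier G" "z \<in> carrier G" and e: "z \<otimes> x = x \<otimes> z"
  have "z \<otimes> inv x = inv x \<otimes> (x \<otimes> z) \<otimes> inv x" using c by (simp add: inv_cancel_left)
  also have "\<dots> = inv x \<otimes> z" unfolding e[symmetric] using c by (simp add: m_assoc)
  finally show ?thesis .
qed

lemma commute_int_pow:
  assumes "x \<in> carrier G" "z \<in> carrier G" "z \<otimes> x = x \<otimes> z"
  shows "z \<otimes> x [^] (n::int) = x [^] n \<otimes> z"
proof -
  have "conjugate z (x [^] n) = x [^] n"
    using assms conjugate_int_pow conjugate_commuting by simp
  then have "x [^] n \<otimes> z = z \<otimes> x [^] n \<otimes> inv z \<otimes> z" unfolding conjugate_def by simp
  then show ?thesis using assms by (simp add: m_assoc)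
qed

text \<open>This turns the twisting relations into conjugations: the second factor on the left is
  \<open>s\<close> conjugated by \<open>t t'\<close>, and the braid relations let the product with \<open>s\<close> collapse.\<close>

lemma twist_conjugate:
  assumes c: "s \<in> carrier G" "t \<in> carrier G" "t' \<in> carrier G"
    and sq: "s \<otimes> s = \<one>" "t \<otimes> t = \<one>" "t' \<otimes> t' = \<one>"
    and b: "s \<otimes> t \<otimes> s = t \<otimes> s \<otimes> t" "s \<otimes> t' \<otimes> s = t' \<otimes> s \<otimes> t'"
  shows "s \<otimes> (t \<otimes> t' \<otimes> s \<otimes> t' \<otimes> t) = conjugate (t \<otimes> s) (t \<otimes> t')"
proof -
  have "s \<otimes> (t \<otimes> t' \<otimes> s \<otimes> t' \<otimes> t) = s \<otimes> t \<otimes> (t' \<otimes> s \<otimes> t') \<otimes> t"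
    using c by (simp add: m_assoc)
  also have "\<dots> = (s \<otimes> t \<otimes> s) \<otimes> t' \<otimes> s \<otimes> t"
    unfolding b(2)[symmetric] using c by (simp add: m_assoc)
  also have "\<dots> = t \<otimes> s \<otimes> t \<otimes> t' \<otimes> s \<otimes> t"
    unfolding b(1) by simp
  also have "\<dots> = conjugate (t \<otimes> s) (t \<otimes> t')"
    using c sq by (simp add: conjugate_def involution_inv inv_mult_group m_assoc)
  finally show ?thesis .
qed

text \<open>In the application \<open>t, u, v\<close> are the three transpositions of a copy of \<open>S\<^sub>3\<close> and
  \<open>x, y, z\<close> are the conjugates of \<open>t r\<close> that belong to the three edges of an oriented triangle.\<close>

lemma triangle_relations:
  assumes c: "t \<in> carrier G" "u \<in> carrier G" "v \<in> carrier G" "r \<in> carrier G"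
    and sq: "t \<otimes> t = \<one>" "u \<otimes> u = \<one>" "v \<otimes> v = \<one>" "r \<otimes> r = \<one>"
    and S3: "t \<otimes> v \<otimes> t = u" "v \<otimes> t \<otimes> v = u" "u \<otimes> t \<otimes> u = v"
    and b: "r \<otimes> u \<otimes> r = u \<otimes> r \<otimes> u" "r \<otimes> v \<otimes> r = v \<otimes> r \<otimes> v"
  defines "x \<equiv> t \<otimes> r" and "y \<equiv> v \<otimes> (r \<otimes> t) \<otimes> v" and "z \<equiv> u \<otimes> (r \<otimes> t) \<otimes> u"
  shows "x \<otimes> y \<otimes> z = \<one>" "y \<otimes> x \<otimes> z = \<one>"
proof -
  note cancel = involution_cancel[OF sq(1)] involution_cancel[OF sq(2)]
    involution_cancel[OF sq(3)] involution_cancel[OF sq(4)]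
  have "x \<otimes> y \<otimes> z = t \<otimes> (r \<otimes> v \<otimes> r) \<otimes> t \<otimes> v \<otimes> u \<otimes> r \<otimes> t \<otimes> u"
    unfolding x_def y_def z_def using c by (simp add: m_assoc)
  also have "\<dots> = t \<otimes> v \<otimes> r \<otimes> (v \<otimes> t \<otimes> v) \<otimes> u \<otimes> r \<otimes> t \<otimes> u"
    unfolding b(2) using c by (simp add: m_assoc)
  also have "\<dots> = (t \<otimes> v \<otimes> t) \<otimes> u"
    unfolding S3(2) using c sq cancel by (simp add: m_assoc)
  also have "\<dots> = \<one>" using S3(1) sq by simp
  finally show "x \<otimes> y \<otimes> z = \<one>" .
  have "y \<otimes> x \<otimes> z = v \<otimes> r \<otimes> (t \<otimes> v \<otimes> t) \<otimes> r \<otimes> u \<otimes> r \<otimes> t \<otimes> u"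
    unfolding x_def y_def z_def using c by (simp add: m_assoc)
  also have "\<dots> = v \<otimes> (r \<otimes> u \<otimes> r) \<otimes> u \<otimes> r \<otimes> t \<otimes> u"
    unfolding S3(1) using c by (simp add: m_assoc)
  also have "\<dots> = v \<otimes> (u \<otimes> t \<otimes> u)"
    unfolding b(1) using c sq cancel by (simp add: m_assoc)
  also have "\<dots> = \<one>" using S3(3) sq by simp
  finally show "y \<otimes> x \<otimes> z = \<one>" .
qed

text \<open>Conjugation by a power of \<open>b\<close> changes \<open>b\<^sup>p s\<close> to \<open>b\<^sup>p\<^sup>+\<^sup>2\<^sup>q s\<close>, so braid relations for all
  elements \<open>b\<^sup>m s\<close> with a fixed \<open>u\<close> spread to the conjugates of \<open>u\<close> by powers of \<open>b\<close>.\<close>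

lemma braid_shift:
  assumes c: "s \<in> carrier G" "b \<in> carrier G" "u \<in> carrier G"
    and inv: "\<And>n::int. s \<otimes> b [^] n = b [^] (- n) \<otimes> s"
    and braid: "\<And>m::int. (b [^] m \<otimes> s) \<otimes> u \<otimes> (b [^] m \<otimes> s) = u \<otimes> (b [^] m \<otimes> s) \<otimes> u"
    and a: "a = b [^] (p::int) \<otimes> s" and v: "v = b [^] (- q) \<otimes> u \<otimes> b [^] (q::int)"
  shows "a \<otimes> v \<otimes> a = v \<otimes> a \<otimes> v"
proof -
  let ?h = "b [^] (- q)"
  let ?a = "b [^] (p + 2 * q) \<otimes> s"
  have h: "?h \<in> carrier G" "inv ?h = b [^] q" using c by (simp_all add: int_pow_neg)
  have "conjugate ?h ?a = ?h \<otimes> b [^] (p + 2 * q) \<otimes> (s \<otimes> b [^] q)"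
    using c h by (simp add: conjugate_def m_assoc)
  also have "\<dots> = b [^] (- q) \<otimes> b [^] (p + 2 * q) \<otimes> b [^] (- q) \<otimes> s"
    unfolding inv using c by (simp add: m_assoc)
  also have "\<dots> = b [^] (- q + (p + 2 * q) + - q) \<otimes> s"
    unfolding int_pow_mult[OF c(2)] ..
  also have "\<dots> = a" using a by simp
  finally have "conjugate ?h ?a = a" .
  moreover have "conjugate ?h u = v" using v h by (simp add: conjugate_def)
  moreover have "conjugate ?h (?a \<otimes> u \<otimes> ?a) = conjugate ?h (u \<otimes> ?a \<otimes> u)"
    using braid by simp
  ultimately show ?thesis using c h(1) by (simp add: conjugate_mult)
qed

end

section \<open>The two sets of relations in an arbitrary group\<close>

text \<open>The defining relations of \<open>Pi1\<close>, read in an arbitrary group. They are used twice: for the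
  generators of \<open>Pi1\<close> themselves and for their images in a semidirect product. The same holds for
  the next locale and the presentation of the kernel.\<close>

locale pi_family = group G for G (structure) +
  fixes g g' :: "nat \<Rightarrow> 'a"
  assumes g_closed: "j \<in> {1..6} \<Longrightarrow> g j \<in> carrier G"
    and g'_closed: "j \<in> {1..6} \<Longrightarrow> g' j \<in> carrier G"
    and g_square: "j \<in> {1..6} \<Longrightarrow> g j \<otimes> g j = \<one>"
    and g'_square: "j \<in> {1..6} \<Longrightarrow> g' j \<otimes> g' j = \<one>"
    and twist: "g' 3 = g 1 \<otimes> g' 1 \<otimes> g 3 \<otimes> g' 1 \<otimes> g 1"
      "g' 5 = g 4 \<otimes> g' 4 \<otimes> g 5 \<otimes> g' 4 \<otimes> g 4"
      "g 2 = g' 6 \<otimes> g 6 \<otimes> g' 2 \<otimes> g 6 \<otimes> g' 6"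
      "g' 2 = g 1 \<otimes> g' 1 \<otimes> g 2 \<otimes> g' 1 \<otimes> g 1"
      "g 3 = g' 4 \<otimes> g 4 \<otimes> g' 3 \<otimes> g 4 \<otimes> g' 4"
      "g 5 = g' 6 \<otimes> g 6 \<otimes> g' 5 \<otimes> g 6 \<otimes> g' 6"
    and braid: "\<lbrakk>i \<in> {1..6}; j \<in> {1..6}; {i, j} \<in> pi_edges;
        a = (g i \<otimes> g' i) [^] (p::int) \<otimes> g i; b = (g j \<otimes> g' j) [^] (q::int) \<otimes> g j\<rbrakk>
      \<Longrightarrow> a \<otimes> b \<otimes> a = b \<otimes> a \<otimes> b"
    and far: "\<lbrakk>i \<in> {1..6}; j \<in> {1..6}; i \<noteq> j; {i, j} \<notin> pi_edges;
        a \<in> {g i, g' i}; b \<in> {g j, g' j}\<rbrakk> \<Longrightarrow> a \<otimes> b = b \<otimes> a"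

locale xa_family = group G for G (structure) +
  fixes I :: "'i set" and X A :: "'i \<Rightarrow> 'i \<Rightarrow> 'a"
  assumes X_closed: "\<lbrakk>i \<in> I; j \<in> I; i \<noteq> j\<rbrakk> \<Longrightarrow> X i j \<in> carrier G"
    and A_closed: "\<lbrakk>i \<in> I; j \<in> I; i \<noteq> j\<rbrakk> \<Longrightarrow> A i j \<in> carrier G"
    and flip: "\<lbrakk>i \<in> I; j \<in> I; i \<noteq> j\<rbrakk> \<Longrightarrow>
      X j i \<otimes> A j i [^] (n::int) = inv (X i j \<otimes> A i j [^] n)"
    and triangle: "\<lbrakk>i \<in> I; j \<in> I; k \<in> I; distinct [i, j, k]\<rbrakk> \<Longrightarrow>
      (X i j \<otimes> A i j [^] (n::int)) \<otimes> (X j k \<otimes> A j k [^] n) \<otimes> (X k i \<otimes> A k i [^] n) = \<one>"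
    and triangle': "\<lbrakk>i \<in> I; j \<in> I; k \<in> I; distinct [i, j, k]\<rbrakk> \<Longrightarrow>
      (X j k \<otimes> A j k [^] (n::int)) \<otimes> (X i j \<otimes> A i j [^] n) \<otimes> (X k i \<otimes> A k i [^] n) = \<one>"
    and quad: "\<lbrakk>i \<in> I; j \<in> I; k \<in> I; l \<in> I; distinct [i, j, k, l]\<rbrakk> \<Longrightarrow>
      A i j \<otimes> inv A i k = A k l \<otimes> inv A j l"

abbreviation idx :: "nat set" where "idx \<equiv> {1..6}"

lemma letter_words: "letter g \<in> words S \<longleftrightarrow> g \<in> S"
  by (simp add: letter_def)

lemma word_pow_words: "w \<in> words S \<Longrightarrow> word_pow w n \<in> words S"
proof -
  have "v \<in> words S \<Longrightarrow> concat (replicate k v) \<in> words S" for v :: "'a word" and k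
    by (induction k) auto
  then show "w \<in> words S \<Longrightarrow> word_pow w n \<in> words S" by (simp add: word_pow_def)
qed

lemma pi_gens_mem [simp]: "Gam j \<in> pi_gens \<longleftrightarrow> j \<in> idx" "Gam' j \<in> pi_gens \<longleftrightarrow> j \<in> idx"
  by (auto simp: pi_gens_def)

lemma xa_gens_mem [simp]:
  "Xg i j \<in> xa_gens \<longleftrightarrow> i \<in> idx \<and> j \<in> idx \<and> i \<noteq> j"
  "Ag i j \<in> xa_gens \<longleftrightarrow> i \<in> idx \<and> j \<in> idx \<and> i \<noteq> j"
  by (auto simp: xa_gens_def)

abbreviation pi_val :: "(nat \<Rightarrow> 'a) \<Rightarrow> (nat \<Rightarrow> 'a) \<Rightarrow> pi_gen \<Rightarrow> 'a" where
  "pi_val g g' \<equiv> (\<lambda>x. case x of Gam j \<Rightarrow> g j | Gam' j \<Rightarrow> g' j)"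

abbreviation xa_val :: "(nat \<Rightarrow> nat \<Rightarrow> 'a) \<Rightarrow> (nat \<Rightarrow> nat \<Rightarrow> 'a) \<Rightarrow> xa_gen \<Rightarrow> 'a" where
  "xa_val X A \<equiv> (\<lambda>x. case x of Xg i j \<Rightarrow> X i j | Ag i j \<Rightarrow> A i j)"

lemma pi_gens_cases:
  assumes "x \<in> pi_gens"
  obtains j where "j \<in> idx" "x = Gam j" | j where "j \<in> idx" "x = Gam' j"
  using assms by (auto simp: pi_gens_def)

lemma xa_gens_cases:
  assumes "x \<in> xa_gens"
  obtains i j where "i \<in> idx" "j \<in> idx" "i \<noteq> j" "x = Xg i j"
    | i j where "i \<in> idx" "j \<in> idx" "i \<noteq> j" "x = Ag i j"
  using assms unfolding xa_gens_def by blast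

lemma pi_relsI:
  "j \<in> idx \<Longrightarrow> (gam j @ gam j, []) \<in> pi_rels"
  "j \<in> idx \<Longrightarrow> (gam' j @ gam' j, []) \<in> pi_rels"
  "(gam' 3, gam 1 @ gam' 1 @ gam 3 @ gam' 1 @ gam 1) \<in> pi_rels"
  "(gam' 5, gam 4 @ gam' 4 @ gam 5 @ gam' 4 @ gam 4) \<in> pi_rels"
  "(gam 2, gam' 6 @ gam 6 @ gam' 2 @ gam 6 @ gam' 6) \<in> pi_rels"
  "(gam' 2, gam 1 @ gam' 1 @ gam 2 @ gam' 1 @ gam 1) \<in> pi_rels"
  "(gam 3, gam' 4 @ gam 4 @ gam' 3 @ gam 4 @ gam' 4) \<in> pi_rels"
  "(gam 5, gam' 6 @ gam 6 @ gam' 5 @ gam 6 @ gam' 6) \<in> pi_rels"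
  unfolding pi_rels_def
  by (rule UnI1, rule UnI1, rule UnI1, rule UnI1, blast)
    (rule UnI1, rule UnI1, rule UnI1, rule UnI2, blast,
      (rule UnI1, rule UnI1, rule UnI2, simp)+)

lemma xa_relsI:
  "\<lbrakk>i \<in> idx; j \<in> idx; i \<noteq> j\<rbrakk> \<Longrightarrow> (XA j i n, word_inv (XA i j n)) \<in> xa_rels"
  "\<lbrakk>i \<in> idx; j \<in> idx; k \<in> idx; distinct [i, j, k]\<rbrakk> \<Longrightarrow>
    (XA i j n @ XA j k n @ XA k i n, []) \<in> xa_rels"
  "\<lbrakk>i \<in> idx; j \<in> idx; k \<in> idx; distinct [i, j, k]\<rbrakk> \<Longrightarrow>
    (XA j k n @ XA i j n @ XA k i n, []) \<in> xa_rels"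
  "\<lbrakk>i \<in> idx; j \<in> idx; k \<in> idx; l \<in> idx; distinct [i, j, k, l]\<rbrakk> \<Longrightarrow>
    (letter (Ag i j) @ word_inv (letter (Ag i k)), letter (Ag k l) @ word_inv (letter (Ag j l)))
      \<in> xa_rels"
  unfolding xa_rels_def Un_iff mem_Collect_eq
  subgoal by (rule disjI1, rule disjI1, rule disjI1, rule exI[of _ i], rule exI[of _ j], rule exI[of _ n]) auto
  subgoal by (rule disjI1, rule disjI1, rule disjI2, rule exI[of _ i], rule exI[of _ j], rule exI[of _ k], rule exI[of _ n]) auto
  subgoal by (rule disjI1, rule disjI2, rule exI[of _ i], rule exI[of _ j], rule exI[of _ k], rule exI[of _ n]) auto
  subgoal by (rule disjI2, rule exI[of _ i], rule exI[of _ j], rule exI[of _ k], rule exI[of _ l]) auto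
  done

context
  fixes H :: "('a, 'b) monoid_scheme" (structure) and g g' :: "nat \<Rightarrow> 'a"
  assumes H: "group H" and c: "\<And>j. j \<in> idx \<Longrightarrow> g j \<in> carrier H" "\<And>j. j \<in> idx \<Longrightarrow> g' j \<in> carrier H"
begin

interpretation group H by (rule H)

lemma pi_val_closed: "x \<in> pi_gens \<Longrightarrow> pi_val g g' x \<in> carrier H"
  by (erule pi_gens_cases) (simp_all add: c)

lemma pi_eval_append:
  "u \<in> words pi_gens \<Longrightarrow> v \<in> words pi_gens \<Longrightarrow> word_eval H (pi_val g g') (u @ v) =
    word_eval H (pi_val g g') u \<otimes> word_eval H (pi_val g g') v"
  using word_eval_append[of H pi_gens "pi_val g g'" u v, OF H pi_val_closed] by simp

lemma pi_eval_letter: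
  "j \<in> idx \<Longrightarrow> word_eval H (pi_val g g') (gam j) = g j"
  "j \<in> idx \<Longrightarrow> word_eval H (pi_val g g') (gam' j) = g' j"
  using word_eval_letter[OF H, of "pi_val g g'" "Gam j"]
    word_eval_letter[OF H, of "pi_val g g'" "Gam' j"] by (simp_all add: c)

lemma pi_eval_pow:
  "w \<in> words pi_gens \<Longrightarrow> word_eval H (pi_val g g') (word_pow w n) =
    word_eval H (pi_val g g') w [^] n"
  using word_eval_pow[of H pi_gens "pi_val g g'" w, OF H pi_val_closed] by simp

lemmas pi_eval = pi_eval_append pi_eval_letter pi_eval_pow letter_words word_pow_words

lemma pi_family_rels:
  assumes "pi_family H g g'" and lr: "(l, r) \<in> pi_rels"
  shows "word_eval H (pi_val g g') l = word_eval H (pi_val g g') r"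
proof -
  interpret P: pi_family H g g' by fact
  show ?thesis
    using lr unfolding pi_rels_def
  proof (elim UnE)
    assume "(l, r) \<in> {(gam j @ gam j, []) | j. j \<in> idx}"
    then obtain j where "j \<in> idx" "l = gam j @ gam j" "r = []" by blast
    then show ?thesis by (simp add: pi_eval P.g_square)
  next
    assume "(l, r) \<in> {(gam' j @ gam' j, []) | j. j \<in> idx}"
    then obtain j where "j \<in> idx" "l = gam' j @ gam' j" "r = []" by blast
    then show ?thesis by (simp add: pi_eval P.g'_square)
  next
    assume "(l, r) \<in> {(gam' 3, gam 1 @ gam' 1 @ gam 3 @ gam' 1 @ gam 1),
      (gam' 5, gam 4 @ gam' 4 @ gam 5 @ gam' 4 @ gam 4),
      (gam 2, gam' 6 @ gam 6 @ gam' 2 @ gam 6 @ gam' 6),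
      (gam' 2, gam 1 @ gam' 1 @ gam 2 @ gam' 1 @ gam 1),
      (gam 3, gam' 4 @ gam 4 @ gam' 3 @ gam 4 @ gam' 4),
      (gam 5, gam' 6 @ gam 6 @ gam' 5 @ gam 6 @ gam' 6)}"
    then show ?thesis
    proof (elim insertE emptyE Pair_inject)
      assume lr: "l = gam' 3" "r = gam 1 @ gam' 1 @ gam 3 @ gam' 1 @ gam 1"
      show ?thesis unfolding lr by (simp add: pi_eval P.twist(1) c m_assoc)
    next
      assume lr: "l = gam' 5" "r = gam 4 @ gam' 4 @ gam 5 @ gam' 4 @ gam 4"
      show ?thesis unfolding lr by (simp add: pi_eval P.twist(2) c m_assoc)
    next
      assume lr: "l = gam 2" "r = gam' 6 @ gam 6 @ gam' 2 @ gam 6 @ gam' 6"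
      show ?thesis unfolding lr by (simp add: pi_eval, subst P.twist(3)) (simp add: c m_assoc)
    next
      assume lr: "l = gam' 2" "r = gam 1 @ gam' 1 @ gam 2 @ gam' 1 @ gam 1"
      show ?thesis unfolding lr by (simp add: pi_eval P.twist(4) c m_assoc)
    next
      assume lr: "l = gam 3" "r = gam' 4 @ gam 4 @ gam' 3 @ gam 4 @ gam' 4"
      show ?thesis unfolding lr by (simp add: pi_eval, subst P.twist(5)) (simp add: c m_assoc)
    next
      assume lr: "l = gam 5" "r = gam' 6 @ gam 6 @ gam' 5 @ gam 6 @ gam' 6"
      show ?thesis unfolding lr by (simp add: pi_eval, subst P.twist(6)) (simp add: c m_assoc)
    qed
  next
    assume "(l, r) \<in> {(a @ b @ a, b @ a @ b) | a b i j p q.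
        i \<in> idx \<and> j \<in> idx \<and> {i, j} \<in> pi_edges \<and>
        a = word_pow (gam i @ gam' i) p @ gam i \<and> b = word_pow (gam j @ gam' j) q @ gam j}"
    then obtain a b i j p q where ij: "i \<in> idx" "j \<in> idx" "{i, j} \<in> pi_edges"
      and ab: "a = word_pow (gam i @ gam' i) p @ gam i" "b = word_pow (gam j @ gam' j) q @ gam j"
      and lr: "l = a @ b @ a" "r = b @ a @ b" by blast
    have e: "word_eval H (pi_val g g') a = (g i \<otimes> g' i) [^] p \<otimes> g i"
      "word_eval H (pi_val g g') b = (g j \<otimes> g' j) [^] q \<otimes> g j"
      and w: "a \<in> words pi_gens" "b \<in> words pi_gens"
      using ij ab by (simp_all add: pi_eval)
    show ?thesis
      using P.braid[OF ij e] e ij c w unfolding lr by (simp add: pi_eval_append m_assoc)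
  next
    assume "(l, r) \<in> {(a @ b, b @ a) | a b i j.
        i \<in> idx \<and> j \<in> idx \<and> i \<noteq> j \<and> {i, j} \<notin> pi_edges \<and>
        a \<in> {gam i, gam' i} \<and> b \<in> {gam j, gam' j}}"
    then obtain a b i j where ij: "i \<in> idx" "j \<in> idx" "i \<noteq> j" "{i, j} \<notin> pi_edges"
      and ab: "a \<in> {gam i, gam' i}" "b \<in> {gam j, gam' j}" and lr: "l = a @ b" "r = b @ a" by blast
    have "word_eval H (pi_val g g') a \<in> {g i, g' i}" "word_eval H (pi_val g g') b \<in> {g j, g' j}"
      and w: "a \<in> words pi_gens" "b \<in> words pi_gens"
      using ab pi_eval_letter[OF ij(1)] pi_eval_letter[OF ij(2)] ij(1,2) by (auto simp: letter_words)
    then show ?thesis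
      using P.far[OF ij] w unfolding lr by (simp add: pi_eval_append)
  qed
qed

lemma pi_family_of_rels:
  assumes R: "\<And>l r. (l, r) \<in> pi_rels \<Longrightarrow> l \<in> words pi_gens \<Longrightarrow> r \<in> words pi_gens \<Longrightarrow>
      word_eval H (pi_val g g') l = word_eval H (pi_val g g') r"
  shows "pi_family H g g'"
proof unfold_locales
  fix j :: nat assume j: "j \<in> idx"
  show "g j \<otimes> g j = \<one>"
    using R[OF pi_relsI(1)] j by (simp add: pi_eval)
  show "g' j \<otimes> g' j = \<one>"
    using R[OF pi_relsI(2)] j by (simp add: pi_eval)
next
  show "g' 3 = g 1 \<otimes> g' 1 \<otimes> g 3 \<otimes> g' 1 \<otimes> g 1"
    using R[OF pi_relsI(3)] by (simp add: pi_eval c m_assoc)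
  show "g' 5 = g 4 \<otimes> g' 4 \<otimes> g 5 \<otimes> g' 4 \<otimes> g 4"
    using R[OF pi_relsI(4)] by (simp add: pi_eval c m_assoc)
  show "g 2 = g' 6 \<otimes> g 6 \<otimes> g' 2 \<otimes> g 6 \<otimes> g' 6"
    using R[OF pi_relsI(5)] by (simp add: pi_eval c m_assoc)
  show "g' 2 = g 1 \<otimes> g' 1 \<otimes> g 2 \<otimes> g' 1 \<otimes> g 1"
    using R[OF pi_relsI(6)] by (simp add: pi_eval c m_assoc)
  show "g 3 = g' 4 \<otimes> g 4 \<otimes> g' 3 \<otimes> g 4 \<otimes> g' 4"
    using R[OF pi_relsI(7)] by (simp add: pi_eval c m_assoc)
  show "g 5 = g' 6 \<otimes> g 6 \<otimes> g' 5 \<otimes> g 6 \<otimes> g' 6"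
    using R[OF pi_relsI(8)] by (simp add: pi_eval c m_assoc)
next
  fix i j :: nat and a b and p q :: int
  assume ij: "i \<in> idx" "j \<in> idx" "{i, j} \<in> pi_edges"
    and ab: "a = (g i \<otimes> g' i) [^] p \<otimes> g i" "b = (g j \<otimes> g' j) [^] q \<otimes> g j"
  define u where "u = word_pow (gam i @ gam' i) p @ gam i"
  define v where "v = word_pow (gam j @ gam' j) q @ gam j"
  have "(u @ v @ u, v @ u @ v) \<in> pi_rels" unfolding pi_rels_def u_def v_def
    by (rule UnI1, rule UnI2, use ij in blast)
  moreover have w: "u \<in> words pi_gens" "v \<in> words pi_gens"
    unfolding u_def v_def using ij by (simp_all add: pi_eval)
  moreover have "word_eval H (pi_val g g') u = a" "word_eval H (pi_val g g') v = b"
    unfolding u_def v_def using ij ab by (simp_all add: pi_eval)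
  moreover have "a \<in> carrier H" "b \<in> carrier H" using ij ab c by simp_all
  ultimately show "a \<otimes> b \<otimes> a = b \<otimes> a \<otimes> b"
    using R[of "u @ v @ u" "v @ u @ v"] by (simp add: pi_eval_append m_assoc)
next
  fix i j :: nat and a b
  assume ij: "i \<in> idx" "j \<in> idx" "i \<noteq> j" "{i, j} \<notin> pi_edges"
    and ab: "a \<in> {g i, g' i}" "b \<in> {g j, g' j}"
  obtain u v where uv: "u \<in> {gam i, gam' i}" "v \<in> {gam j, gam' j}"
      "word_eval H (pi_val g g') u = a" "word_eval H (pi_val g g') v = b"
    using ab pi_eval_letter[OF ij(1)] pi_eval_letter[OF ij(2)] by blast
  have "(u @ v, v @ u) \<in> pi_rels" unfolding pi_rels_def
    by (rule UnI2, use ij uv(1,2) in blast)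
  moreover have w: "u \<in> words pi_gens" "v \<in> words pi_gens"
    using ij uv(1,2) by (auto simp add: pi_eval)
  ultimately show "a \<otimes> b = b \<otimes> a"
    using R[of "u @ v" "v @ u"] uv by (simp add: pi_eval_append)
qed (simp_all add: c)

end

context
  fixes H :: "('a, 'b) monoid_scheme" (structure) and X A :: "nat \<Rightarrow> nat \<Rightarrow> 'a"
  assumes H: "group H"
    and c: "\<And>i j. i \<in> idx \<Longrightarrow> j \<in> idx \<Longrightarrow> i \<noteq> j \<Longrightarrow> X i j \<in> carrier H"
      "\<And>i j. i \<in> idx \<Longrightarrow> j \<in> idx \<Longrightarrow> i \<noteq> j \<Longrightarrow> A i j \<in> carrier H"
begin

interpretation group H by (rule H)

lemma xa_val_closed: "x \<in> xa_gens \<Longrightarrow> xa_val X A x \<in> carrier H"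
  by (erule xa_gens_cases) (simp_all add: c)

lemma xa_eval_append:
  "u \<in> words xa_gens \<Longrightarrow> v \<in> words xa_gens \<Longrightarrow> word_eval H (xa_val X A) (u @ v) =
    word_eval H (xa_val X A) u \<otimes> word_eval H (xa_val X A) v"
  using word_eval_append[of H xa_gens "xa_val X A" u v, OF H xa_val_closed] by simp

lemma xa_eval_letter:
  "i \<in> idx \<Longrightarrow> j \<in> idx \<Longrightarrow> i \<noteq> j \<Longrightarrow> word_eval H (xa_val X A) (letter (Xg i j)) = X i j"
  "i \<in> idx \<Longrightarrow> j \<in> idx \<Longrightarrow> i \<noteq> j \<Longrightarrow> word_eval H (xa_val X A) (letter (Ag i j)) = A i j"
  using word_eval_letter[OF H, of "xa_val X A" "Xg i j"]
    word_eval_letter[OF H, of "xa_val X A" "Ag i j"] by (simp_all add: c)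

lemma xa_eval_inv:
  "w \<in> words xa_gens \<Longrightarrow> word_eval H (xa_val X A) (word_inv w) = inv word_eval H (xa_val X A) w"
  using word_eval_inv[of H xa_gens "xa_val X A" w, OF H xa_val_closed] by simp

lemma XA_words: "i \<in> idx \<Longrightarrow> j \<in> idx \<Longrightarrow> i \<noteq> j \<Longrightarrow> XA i j n \<in> words xa_gens"
  by (simp add: XA_def letter_words word_pow_words)

lemma xa_eval_XA:
  "i \<in> idx \<Longrightarrow> j \<in> idx \<Longrightarrow> i \<noteq> j \<Longrightarrow>
    word_eval H (xa_val X A) (XA i j n) = X i j \<otimes> A i j [^] n"
  using word_eval_pow[of H xa_gens "xa_val X A" "letter (Ag i j)" n, OF H xa_val_closed]
  by (simp add: XA_def xa_eval_append xa_eval_letter letter_words word_pow_words)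

lemmas xa_eval = xa_eval_append xa_eval_letter xa_eval_XA xa_eval_inv letter_words XA_words

lemma xa_family_rels:
  assumes "xa_family H idx X A" and lr: "(l, r) \<in> xa_rels"
  shows "word_eval H (xa_val X A) l = word_eval H (xa_val X A) r"
proof -
  interpret F: xa_family H idx X A by fact
  show ?thesis
    using lr unfolding xa_rels_def
  proof (elim UnE)
    assume "(l, r) \<in> {(XA j i n, word_inv (XA i j n)) | i j n. {i, j} \<subseteq> idx \<and> distinct [i, j]}"
    then obtain i j n where "i \<in> idx" "j \<in> idx" "i \<noteq> j"
      and lr: "l = XA j i n" "r = word_inv (XA i j n)" by auto
    then show ?thesis using F.flip[of i j n] by (simp add: xa_eval del: atLeastAtMost_iff)
  next
    assume "(l, r) \<in> {(XA i j n @ XA j k n @ XA k i n, []) | i j k n.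
      {i, j, k} \<subseteq> idx \<and> distinct [i, j, k]}"
    then obtain i j k n where ij: "i \<in> idx" "j \<in> idx" "k \<in> idx" "distinct [i, j, k]"
      and lr: "l = XA i j n @ XA j k n @ XA k i n" "r = []" by auto
    then show ?thesis
      using F.triangle[OF ij, of n] c by (simp add: xa_eval m_assoc del: atLeastAtMost_iff)
  next
    assume "(l, r) \<in> {(XA j k n @ XA i j n @ XA k i n, []) | i j k n.
      {i, j, k} \<subseteq> idx \<and> distinct [i, j, k]}"
    then obtain i j k n where ij: "i \<in> idx" "j \<in> idx" "k \<in> idx" "distinct [i, j, k]"
      and lr: "l = XA j k n @ XA i j n @ XA k i n" "r = []" by auto
    then show ?thesis
      using F.triangle'[OF ij, of n] c by (simp add: xa_eval m_assoc del: atLeastAtMost_iff)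
  next
    assume "(l, r) \<in> {(letter (Ag i j) @ word_inv (letter (Ag i k)),
        letter (Ag k l) @ word_inv (letter (Ag j l))) | i j k l.
      {i, j, k, l} \<subseteq> idx \<and> distinct [i, j, k, l]}"
    then obtain i j k m where ij: "i \<in> idx" "j \<in> idx" "k \<in> idx" "m \<in> idx" "distinct [i, j, k, m]"
      and lr: "l = letter (Ag i j) @ word_inv (letter (Ag i k))"
      "r = letter (Ag k m) @ word_inv (letter (Ag j m))" by auto
    then show ?thesis
      using F.quad[OF ij] by (simp add: xa_eval del: atLeastAtMost_iff)
  qed
qed

lemma xa_family_of_rels:
  assumes R: "\<And>l r. (l, r) \<in> xa_rels \<Longrightarrow> l \<in> words xa_gens \<Longrightarrow> r \<in> words xa_gens \<Longrightarrow>
      word_eval H (xa_val X A) l = word_eval H (xa_val X A) r"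
  shows "xa_family H idx X A"
proof unfold_locales
  fix i j :: nat and n :: int assume ij: "i \<in> idx" "j \<in> idx" "i \<noteq> j"
  show "X i j \<in> carrier H" "A i j \<in> carrier H" using c ij by auto
  show "X j i \<otimes> A j i [^] n = inv (X i j \<otimes> A i j [^] n)"
    using R[OF xa_relsI(1)[of i j n]] ij by (simp add: xa_eval del: atLeastAtMost_iff)
next
  fix i j k :: nat and n :: int assume ij: "i \<in> idx" "j \<in> idx" "k \<in> idx" "distinct [i, j, k]"
  show "(X i j \<otimes> A i j [^] n) \<otimes> (X j k \<otimes> A j k [^] n) \<otimes> (X k i \<otimes> A k i [^] n) = \<one>"
    using R[OF xa_relsI(2)[OF ij, of n]] ij c by (simp add: xa_eval m_assoc del: atLeastAtMost_iff)
  show "(X j k \<otimes> A j k [^] n) \<otimes> (X i j \<otimes> A i j [^] n) \<otimes> (X k i \<otimes> A k i [^] n) = \<one>"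
    using R[OF xa_relsI(3)[OF ij, of n]] ij c by (simp add: xa_eval m_assoc del: atLeastAtMost_iff)
next
  fix i j k l :: nat assume ij: "i \<in> idx" "j \<in> idx" "k \<in> idx" "l \<in> idx" "distinct [i, j, k, l]"
  show "A i j \<otimes> inv A i k = A k l \<otimes> inv A j l"
    using R[OF xa_relsI(4)[OF ij]] ij by (simp add: xa_eval del: atLeastAtMost_iff)
qed

end

section \<open>The relations between X and A hold in the kernel\<close>

lemma pi_edges_mem [simp]:
  "{1, 3} \<in> pi_edges" "{3, 4} \<in> pi_edges" "{4, 5} \<in> pi_edges" "{5, 6} \<in> pi_edges"
  "{2, 6} \<in> pi_edges" "{1, 2} \<in> pi_edges"
  by (simp_all add: pi_edges_def)

lemma pi_edges_not_mem [simp]: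
  "{1, 4} \<notin> pi_edges" "{1, 5} \<notin> pi_edges" "{1, 6} \<notin> pi_edges" "{3, 5} \<notin> pi_edges"
  "{3, 6} \<notin> pi_edges" "{3, 2} \<notin> pi_edges" "{4, 6} \<notin> pi_edges" "{4, 2} \<notin> pi_edges"
  "{5, 2} \<notin> pi_edges"
  by (simp_all add: pi_edges_def doubleton_eq_iff)

lemma idx_fresh: "\<exists>m\<in>idx. m \<noteq> a \<and> m \<noteq> b \<and> m \<noteq> c \<and> m \<noteq> d \<and> m \<noteq> e"
proof -
  have "card {a, b, c, d, e} \<le> 5"
    by (intro order_trans[OF card_insert_le_m1] card_insert_le_m1) simp_all
  then have "\<not> idx \<subseteq> {a, b, c, d, e}" using card_mono[of "{a, b, c, d, e}" idx] by auto
  then show ?thesis by auto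
qed

text \<open>The homomorphism \<open>\<theta>\<close> plays the role of \<open>psi\<close>.\<close>

locale pi_cover = pi_family G g g' for G (structure) and g g' :: "nat \<Rightarrow> 'a" +
  fixes \<theta> :: "'a \<Rightarrow> nat \<Rightarrow> nat"
  assumes \<theta>_one: "\<theta> \<one> = id"
    and \<theta>_mult: "x \<in> carrier G \<Longrightarrow> y \<in> carrier G \<Longrightarrow> \<theta> (x \<otimes> y) = \<theta> y \<circ> \<theta> x"
    and \<theta>_permutes: "x \<in> carrier G \<Longrightarrow> \<theta> x permutes idx"
    and \<theta>_g: "j \<in> idx \<Longrightarrow> \<theta> (g j) = psi_transp j"
    and \<theta>_g': "j \<in> idx \<Longrightarrow> \<theta> (g' j) = psi_transp j"
begin

lemma g_braid:
  assumes "i \<in> idx" "j \<in> idx" "{i, j} \<in> pi_edges"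
  shows "g i \<otimes> g j \<otimes> g i = g j \<otimes> g i \<otimes> g j"
proof -
  have "(g i \<otimes> g' i) [^] (0::int) \<otimes> g i = g i" "(g j \<otimes> g' j) [^] (0::int) \<otimes> g j = g j"
    using assms g_closed by simp_all
  then show ?thesis using braid[OF assms, of "g i" 0 "g j" 0] by simp
qed

lemma g_braid_prime:
  assumes "i \<in> idx" "j \<in> idx" "{i, j} \<in> pi_edges"
  shows "g i \<otimes> g' j \<otimes> g i = g' j \<otimes> g i \<otimes> g' j"
proof -
  have c: "g i \<in> carrier G" "g' j \<in> carrier G" "g j \<in> carrier G" using assms g_closed g'_closed by auto
  have i: "(g i \<otimes> g' i) [^] (0::int) \<otimes> g i = g i" using c by simp
  have "(g j \<otimes> g' j) [^] (- 1::int) \<otimes> g j = inv (g j \<otimes> g' j) \<otimes> g j"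
    using c int_pow_neg[of "g j \<otimes> g' j" 1] by simp
  also have "\<dots> = g' j"
    using c g_square[OF assms(2)] g'_square[OF assms(2)]
    by (simp add: inv_mult_group involution_inv m_assoc)
  finally show ?thesis using braid[OF assms, of "g i" 0 "g' j" "- 1"] i by simp
qed

lemma g_far: "\<lbrakk>i \<in> idx; j \<in> idx; i \<noteq> j; {i, j} \<notin> pi_edges\<rbrakk> \<Longrightarrow> g i \<otimes> g j = g j \<otimes> g i"
  using far by blast

lemma g_far_prime:
  "\<lbrakk>i \<in> idx; j \<in> idx; i \<noteq> j; {i, j} \<notin> pi_edges\<rbrakk> \<Longrightarrow> g' i \<otimes> g j = g j \<otimes> g' i"
  using far by blast

lemma g_closeds [simp]:
  "g 1 \<in> carrier G" "g 2 \<in> carrier G" "g 3 \<in> carrier G" "g 4 \<in> carrier G" "g 5 \<in> carrier G"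
  "g 6 \<in> carrier G" "g' 1 \<in> carrier G" "g' 2 \<in> carrier G" "g' 3 \<in> carrier G"
  "g' 4 \<in> carrier G" "g' 5 \<in> carrier G" "g' 6 \<in> carrier G"
  by (simp_all add: g_closed g'_closed)

lemma \<theta>_gs:
  "\<theta> (g 1) = transpose 1 3" "\<theta> (g 2) = transpose 1 5" "\<theta> (g 3) = transpose 2 3"
  "\<theta> (g 4) = transpose 2 6" "\<theta> (g 5) = transpose 4 6" "\<theta> (g 6) = transpose 4 5"
  by (simp_all add: \<theta>_g psi_transp_def)

abbreviation H :: "'a set" where "H \<equiv> generate G (g ` {2..6})"

lemma H_closed: "h \<in> H \<Longrightarrow> h \<in> carrier G"
  by (rule generate_in_carrier[of "g ` {2..6}"]) (auto simp: g_closed)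

lemma H_mult: "h \<in> H \<Longrightarrow> k \<in> H \<Longrightarrow> h \<otimes> k \<in> H"
  by (rule generate.eng)

lemma H_inv: "h \<in> H \<Longrightarrow> inv h \<in> H"
  by (rule generate_m_inv_closed[of "g ` {2..6}"]) (auto simp: g_closed)

lemma H_g [simp]: "g 2 \<in> H" "g 3 \<in> H" "g 4 \<in> H" "g 5 \<in> H" "g 6 \<in> H"
  by (rule generate.incl, simp)+

lemma less_5_cases: "(i::nat) < 5 \<Longrightarrow> i = 0 \<or> i = 1 \<or> i = 2 \<or> i = 3 \<or> i = 4" by arith

text \<open>The hexagon of transpositions without the edge of \<open>g 1\<close>.\<close>

lemma path: "braid_path G 5 (\<lambda>i. g ([3, 4, 5, 6, 2] ! i)) (\<lambda>i. [3, 2, 6, 4, 5, 1] ! i) \<theta>"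
proof unfold_locales
  fix i :: nat assume i: "i < 5"
  show "g ([3, 4, 5, 6, 2] ! i) \<in> carrier G" "g ([3, 4, 5, 6, 2] ! i) \<otimes> g ([3, 4, 5, 6, 2] ! i) = \<one>"
    using less_5_cases[OF i] by (auto simp: g_square)
  show "\<theta> (g ([3, 4, 5, 6, 2] ! i)) =
      transpose ([3, 2, 6, 4, 5, 1] ! i) ([3, 2, 6, 4, 5, 1] ! Suc i)"
    using less_5_cases[OF i] by (auto simp: \<theta>_gs transpose_commute)
next
  fix i :: nat assume i: "Suc i < 5"
  then have "i = 0 \<or> i = 1 \<or> i = 2 \<or> i = 3" by arith
  then show "g ([3, 4, 5, 6, 2] ! i) \<otimes> g ([3, 4, 5, 6, 2] ! Suc i) \<otimes> g ([3, 4, 5, 6, 2] ! i) =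
      g ([3, 4, 5, 6, 2] ! Suc i) \<otimes> g ([3, 4, 5, 6, 2] ! i) \<otimes> g ([3, 4, 5, 6, 2] ! Suc i)"
    using g_braid[of 3 4] g_braid[of 4 5] g_braid[of 5 6] g_braid[of 2 6] by auto
next
  fix i j :: nat assume "j < 5" "Suc i < j"
  then have "i = 0 \<and> (j = 2 \<or> j = 3 \<or> j = 4) \<or> i = 1 \<and> (j = 3 \<or> j = 4) \<or> i = 2 \<and> j = 4" by arith
  then show "g ([3, 4, 5, 6, 2] ! i) \<otimes> g ([3, 4, 5, 6, 2] ! j) =
      g ([3, 4, 5, 6, 2] ! j) \<otimes> g ([3, 4, 5, 6, 2] ! i)"
    using g_far[of 3 5] g_far[of 3 6] g_far[of 3 2] g_far[of 4 6] g_far[of 4 2] g_far[of 5 2]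
    by auto
next
  show "inj_on (\<lambda>i. [3, 2, 6, 4, 5, 1::nat] ! i) {..5}"
  proof -
    have "{..5::nat} = {0, 1, 2, 3, 4, 5}" by auto
    then show ?thesis by (simp add: inj_on_def)
  qed
qed (simp_all add: \<theta>_one \<theta>_mult)

text \<open>The same path from its other end, after removal of the point \<open>3\<close>. Fixing \<open>3\<close> and then \<open>1\<close>
  strips one generator from either end, hence two paths are needed.\<close>

lemma path_back: "braid_path G 4 (\<lambda>i. g ([2, 6, 5, 4] ! i)) (\<lambda>i. [1, 5, 4, 6, 2] ! i) \<theta>"
proof unfold_locales
  fix i :: nat assume "i < 4"
  then have i: "i = 0 \<or> i = 1 \<or> i = 2 \<or> i = 3" by arith
  show "g ([2, 6, 5, 4] ! i) \<in> carrier G" "g ([2, 6, 5, 4] ! i) \<otimes> g ([2, 6, 5, 4] ! i) = \<one>"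
    using i by (auto simp: g_square)
  show "\<theta> (g ([2, 6, 5, 4] ! i)) = transpose ([1, 5, 4, 6, 2] ! i) ([1, 5, 4, 6, 2] ! Suc i)"
    using i by (auto simp: \<theta>_gs transpose_commute)
next
  fix i :: nat assume i: "Suc i < 4"
  then have "i = 0 \<or> i = 1 \<or> i = 2" by arith
  then show "g ([2, 6, 5, 4] ! i) \<otimes> g ([2, 6, 5, 4] ! Suc i) \<otimes> g ([2, 6, 5, 4] ! i) =
      g ([2, 6, 5, 4] ! Suc i) \<otimes> g ([2, 6, 5, 4] ! i) \<otimes> g ([2, 6, 5, 4] ! Suc i)"
    using g_braid[of 4 5] g_braid[of 5 6] g_braid[of 2 6] by auto
next
  fix i j :: nat assume "j < 4" "Suc i < j"
  then have "i = 0 \<and> (j = 2 \<or> j = 3) \<or> i = 1 \<and> j = 3" by arith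
  then show "g ([2, 6, 5, 4] ! i) \<otimes> g ([2, 6, 5, 4] ! j) = g ([2, 6, 5, 4] ! j) \<otimes> g ([2, 6, 5, 4] ! i)"
    using g_far[of 4 6] g_far[of 4 2] g_far[of 5 2] by auto
next
  show "inj_on (\<lambda>i. [1, 5, 4, 6, 2::nat] ! i) {..4}"
  proof -
    have "{..4::nat} = {0, 1, 2, 3, 4}" by auto
    then show ?thesis by (simp add: inj_on_def)
  qed
qed (simp_all add: \<theta>_one \<theta>_mult)

lemma path_images:
  "(\<lambda>i. g ([3, 4, 5, 6, 2] ! i)) ` {0..<5} = g ` {2..6}"
  "(\<lambda>i. g ([3, 4, 5, 6, 2] ! i)) ` {Suc 0..<5} = g ` {2, 4, 5, 6}"
  "(\<lambda>i. g ([2, 6, 5, 4] ! i)) ` {0..<4} = g ` {2, 4, 5, 6}"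
  "(\<lambda>i. g ([2, 6, 5, 4] ! i)) ` {Suc 0..<4} = g ` {4, 5, 6}"
  "(\<lambda>i. [3, 2, 6, 4, 5, 1::nat] ! i) ` {0..5} = idx"
proof -
  have 1: "{0..<5::nat} = {0, 1, 2, 3, 4}" "{Suc 0..<5} = {1, 2, 3, 4}" "{0..<4::nat} = {0, 1, 2, 3}"
    "{Suc 0..<4} = {1, 2, 3}" "{0..5::nat} = {0, 1, 2, 3, 4, 5}" "{2..6::nat} = {2, 3, 4, 5, 6}"
    "idx = {1, 2, 3, 4, 5, 6}" by auto
  show "(\<lambda>i. g ([3, 4, 5, 6, 2] ! i)) ` {0..<5} = g ` {2..6}"
    "(\<lambda>i. g ([3, 4, 5, 6, 2] ! i)) ` {Suc 0..<5} = g ` {2, 4, 5, 6}"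
    "(\<lambda>i. g ([2, 6, 5, 4] ! i)) ` {0..<4} = g ` {2, 4, 5, 6}"
    "(\<lambda>i. g ([2, 6, 5, 4] ! i)) ` {Suc 0..<4} = g ` {4, 5, 6}"
    "(\<lambda>i. [3, 2, 6, 4, 5, 1::nat] ! i) ` {0..5} = idx"
    unfolding 1 by (simp_all add: insert_commute)
qed

declare One_nat_def [simp del]

lemma \<theta>_inv:
  assumes "h \<in> carrier G" "\<theta> h k = l"
  shows "\<theta> (inv h) l = k"
proof -
  have "\<theta> (inv h) (\<theta> h k) = \<theta> (h \<otimes> inv h) k"
    using assms(1) \<theta>_mult[of h "inv h"] by simp
  then show ?thesis using assms \<theta>_one by simp
qed

lemma H_faithful:
  assumes "x \<in> H" "\<theta> x = id"
  shows "x = \<one>"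
  using braid_path.tail_faithful[OF path, of x 0] assms by (simp add: path_images)

lemma H_surj:
  assumes "q permutes idx"
  shows "\<exists>h\<in>H. \<theta> h = q"
  using braid_path.tail_surj[OF path, of q 0, unfolded path_images, OF assms] by simp

lemma H_stabilizer:
  assumes "x \<in> H" "\<theta> x 1 = 1" "\<theta> x 3 = 3"
  shows "x \<in> generate G (g ` {4, 5, 6})"
proof -
  have "x \<in> generate G (g ` {2, 4, 5, 6})"
    using braid_path.tail_stabilizer[OF path, of x 0, unfolded path_images] assms by simp
  then show ?thesis
    using braid_path.tail_stabilizer[OF path_back, of x 0, unfolded path_images] assms by simp
qed

lemma H_eqI:
  assumes "x \<in> H" "y \<in> H" "\<theta> x = \<theta> y"
  shows "x = y"
proof -
  have c: "x \<in> carrier G" "y \<in> carrier G" using assms H_closed by auto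
  have "\<theta> (x \<otimes> inv y) = \<theta> (inv y) \<circ> \<theta> y" using c assms \<theta>_mult by simp
  also have "\<dots> = id" using c \<theta>_mult[of y "inv y"] \<theta>_one by simp
  finally have "x \<otimes> inv y = \<one>" using H_faithful H_mult H_inv assms by blast
  then show ?thesis using c inv_equality inv_solve_right' by force
qed

lemma \<theta>_eqI:
  assumes "x \<in> carrier G" "q permutes idx"
    "\<theta> x 1 = q 1" "\<theta> x 2 = q 2" "\<theta> x 3 = q 3" "\<theta> x 4 = q 4" "\<theta> x 5 = q 5" "\<theta> x 6 = q 6"
  shows "\<theta> x = q"
  using S6_eqI[of "\<theta> x" q] assms \<theta>_permutes by (simp add: S6_def)

text \<open>The elements of \<open>H\<close> over the transpositions of \<open>1, 3\<close> and of \<open>1, 2\<close>. The latter is a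
  conjugate of \<open>g 2\<close> by elements that commute with \<open>g 1\<close>, which is what makes \<open>g 1\<close> braid with it.\<close>

definition \<tau> :: 'a where
  "\<tau> = g 2 \<otimes> g 6 \<otimes> g 5 \<otimes> g 4 \<otimes> g 3 \<otimes> g 4 \<otimes> g 5 \<otimes> g 6 \<otimes> g 2"

definition \<rho> :: 'a where
  "\<rho> = g 4 \<otimes> g 5 \<otimes> g 6 \<otimes> g 2 \<otimes> g 6 \<otimes> g 5 \<otimes> g 4"

lemma \<tau>_H [simp]: "\<tau> \<in> H" unfolding \<tau>_def by (intro H_mult H_g)
lemma \<rho>_H [simp]: "\<rho> \<in> H" unfolding \<rho>_def by (intro H_mult H_g)
lemma \<tau>_closed [simp]: "\<tau> \<in> carrier G" by (rule H_closed) simp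
lemma \<rho>_closed [simp]: "\<rho> \<in> carrier G" by (rule H_closed) simp

lemma \<theta>_\<tau>: "\<theta> \<tau> = transpose 1 3"
  by (rule \<theta>_eqI) (simp_all add: \<tau>_def \<theta>_mult \<theta>_gs permutes_swap_id transpose_def)

lemma \<theta>_\<rho>: "\<theta> \<rho> = transpose 1 2"
  by (rule \<theta>_eqI) (simp_all add: \<rho>_def \<theta>_mult \<theta>_gs permutes_swap_id transpose_def)

lemma H_eqI6:
  assumes "x \<in> H" "y \<in> H" "\<theta> x 1 = \<theta> y 1" "\<theta> x 2 = \<theta> y 2" "\<theta> x 3 = \<theta> y 3"
    "\<theta> x 4 = \<theta> y 4" "\<theta> x 5 = \<theta> y 5" "\<theta> x 6 = \<theta> y 6"
  shows "x = y"
proof (rule H_eqI[OF assms(1,2)])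
  show "\<theta> x = \<theta> y"
    by (rule \<theta>_eqI) (use assms H_closed \<theta>_permutes in blast)+
qed

lemmas \<theta>_simps = \<theta>_mult \<theta>_gs \<theta>_\<tau> \<theta>_\<rho> \<theta>_one transpose_def

lemma \<tau>_square: "\<tau> \<otimes> \<tau> = \<one>"
  by (rule H_eqI6) (simp_all add: \<theta>_simps H_mult generate.one)
lemma \<rho>_square: "\<rho> \<otimes> \<rho> = \<one>"
  by (rule H_eqI6) (simp_all add: \<theta>_simps H_mult generate.one)
lemma \<tau>_\<rho>: "\<tau> \<otimes> \<rho> \<otimes> \<tau> = g 3" "\<rho> \<otimes> \<tau> \<otimes> \<rho> = g 3" "g 3 \<otimes> \<tau> \<otimes> g 3 = \<rho>"
  by (rule H_eqI6; simp add: \<theta>_simps H_mult)+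
lemma \<tau>_commute: "g 4 \<otimes> \<tau> = \<tau> \<otimes> g 4" "g 5 \<otimes> \<tau> = \<tau> \<otimes> g 5" "g 6 \<otimes> \<tau> = \<tau> \<otimes> g 6"
  by (rule H_eqI6; simp add: \<theta>_simps H_mult)+

text \<open>The elements \<open>g 4, g 5, g 6\<close> generate the stabilizer of \<open>1\<close> and \<open>3\<close> in \<open>H\<close>. Therefore the
  conjugate of such an \<open>x\<close> by \<open>h\<close> only depends on the two points that \<open>h\<close> moves to \<open>1\<close> and \<open>3\<close>,
  and \<open>transport x k l\<close> below is this conjugate for the points \<open>k, l\<close>.\<close>

definition stab_commuting :: "'a \<Rightarrow> bool" where
  "stab_commuting x \<longleftrightarrow> x \<in> carrier G \<and> g 4 \<otimes> x = x \<otimes> g 4 \<and> g 5 \<otimes> x = x \<otimes> g 5 \<and> g 6 \<otimes> x = x \<otimes> g 6"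

definition transport :: "'a \<Rightarrow> nat \<Rightarrow> nat \<Rightarrow> 'a" where
  "transport x k l = conjugate (SOME h. h \<in> H \<and> \<theta> h k = 1 \<and> \<theta> h l = 3) x"

lemma transport_eq:
  assumes x: "stab_commuting x" and h: "h \<in> H" "\<theta> h k = 1" "\<theta> h l = 3"
  shows "transport x k l = conjugate h x"
proof -
  define t where "t = (SOME h. h \<in> H \<and> \<theta> h k = 1 \<and> \<theta> h l = 3)"
  have t: "t \<in> H \<and> \<theta> t k = 1 \<and> \<theta> t l = 3"
    unfolding t_def by (rule someI[of _ h]) (use h in simp)
  have xc: "x \<in> carrier G" using x by (simp add: stab_commuting_def)
  have c: "h \<in> carrier G" "t \<in> carrier G" using h t H_closed by auto
  define u where "u = inv h \<otimes> t"
  have uH: "u \<in> H" unfolding u_def using h t H_mult H_inv by blast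
  have "\<theta> u 1 = 1" "\<theta> u 3 = 3"
    unfolding u_def using c h t \<theta>_inv[OF c(1) h(2)] \<theta>_inv[OF c(1) h(3)] by (simp_all add: \<theta>_mult)
  then have "u \<in> generate G (g ` {4, 5, 6})" using H_stabilizer uH by simp
  then have "u \<otimes> x = x \<otimes> u"
    by (rule generate_commute) (use x in \<open>auto simp: stab_commuting_def\<close>)
  then have "conjugate u x = x" using conjugate_commuting uH H_closed xc by blast
  moreover have "t = h \<otimes> u" unfolding u_def using c by (simp add: inv_cancel_left)
  ultimately have "conjugate t x = conjugate h x"
    using c xc uH H_closed conjugate_conjugate[of h u x] by simp
  then show ?thesis unfolding transport_def t_def by simp
qed

lemma perm_extend:
  assumes "q permutes idx" "i \<in> idx" "y \<in> idx"
  shows "\<exists>q'. q' permutes idx \<and> q' i = y \<and> (\<forall>z. q z \<noteq> q i \<longrightarrow> q z \<noteq> y \<longrightarrow> q' z = q z)"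
proof (intro exI conjI)
  show "transpose (q i) y \<circ> q permutes idx"
    using assms permutes_in_image[OF assms(1)] by (intro permutes_compose permutes_swap_id) auto
qed (auto simp: transpose_def)

lemma ex_H4:
  assumes "i \<in> idx" "j \<in> idx" "k \<in> idx" "l \<in> idx" "distinct [i, j, k, l]"
  shows "\<exists>h\<in>H. \<theta> h i = 1 \<and> \<theta> h j = 3 \<and> \<theta> h k = 2 \<and> \<theta> h l = 6"
proof -
  have ne: "i \<noteq> j" "i \<noteq> k" "i \<noteq> l" "j \<noteq> k" "j \<noteq> l" "k \<noteq> l" using assms(5) by auto
  obtain q1 where q1: "q1 permutes idx" "q1 i = 1"
    using perm_extend[OF permutes_id assms(1), of 1] by auto
  have i1: "q1 x = q1 y \<longleftrightarrow> x = y" for x y using permutes_inj[OF q1(1)] by (simp add: inj_eq)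
  obtain q2 where q2: "q2 permutes idx" "q2 j = 3" "\<forall>z. q1 z \<noteq> q1 j \<longrightarrow> q1 z \<noteq> 3 \<longrightarrow> q2 z = q1 z"
    using perm_extend[OF q1(1) assms(2), of 3] by auto
  then have q2': "q2 i = 1" using q1 i1 ne by simp
  have i2: "q2 x = q2 y \<longleftrightarrow> x = y" for x y using permutes_inj[OF q2(1)] by (simp add: inj_eq)
  obtain q3 where q3: "q3 permutes idx" "q3 k = 2" "\<forall>z. q2 z \<noteq> q2 k \<longrightarrow> q2 z \<noteq> 2 \<longrightarrow> q3 z = q2 z"
    using perm_extend[OF q2(1) assms(3), of 2] by auto
  then have q3': "q3 i = 1" "q3 j = 3" using q2 q2' i2 ne by simp_all
  have i3: "q3 x = q3 y \<longleftrightarrow> x = y" for x y using permutes_inj[OF q3(1)] by (simp add: inj_eq)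
  obtain q4 where q4: "q4 permutes idx" "q4 l = 6" "\<forall>z. q3 z \<noteq> q3 l \<longrightarrow> q3 z \<noteq> 6 \<longrightarrow> q4 z = q3 z"
    using perm_extend[OF q3(1) assms(4), of 6] by auto
  then have q4': "q4 i = 1" "q4 j = 3" "q4 k = 2" using q3 q3' i3 ne by simp_all
  then show ?thesis using H_surj[OF q4(1)] q4 by auto
qed

lemma ex_H3:
  assumes "i \<in> idx" "j \<in> idx" "k \<in> idx" "distinct [i, j, k]"
  shows "\<exists>h\<in>H. \<theta> h i = 1 \<and> \<theta> h j = 3 \<and> \<theta> h k = 2"
proof -
  obtain l where "l \<in> idx" "l \<noteq> i" "l \<noteq> j" "l \<noteq> k" using idx_fresh[of i j k i i] by blast
  then show ?thesis using ex_H4[of i j k l] assms by auto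
qed

lemma ex_H2:
  assumes "i \<in> idx" "j \<in> idx" "i \<noteq> j"
  shows "\<exists>h\<in>H. \<theta> h i = 1 \<and> \<theta> h j = 3"
proof -
  obtain k where "k \<in> idx" "k \<noteq> i" "k \<noteq> j" using idx_fresh[of i j i i i] by blast
  then show ?thesis using ex_H3[of i j k] assms by auto
qed

text \<open>The conjugation action of \<open>H\<close> permutes the family \<open>transport x\<close> through its indices. With
  this, a relation between members of such families follows for all indices from one choice.\<close>

lemma transport_conj:
  assumes x: "stab_commuting x" and h: "h \<in> H" and kl: "k \<in> idx" "l \<in> idx" "k \<noteq> l"
  shows "transport x k l = conjugate h (transport x (\<theta> h k) (\<theta> h l))"
proof -
  have p: "\<theta> h permutes idx" using h H_closed \<theta>_permutes by blast
  then have "\<theta> h k \<in> idx" "\<theta> h l \<in> idx" "\<theta> h k \<noteq> \<theta> h l"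
    using kl permutes_in_image[OF p] permutes_inj[OF p] by (auto simp: inj_eq)
  then obtain s where s: "s \<in> H" "\<theta> s (\<theta> h k) = 1" "\<theta> s (\<theta> h l) = 3" using ex_H2 by blast
  have c: "s \<in> carrier G" "h \<in> carrier G" "x \<in> carrier G"
    using s h H_closed x by (auto simp: stab_commuting_def)
  have "transport x k l = conjugate (h \<otimes> s) x"
    using s h c by (intro transport_eq[OF x]) (simp_all add: H_mult \<theta>_mult)
  then show ?thesis using transport_eq[OF x s] c by (simp add: conjugate_conjugate)
qed

lemma transport_closed:
  assumes "stab_commuting x" "k \<in> idx" "l \<in> idx" "k \<noteq> l"
  shows "transport x k l \<in> carrier G"
proof -
  obtain s where "s \<in> H" "\<theta> s k = 1" "\<theta> s l = 3" using ex_H2 assms by blast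
  then show ?thesis using transport_eq assms(1) H_closed by (auto simp: stab_commuting_def)
qed

subsection \<open>The elements over the pair (1, 3)\<close>

text \<open>\<open>X13\<close> and \<open>B 1\<close> are \<open>X\<^sub>1\<^sub>3\<close> and \<open>A\<^sub>1\<^sub>3\<close>.\<close>

definition B :: "nat \<Rightarrow> 'a" where "B j = g j \<otimes> g' j"

definition X13 :: 'a where "X13 = \<tau> \<otimes> g 1"

lemma B_closed [simp]:
  "B 1 \<in> carrier G" "B 2 \<in> carrier G" "B 3 \<in> carrier G" "B 4 \<in> carrier G" "B 5 \<in> carrier G"
  "B 6 \<in> carrier G"
  by (simp_all add: B_def)

lemma X13_closed [simp]: "X13 \<in> carrier G" by (simp add: X13_def)

lemma g1_commute:
  "g 4 \<otimes> g 1 = g 1 \<otimes> g 4" "g 5 \<otimes> g 1 = g 1 \<otimes> g 5" "g 6 \<otimes> g 1 = g 1 \<otimes> g 6"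
  "g 4 \<otimes> g' 1 = g' 1 \<otimes> g 4" "g 5 \<otimes> g' 1 = g' 1 \<otimes> g 5" "g 6 \<otimes> g' 1 = g' 1 \<otimes> g 6"
  using g_far[of 1 4] g_far[of 1 5] g_far[of 1 6] g_far_prime[of 1 4] g_far_prime[of 1 5]
    g_far_prime[of 1 6] by simp_all

lemma stab_commuting_mult: "stab_commuting x \<Longrightarrow> stab_commuting y \<Longrightarrow> stab_commuting (x \<otimes> y)"
  unfolding stab_commuting_def using commute_mult by simp

lemma stab_commuting_pow: "stab_commuting x \<Longrightarrow> stab_commuting (x [^] (n::int))"
  unfolding stab_commuting_def using commute_int_pow by simp

lemma stab_commuting_base: "stab_commuting (g 1)" "stab_commuting (B 1)" "stab_commuting \<tau>" "stab_commuting X13"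
proof -
  show g1: "stab_commuting (g 1)" by (simp add: stab_commuting_def g1_commute)
  have "stab_commuting (g' 1)" by (simp add: stab_commuting_def g1_commute)
  then show "stab_commuting (B 1)" unfolding B_def using g1 by (intro stab_commuting_mult)
  show \<tau>: "stab_commuting \<tau>" by (simp add: stab_commuting_def \<tau>_commute)
  show "stab_commuting X13" unfolding X13_def using g1 \<tau> by (rule stab_commuting_mult[rotated])
qed

lemma squares [simp]:
  "g 1 \<otimes> g 1 = \<one>" "g 2 \<otimes> g 2 = \<one>" "g 3 \<otimes> g 3 = \<one>" "g 4 \<otimes> g 4 = \<one>" "g 5 \<otimes> g 5 = \<one>"
  "g 6 \<otimes> g 6 = \<one>" "g' 1 \<otimes> g' 1 = \<one>" "g' 2 \<otimes> g' 2 = \<one>" "g' 3 \<otimes> g' 3 = \<one>"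
  "g' 4 \<otimes> g' 4 = \<one>" "g' 5 \<otimes> g' 5 = \<one>" "g' 6 \<otimes> g' 6 = \<one>"
  by (simp_all add: g_square g'_square)

lemma invs [simp]:
  "inv (g 1) = g 1" "inv (g 2) = g 2" "inv (g 3) = g 3" "inv (g 4) = g 4" "inv (g 5) = g 5"
  "inv (g 6) = g 6" "inv (g' 1) = g' 1" "inv (g' 2) = g' 2" "inv (g' 3) = g' 3"
  "inv (g' 4) = g' 4" "inv (g' 5) = g' 5" "inv (g' 6) = g' 6" "inv \<tau> = \<tau>" "inv \<rho> = \<rho>"
  by (simp_all add: involution_inv \<tau>_square \<rho>_square)

lemmas cancels = squares[THEN involution_cancel] \<tau>_square[THEN involution_cancel]
  \<rho>_square[THEN involution_cancel]

text \<open>Since \<open>g 1\<close> inverts \<open>B 1\<close>, these are the reflections of the dihedral group generated by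
  \<open>g 1\<close> and \<open>g' 1\<close>. They are also the products of \<open>g 1\<close> with the powers of \<open>B 1\<close>, up to the sign of the
  exponent, and \<open>\<tau> r\<^sub>-\<^sub>n = X\<^sub>1\<^sub>3 A\<^sub>1\<^sub>3\<^sup>n\<close>.\<close>

definition r :: "int \<Rightarrow> 'a" where "r m = B 1 [^] m \<otimes> g 1"

lemma r_closed [simp]: "r m \<in> carrier G" by (simp add: r_def)

lemma g1_B1_pow: "g 1 \<otimes> B 1 [^] (n::int) = r (- n)"
proof -
  have "conjugate (g 1) (B 1) = inv (B 1)"
    by (simp add: conjugate_def B_def inv_mult_group m_assoc cancels)
  then have "conjugate (g 1) (B 1 [^] n) = B 1 [^] (- n)"
    using conjugate_int_pow[of "g 1" "B 1" n] by (simp add: int_pow_inv int_pow_neg)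
  then have "B 1 [^] (- n) \<otimes> g 1 = g 1 \<otimes> B 1 [^] n \<otimes> g 1 \<otimes> g 1" by (simp add: conjugate_def)
  then show ?thesis unfolding r_def by (simp add: m_assoc)
qed

lemma r_square: "r m \<otimes> r m = \<one>"
proof -
  have "r m \<otimes> r m = B 1 [^] m \<otimes> (g 1 \<otimes> B 1 [^] m) \<otimes> g 1" by (simp add: r_def m_assoc)
  also have "\<dots> = (B 1 [^] m \<otimes> B 1 [^] (- m)) \<otimes> (g 1 \<otimes> g 1)"
    unfolding g1_B1_pow by (simp add: r_def m_assoc)
  also have "\<dots> = \<one>" by (simp add: int_pow_neg)
  finally show ?thesis .
qed

lemma r_stab_commuting: "stab_commuting (r m)"
  unfolding r_def by (intro stab_commuting_mult stab_commuting_pow stab_commuting_base)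

lemma r_braid:
  "r m \<otimes> g 3 \<otimes> r m = g 3 \<otimes> r m \<otimes> g 3" "r m \<otimes> g 2 \<otimes> r m = g 2 \<otimes> r m \<otimes> g 2"
  using braid[of 1 3 "r m" m "g 3" 0] braid[of 1 2 "r m" m "g 2" 0]
  by (simp_all add: r_def B_def)

lemma r_braid_\<rho>: "r m \<otimes> \<rho> \<otimes> r m = \<rho> \<otimes> r m \<otimes> \<rho>"
proof -
  define c where "c = g 4 \<otimes> g 5 \<otimes> g 6"
  have c: "c \<in> carrier G" by (simp add: c_def)
  have \<rho>: "conjugate c (g 2) = \<rho>"
    by (simp add: c_def \<rho>_def conjugate_def inv_mult_group m_assoc)
  have "r m \<otimes> c = c \<otimes> r m"
    unfolding c_def by (intro commute_mult) (use r_stab_commuting[of m] in \<open>simp_all add: stab_commuting_def\<close>)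
  then have r: "conjugate c (r m) = r m" using c by (intro conjugate_commuting) simp_all
  have "conjugate c (r m \<otimes> g 2 \<otimes> r m) = conjugate c (g 2 \<otimes> r m \<otimes> g 2)"
    by (simp add: r_braid)
  then show ?thesis using c \<rho> r by (simp add: conjugate_mult)
qed

text \<open>Explicit elements of \<open>H\<close> that move the pairs of points in question to \<open>1, 3\<close>.\<close>

lemma transport_values:
  assumes "stab_commuting x"
  shows "transport x 1 3 = x" "transport x 3 1 = conjugate \<tau> x" "transport x 1 2 = conjugate (g 3) x"
    "transport x 5 3 = conjugate (g 2) x" "transport x 3 2 = conjugate \<rho> (conjugate \<tau> x)"
    "transport x 2 1 = conjugate (g 3) (conjugate \<tau> x)"
proof -
  have x: "x \<in> carrier G" using assms by (simp add: stab_commuting_def)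
  show "transport x 1 3 = x"
    using transport_eq[OF assms generate.one, of 1 3] x by (simp add: \<theta>_one conjugate_def)
  show "transport x 3 1 = conjugate \<tau> x" "transport x 1 2 = conjugate (g 3) x" "transport x 5 3 = conjugate (g 2) x"
    using transport_eq[OF assms, of \<tau> 3 1] transport_eq[OF assms, of "g 3" 1 2] transport_eq[OF assms, of "g 2" 5 3]
    by (simp_all add: \<theta>_simps)
  show "transport x 3 2 = conjugate \<rho> (conjugate \<tau> x)"
    using transport_eq[OF assms, of "\<rho> \<otimes> \<tau>" 3 2] x by (simp add: \<theta>_simps H_mult conjugate_conjugate)
  show "transport x 2 1 = conjugate (g 3) (conjugate \<tau> x)"
    using transport_eq[OF assms, of "g 3 \<otimes> \<tau>" 2 1] x by (simp add: \<theta>_simps H_mult conjugate_conjugate)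
qed

lemma transport_XA:
  assumes "i \<in> idx" "j \<in> idx" "i \<noteq> j"
  shows "transport X13 i j \<otimes> transport (B 1) i j [^] (n::int) = transport (\<tau> \<otimes> r (- n)) i j"
proof -
  obtain h where h: "h \<in> H" "\<theta> h i = 1" "\<theta> h j = 3" using ex_H2 assms by blast
  have "\<tau> \<otimes> r (- n) = X13 \<otimes> B 1 [^] n" unfolding X13_def g1_B1_pow[symmetric] by (simp add: m_assoc)
  then show ?thesis
    using transport_eq[OF _ h] h H_closed[OF h(1)]
    by (simp add: stab_commuting_base stab_commuting_mult r_stab_commuting conjugate_mult conjugate_int_pow)
       (simp add: stab_commuting_base stab_commuting_mult stab_commuting_pow conjugate_mult conjugate_int_pow)
qed

text \<open>Each of the twisting relations concerns two adjacent edges of the hexagon. Four of them do not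
  involve \<open>g 1\<close>, so that the conjugating elements lie in \<open>H\<close>.\<close>

lemma B_twist:
  "B 3 = conjugate (g 4 \<otimes> g 3) (B 4)" "B 5 = conjugate (g 4 \<otimes> g 5) (B 4)"
  "B 5 = conjugate (g 6 \<otimes> g 5) (B 6)" "B 2 = conjugate (g 6 \<otimes> g 2) (B 6)"
proof -
  have t3: "g' 3 = g 4 \<otimes> g' 4 \<otimes> g 3 \<otimes> g' 4 \<otimes> g 4"
    using twist(5) by (simp add: m_assoc cancels)
  have t5: "g' 5 = g 6 \<otimes> g' 6 \<otimes> g 5 \<otimes> g' 6 \<otimes> g 6"
    using twist(6) by (simp add: m_assoc cancels)
  have t2: "g' 2 = g 6 \<otimes> g' 6 \<otimes> g 2 \<otimes> g' 6 \<otimes> g 6"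
    using twist(3) by (simp add: m_assoc cancels)
  show "B 3 = conjugate (g 4 \<otimes> g 3) (B 4)"
    unfolding B_def using twist_conjugate[of "g 3" "g 4" "g' 4"] t3 g_braid[of 3 4] g_braid_prime[of 3 4]
    by simp
  show "B 5 = conjugate (g 4 \<otimes> g 5) (B 4)"
    unfolding B_def using twist_conjugate[of "g 5" "g 4" "g' 4"] twist(2) g_braid[of 5 4] g_braid_prime[of 5 4]
    by (simp add: insert_commute)
  show "B 5 = conjugate (g 6 \<otimes> g 5) (B 6)"
    unfolding B_def using twist_conjugate[of "g 5" "g 6" "g' 6"] t5 g_braid[of 5 6] g_braid_prime[of 5 6]
    by simp
  show "B 2 = conjugate (g 6 \<otimes> g 2) (B 6)"
    unfolding B_def using twist_conjugate[of "g 2" "g 6" "g' 6"] t2 g_braid[of 2 6] g_braid_prime[of 2 6]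
    by simp
qed

lemma B_untwist:
  "B 6 = conjugate (g 2 \<otimes> g 6) (B 2)" "B 5 = conjugate (g 6 \<otimes> g 5) (B 6)"
  "B 4 = conjugate (g 5 \<otimes> g 4) (B 5)" "B 3 = conjugate (g 4 \<otimes> g 3) (B 4)"
  using conjugate_by_inverse[of "g 6 \<otimes> g 2" "g 2 \<otimes> g 6", OF _ _ _ _ B_twist(4)]
    conjugate_by_inverse[of "g 4 \<otimes> g 5" "g 5 \<otimes> g 4", OF _ _ _ _ B_twist(2)] B_twist
  by (simp_all add: m_assoc cancels)

lemma B_values:
  "B 3 = transport (B 1) 1 2 \<otimes> inv transport (B 1) 1 3" "B 2 = transport (B 1) 5 3 \<otimes> inv transport (B 1) 1 3"
  unfolding transport_values[OF stab_commuting_base(2)] using twist(1,4)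
  by (simp_all add: conjugate_def B_def inv_mult_group m_assoc)

text \<open>The path \<open>B\<^sub>2, B\<^sub>6, B\<^sub>5, B\<^sub>4, B\<^sub>3\<close> of conjugations around the hexagon carries the expression of
  \<open>B\<^sub>2\<close> by \<open>A\<^sub>5\<^sub>3\<close> and \<open>A\<^sub>1\<^sub>3\<close> to an expression of \<open>B\<^sub>3\<close> which differs from the one in
  \<open>B_values\<close>.\<close>

lemma B_3_far: "B 3 = transport (B 1) 3 6 \<otimes> inv transport (B 1) 2 6"
proof -
  \<comment> \<open>the product of the conjugating elements in \<open>B_untwist\<close>, from \<open>B\<^sub>3\<close> back to \<open>B\<^sub>2\<close>\<close>
  define w where "w = g 4 \<otimes> g 3 \<otimes> (g 5 \<otimes> g 4) \<otimes> (g 6 \<otimes> g 5) \<otimes> (g 2 \<otimes> g 6)"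
  have w: "w \<in> H" unfolding w_def by (intro H_mult H_g)
  then have wc: "w \<in> carrier G" by (rule H_closed)
  have "B 3 = conjugate (g 4 \<otimes> g 3) (conjugate (g 5 \<otimes> g 4) (conjugate (g 6 \<otimes> g 5)
      (conjugate (g 2 \<otimes> g 6) (B 2))))"
    unfolding B_untwist(1)[symmetric] B_untwist(2)[symmetric] B_untwist(3)[symmetric]
    by (rule B_untwist(4))
  then have "B 3 = conjugate w (B 2)" by (simp add: w_def conjugate_conjugate m_assoc)
  also have "\<dots> = conjugate w (transport (B 1) 5 3) \<otimes> inv conjugate w (transport (B 1) 1 3)"
    unfolding B_values using wc stab_commuting_base(2)
    by (simp add: conjugate_mult conjugate_inv transport_closed)
  also have "conjugate w (transport (B 1) 5 3) = transport (B 1) 3 6"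
    using transport_conj[OF stab_commuting_base(2) w, of 3 6] by (simp add: w_def \<theta>_simps)
  also have "conjugate w (transport (B 1) 1 3) = transport (B 1) 2 6"
    using transport_conj[OF stab_commuting_base(2) w, of 2 6] by (simp add: w_def \<theta>_simps)
  finally show ?thesis .
qed

text \<open>Every relation is verified for the points \<open>1, 3, 2, 6\<close> and transported. The last one compares
  the two expressions for \<open>B 3\<close>.\<close>

theorem kernel_family: "xa_family G idx (transport X13) (transport (B 1))"
proof unfold_locales
  fix i j assume ij: "i \<in> idx" "j \<in> idx" "i \<noteq> j"
  show "transport X13 i j \<in> carrier G" "transport (B 1) i j \<in> carrier G"
    using ij by (simp_all add: transport_closed stab_commuting_base del: atLeastAtMost_iff)
  fix n :: int
  let ?y = "\<tau> \<otimes> r (- n)"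
  have y: "stab_commuting ?y" by (intro stab_commuting_mult stab_commuting_base r_stab_commuting)
  obtain h where h: "h \<in> H" "\<theta> h i = 1" "\<theta> h j = 3" using ex_H2 ij by blast
  have hc: "h \<in> carrier G" using h H_closed by simp
  have "transport ?y 3 1 = inv (transport ?y 1 3)"
    by (simp add: transport_values y conjugate_def inv_mult_group m_assoc cancels \<tau>_square
        involution_inv[OF r_closed r_square])
  then have "transport ?y j i = inv (transport ?y i j)"
    using transport_conj[OF y h(1), of i j] transport_conj[OF y h(1), of j i] h ij hc transport_closed[OF y, of 1 3]
    by (simp add: conjugate_inv)
  then show "transport X13 j i \<otimes> transport (B 1) j i [^] n = inv (transport X13 i j \<otimes> transport (B 1) i j [^] n)"
    using transport_XA ij by metis
next
  fix i j k :: nat and n :: int assume ij: "i \<in> idx" "j \<in> idx" "k \<in> idx" "distinct [i, j, k]"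
  let ?y = "\<tau> \<otimes> r (- n)"
  have y: "stab_commuting ?y" by (intro stab_commuting_mult stab_commuting_base r_stab_commuting)
  obtain h where h: "h \<in> H" "\<theta> h i = 1" "\<theta> h j = 3" "\<theta> h k = 2" using ex_H3 ij by blast
  have hc: "h \<in> carrier G" using h H_closed by simp
  have v: "transport ?y 1 3 = \<tau> \<otimes> r (- n)" "transport ?y 3 2 = \<rho> \<otimes> (r (- n) \<otimes> \<tau>) \<otimes> \<rho>"
    "transport ?y 2 1 = g 3 \<otimes> (r (- n) \<otimes> \<tau>) \<otimes> g 3"
    by (simp_all add: transport_values y conjugate_def m_assoc cancels)
  have base: "transport ?y 1 3 \<otimes> transport ?y 3 2 \<otimes> transport ?y 2 1 = \<one>" "transport ?y 3 2 \<otimes> transport ?y 1 3 \<otimes> transport ?y 2 1 = \<one>"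
    unfolding v
    by (rule triangle_relations; simp add: \<tau>_square \<rho>_square r_square \<tau>_\<rho> r_braid r_braid_\<rho>)+
  have t: "transport ?y i j = conjugate h (transport ?y 1 3)" "transport ?y j k = conjugate h (transport ?y 3 2)"
    "transport ?y k i = conjugate h (transport ?y 2 1)"
    using transport_conj[OF y h(1), of i j] transport_conj[OF y h(1), of j k] transport_conj[OF y h(1), of k i] h ij
    by simp_all
  have cc: "transport ?y 1 3 \<in> carrier G" "transport ?y 3 2 \<in> carrier G" "transport ?y 2 1 \<in> carrier G"
    using transport_closed[OF y] by simp_all
  have "transport ?y i j \<otimes> transport ?y j k \<otimes> transport ?y k i = \<one>" "transport ?y j k \<otimes> transport ?y i j \<otimes> transport ?y k i = \<one>"
    unfolding t using cc hc base by (simp_all add: conjugate_mult[symmetric])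
  then show "transport X13 i j \<otimes> transport (B 1) i j [^] n \<otimes> (transport X13 j k \<otimes> transport (B 1) j k [^] n) \<otimes>
      (transport X13 k i \<otimes> transport (B 1) k i [^] n) = \<one>"
    "transport X13 j k \<otimes> transport (B 1) j k [^] n \<otimes> (transport X13 i j \<otimes> transport (B 1) i j [^] n) \<otimes>
      (transport X13 k i \<otimes> transport (B 1) k i [^] n) = \<one>"
    using transport_XA ij by simp_all
next
  fix i j k l :: nat assume ij: "i \<in> idx" "j \<in> idx" "k \<in> idx" "l \<in> idx" "distinct [i, j, k, l]"
  let ?b = "transport (B 1)"
  obtain h where h: "h \<in> H" "\<theta> h i = 1" "\<theta> h j = 3" "\<theta> h k = 2" "\<theta> h l = 6"
    using ex_H4 ij by blast
  have hc: "h \<in> carrier G" using h H_closed by simp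
  have cc: "?b 1 3 \<in> carrier G" "?b 1 2 \<in> carrier G" "?b 2 6 \<in> carrier G" "?b 3 6 \<in> carrier G"
    using transport_closed[OF stab_commuting_base(2)] by simp_all
  have "inv (?b 1 2 \<otimes> inv ?b 1 3) = inv (?b 3 6 \<otimes> inv ?b 2 6)"
    using B_values(1) B_3_far by simp
  then have base: "?b 1 3 \<otimes> inv ?b 1 2 = ?b 2 6 \<otimes> inv ?b 3 6"
    using cc by (simp add: inv_mult_group)
  have t: "?b i j = conjugate h (?b 1 3)" "?b i k = conjugate h (?b 1 2)"
    "?b k l = conjugate h (?b 2 6)" "?b j l = conjugate h (?b 3 6)"
    using transport_conj[OF stab_commuting_base(2) h(1), of i j] transport_conj[OF stab_commuting_base(2) h(1), of i k]
      transport_conj[OF stab_commuting_base(2) h(1), of k l] transport_conj[OF stab_commuting_base(2) h(1), of j l] h ij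
    by simp_all
  show "?b i j \<otimes> inv ?b i k = ?b k l \<otimes> inv ?b j l"
    unfolding t using cc hc base by (simp add: conjugate_mult[symmetric] conjugate_inv[symmetric])
qed

subsection \<open>Generation of the kernel\<close>

abbreviation N :: "'a set" where
  "N \<equiv> generate G ({transport X13 i j | i j. i \<in> idx \<and> j \<in> idx \<and> i \<noteq> j} \<union>
    {transport (B 1) i j | i j. i \<in> idx \<and> j \<in> idx \<and> i \<noteq> j})"

lemma N_incl:
  assumes "i \<in> idx" "j \<in> idx" "i \<noteq> j"
  shows "transport X13 i j \<in> N" "transport (B 1) i j \<in> N"
  by (rule generate.incl, use assms in blast)+

lemma N_closed: "x \<in> N \<Longrightarrow> x \<in> carrier G"
  by (erule generate_in_carrier[rotated]) (auto simp: transport_closed stab_commuting_base simp del: atLeastAtMost_iff)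

lemma N_inv: "x \<in> N \<Longrightarrow> inv x \<in> N"
  by (erule generate_m_inv_closed[rotated]) (auto simp: transport_closed stab_commuting_base simp del: atLeastAtMost_iff)

lemma N_conj_transport:
  assumes h: "h \<in> H" and x: "stab_commuting x" and ij: "i \<in> idx" "j \<in> idx" "i \<noteq> j"
  shows "\<exists>k\<in>idx. \<exists>l\<in>idx. k \<noteq> l \<and> conjugate h (transport x i j) = transport x k l"
proof -
  have p: "\<theta> h permutes idx" using h H_closed \<theta>_permutes by blast
  obtain k l where "\<theta> h k = i" "\<theta> h l = j" using permutes_surj[OF p] by (metis surjD)
  moreover have "k \<in> idx" "l \<in> idx" "k \<noteq> l" using calculation ij permutes_in_image[OF p] by metis+
  ultimately show ?thesis using transport_conj[OF x h, of k l] by metis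
qed

lemma N_conj:
  assumes h: "h \<in> H" and x: "x \<in> N"
  shows "conjugate h x \<in> N"
proof -
  have hc: "h \<in> carrier G" using h H_closed by simp
  have transport: "conjugate h (transport x i j) \<in> N"
    if x: "x \<in> {X13, B 1}" and ij: "i \<in> idx" "j \<in> idx" "i \<noteq> j" for x i j
  proof -
    have "stab_commuting x" using x stab_commuting_base by blast
    then obtain k l where "k \<in> idx" "l \<in> idx" "k \<noteq> l" "conjugate h (transport x i j) = transport x k l"
      using N_conj_transport[OF h _ ij] by blast
    then show ?thesis using N_incl[of k l] x by auto
  qed
  show ?thesis
    using x
  proof (induction rule: generate.induct)
    case one
    then show ?case using hc generate.one by simp
  next
    case (incl s)
    then show ?case using transport by blast
  next
    case (inv s)
    have sc: "s \<in> carrier G" by (rule N_closed, rule generate.incl, rule inv)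
    have "conjugate h s \<in> N" using inv transport by blast
    then have "inv (conjugate h s) \<in> N" by (rule N_inv)
    then show ?case unfolding conjugate_inv[OF hc sc] .
  next
    case (eng x y)
    show ?case
      unfolding conjugate_mult[OF hc N_closed[OF eng(1)] N_closed[OF eng(2)]]
      using eng(3,4) by (rule generate.eng)
  qed
qed

lemma B_in_N: "j \<in> idx \<Longrightarrow> B j \<in> N"
proof -
  have 1: "B 1 \<in> N" using N_incl(2)[of 1 3] by (simp add: transport_values stab_commuting_base)
  have 2: "B 2 \<in> N" unfolding B_values using N_incl(2) by (intro generate.eng N_inv) auto
  have 6: "B 6 \<in> N" unfolding B_untwist(1) using 2 by (intro N_conj H_mult H_g)
  have 5: "B 5 \<in> N" unfolding B_untwist(2) using 6 by (intro N_conj H_mult H_g)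
  have 4: "B 4 \<in> N" unfolding B_untwist(3) using 5 by (intro N_conj H_mult H_g)
  have 3: "B 3 \<in> N" unfolding B_untwist(4) using 4 by (intro N_conj H_mult H_g)
  assume "j \<in> idx"
  then have "j = 1 \<or> j = 2 \<or> j = 3 \<or> j = 4 \<or> j = 5 \<or> j = 6" by auto
  then show ?thesis using 1 2 3 4 5 6 by auto
qed

text \<open>The element \<open>g 1\<close> is \<open>\<tau> X\<^sub>1\<^sub>3\<close>, and \<open>g' j = g j B\<^sub>j\<close> with \<open>B\<^sub>j\<close> in the normal subgroup
  \<open>N\<close>.\<close>

lemma g_decomp:
  assumes "j \<in> idx"
  shows "\<exists>a\<in>N. \<exists>h\<in>H. g j = a \<otimes> h" "\<exists>a\<in>N. \<exists>h\<in>H. g' j = a \<otimes> h"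
proof -
  show d: "\<exists>a\<in>N. \<exists>h\<in>H. g j = a \<otimes> h"
  proof (cases "j = 1")
    case True
    have "X13 \<in> N" using N_incl(1)[of 1 3] by (simp add: transport_values stab_commuting_base)
    then have "conjugate \<tau> X13 \<in> N" by (intro N_conj \<tau>_H)
    moreover have "g 1 = conjugate \<tau> X13 \<otimes> \<tau>"
      by (simp add: conjugate_def X13_def m_assoc cancels \<tau>_square)
    ultimately show ?thesis using True \<tau>_H by blast
  next
    case False
    then have "g j \<in> H" using assms by (intro generate.incl) auto
    moreover have "g j = \<one> \<otimes> g j" using assms g_closed by simp
    ultimately show ?thesis using generate.one by blast
  qed
  then obtain a h where ah: "a \<in> N" "h \<in> H" "g j = a \<otimes> h" by blast
  have c: "a \<in> carrier G" "h \<in> carrier G" "g j \<in> carrier G" "g' j \<in> carrier G"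
    using ah N_closed H_closed assms g_closed g'_closed by auto
  have B: "B j \<in> N" "B j \<in> carrier G" using B_in_N[OF assms] N_closed by auto
  have "g' j = g j \<otimes> B j" unfolding B_def using c g_square[OF assms] by (simp add: involution_cancel)
  also have "\<dots> = (a \<otimes> conjugate h (B j)) \<otimes> h"
    using ah c B by (simp add: conjugate_def m_assoc)
  finally show "\<exists>a\<in>N. \<exists>h\<in>H. g' j = a \<otimes> h"
    using generate.eng[OF ah(1) N_conj[OF ah(2) B(1)]] ah(2) by blast
qed

lemma \<theta>_conjugate:
  assumes "h \<in> carrier G" "x \<in> carrier G" "\<theta> x = id"
  shows "\<theta> (conjugate h x) = id"
  using assms \<theta>_mult[of h "inv h"] by (simp add: conjugate_def \<theta>_mult \<theta>_one)

lemma N_kernel: "x \<in> N \<Longrightarrow> \<theta> x = id"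
proof (induction rule: generate.induct)
  have transport: "\<theta> (transport x i j) = id" if "stab_commuting x" "\<theta> x = id" "i \<in> idx" "j \<in> idx" "i \<noteq> j" for x i j
  proof -
    obtain h where h: "h \<in> H" "\<theta> h i = 1" "\<theta> h j = 3" using ex_H2 \<open>i \<in> idx\<close> \<open>j \<in> idx\<close> \<open>i \<noteq> j\<close> by blast
    then show ?thesis
      using transport_eq[OF that(1) h] \<theta>_conjugate[OF H_closed] that by (simp add: stab_commuting_def)
  qed
  have "\<theta> X13 = id" "\<theta> (B 1) = id"
    by (simp_all add: X13_def B_def \<theta>_simps \<theta>_g' psi_transp_def fun_eq_iff)
  note gens = transport[OF stab_commuting_base(4) this(1)] transport[OF stab_commuting_base(2) this(2)]
  {
    case one
    then show ?case by (rule \<theta>_one)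
  next
    case (incl s)
    then show ?case using gens by blast
  next
    case (inv s)
    then have "\<theta> s = id" using gens by blast
    moreover have "s \<in> carrier G" by (rule N_closed, rule generate.incl, rule inv)
    ultimately show ?case using \<theta>_mult[of s "inv s"] \<theta>_one by simp
  next
    case (eng x y)
    then show ?case using \<theta>_mult[OF N_closed[OF eng(1)] N_closed[OF eng(2)]] by simp
  }
qed

text \<open>By the decomposition of the generators the whole group is \<open>N H\<close>, and \<open>\<theta>\<close> is trivial on \<open>N\<close> and
  faithful on \<open>H\<close>.\<close>

theorem kernel_generated:
  assumes x: "x \<in> generate G (g ` idx \<union> g' ` idx)" and \<theta>: "\<theta> x = id"
  shows "x \<in> N"
proof -
  have "\<exists>a\<in>N. \<exists>h\<in>H. x = a \<otimes> h"
    using x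
  proof (rule generate_involutions_induct)
    show "g ` idx \<union> g' ` idx \<subseteq> carrier G" using g_closed g'_closed by blast
    show "\<And>s. s \<in> g ` idx \<union> g' ` idx \<Longrightarrow> s \<otimes> s = \<one>" using g_square g'_square by blast
    have "\<one> = \<one> \<otimes> \<one>" by simp
    then show "\<exists>a\<in>N. \<exists>h\<in>H. \<one> = a \<otimes> h" using generate.one by blast
  next
    fix y s assume y: "\<exists>a\<in>N. \<exists>h\<in>H. y = a \<otimes> h" and s: "s \<in> g ` idx \<union> g' ` idx"
    obtain a h where ah: "a \<in> N" "h \<in> H" "y = a \<otimes> h" using y by blast
    obtain b k where bk: "b \<in> N" "k \<in> H" "s = b \<otimes> k" using s g_decomp by blast
    have c: "a \<in> carrier G" "h \<in> carrier G" "b \<in> carrier G" "k \<in> carrier G"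
      using ah bk N_closed H_closed by auto
    have "y \<otimes> s = (a \<otimes> conjugate h b) \<otimes> (h \<otimes> k)"
      using ah bk c by (simp add: conjugate_def m_assoc inv_cancel_left)
    then show "\<exists>a\<in>N. \<exists>h\<in>H. y \<otimes> s = a \<otimes> h"
      using generate.eng[OF ah(1) N_conj[OF ah(2) bk(1)]] H_mult[OF ah(2) bk(2)] by blast
  qed
  then obtain a h where ah: "a \<in> N" "h \<in> H" "x = a \<otimes> h" by blast
  have c: "a \<in> carrier G" "h \<in> carrier G" using ah N_closed H_closed by auto
  have "\<theta> h = id" using \<theta> ah c N_kernel \<theta>_mult by simp
  then have "h = \<one>" using H_faithful ah(2) by blast
  then show ?thesis using ah(1,3) c(1) by simp
qed

end

section \<open>Consequences of the relations between X and A\<close>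

text \<open>The existence of a further index next to four given ones is used to compare quotients of the
  \<open>A i j\<close> that have no index in common.\<close>

locale xa_family_large = xa_family G I X A for G (structure) and I :: "'i set" and X A +
  assumes fresh: "\<exists>m\<in>I. m \<noteq> a \<and> m \<noteq> b \<and> m \<noteq> c \<and> m \<noteq> d"
begin

definition Y :: "int \<Rightarrow> 'i \<Rightarrow> 'i \<Rightarrow> 'a" where
  "Y n i j = X i j \<otimes> A i j [^] n"

lemma Y_closed: "\<lbrakk>i \<in> I; j \<in> I; i \<noteq> j\<rbrakk> \<Longrightarrow> Y n i j \<in> carrier G"
  by (simp add: Y_def X_closed A_closed)

lemma Y_flip: "\<lbrakk>i \<in> I; j \<in> I; i \<noteq> j\<rbrakk> \<Longrightarrow> Y n j i = inv (Y n i j)"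
  unfolding Y_def by (rule flip)

lemma Y_chain:
  assumes "i \<in> I" "j \<in> I" "k \<in> I" "distinct [i, j, k]"
  shows "Y n i j \<otimes> Y n j k = Y n i k" "Y n j k \<otimes> Y n i j = Y n i k"
proof -
  have c: "Y n i j \<in> carrier G" "Y n j k \<in> carrier G" "Y n k i \<in> carrier G"
    using assms by (auto intro: Y_closed)
  have ik: "Y n i k = inv (Y n k i)" using Y_flip[of k i] assms by auto
  have "Y n i j \<otimes> Y n j k \<otimes> Y n k i = \<one>" "Y n j k \<otimes> Y n i j \<otimes> Y n k i = \<one>"
    using triangle[OF assms] triangle'[OF assms] unfolding Y_def by auto
  then show "Y n i j \<otimes> Y n j k = Y n i k" "Y n j k \<otimes> Y n i j = Y n i k"
    unfolding ik using c by (metis inv_equality m_closed)+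
qed

lemma Y_step: "\<lbrakk>i \<in> I; j \<in> I; i \<noteq> j\<rbrakk> \<Longrightarrow> Y (n + 1) i j = Y n i j \<otimes> A i j"
  unfolding Y_def by (simp add: int_pow_mult A_closed X_closed m_assoc)

text \<open>The common value of the two sides of the last relation, which does not depend on the auxiliary
  index (\<open>C_left\<close>, \<open>C_right\<close>). In \<open>Pi1\<close> the elements \<open>B\<^sub>2, \<dots>, B\<^sub>6\<close> are of this kind.\<close>

definition C :: "'i \<Rightarrow> 'i \<Rightarrow> 'a" where
  "C k j = (let m = (SOME m. m \<in> I \<and> m \<noteq> k \<and> m \<noteq> j) in A k m \<otimes> inv A j m)"

lemma C_left:
  assumes "k \<in> I" "j \<in> I" "l \<in> I" "distinct [k, j, l]"
  shows "C k j = A k l \<otimes> inv A j l"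
proof -
  define m where "m = (SOME m. m \<in> I \<and> m \<noteq> k \<and> m \<noteq> j)"
  have m: "m \<in> I \<and> m \<noteq> k \<and> m \<noteq> j" unfolding m_def by (rule someI[of _ l]) (use assms in auto)
  obtain i where i: "i \<in> I" "i \<noteq> j" "i \<noteq> k" "i \<noteq> l" "i \<noteq> m" using fresh[of j k l m] by blast
  have "C k j = A k m \<otimes> inv A j m" unfolding C_def m_def by (simp add: Let_def)
  also have "\<dots> = A i j \<otimes> inv A i k" using quad[of i j k m] i m assms by auto
  also have "\<dots> = A k l \<otimes> inv A j l" using quad[of i j k l] i assms by auto
  finally show ?thesis .
qed

lemma C_right:
  assumes "k \<in> I" "j \<in> I" "i \<in> I" "distinct [k, j, i]"
  shows "C k j = A i j \<otimes> inv A i k"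
proof -
  obtain l where l: "l \<in> I" "l \<noteq> j" "l \<noteq> k" "l \<noteq> i" using fresh[of j k i i] by blast
  then show ?thesis using C_left[of k j l] quad[of i j k l] assms by auto
qed

lemma C_closed: "\<lbrakk>k \<in> I; j \<in> I; k \<noteq> j\<rbrakk> \<Longrightarrow> C k j \<in> carrier G"
proof -
  assume kj: "k \<in> I" "j \<in> I" "k \<noteq> j"
  obtain l where l: "l \<in> I" "l \<noteq> j" "l \<noteq> k" using fresh[of j k k k] by blast
  then show ?thesis using C_left[of k j l] kj by (auto simp: A_closed)
qed

lemma C_flip: "\<lbrakk>k \<in> I; j \<in> I; k \<noteq> j\<rbrakk> \<Longrightarrow> C j k = inv C k j"
proof -
  assume kj: "k \<in> I" "j \<in> I" "k \<noteq> j"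
  obtain l where l: "l \<in> I" "l \<noteq> j" "l \<noteq> k" using fresh[of j k k k] by blast
  have "A k l \<in> carrier G" "A j l \<in> carrier G" using kj l by (auto intro: A_closed)
  then show ?thesis using C_left[of k j l] C_left[of j k l] kj l by (auto simp: inv_mult_group)
qed

text \<open>Written with a common second index and with a common first index, the quotients compose in the
  two opposite orders, so consecutive ones commute. All of them commute as a consequence.\<close>

lemma C_chain:
  assumes "k \<in> I" "l \<in> I" "j \<in> I" "distinct [k, l, j]"
  shows "C k l \<otimes> C l j = C k j" "C l j \<otimes> C k l = C k j"
proof -
  obtain m where m: "m \<in> I" "m \<noteq> j" "m \<noteq> k" "m \<noteq> l" using fresh[of j k l l] by blast
  have c: "A k m \<in> carrier G" "A l m \<in> carrier G" "A j m \<in> carrier G"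
    "A m k \<in> carrier G" "A m l \<in> carrier G" "A m j \<in> carrier G"
    using assms m by (auto intro: A_closed)
  show "C k l \<otimes> C l j = C k j"
    using C_left[of k l m] C_left[of l j m] C_left[of k j m] assms m c
    by (auto simp: m_assoc inv_cancel_left)
  show "C l j \<otimes> C k l = C k j"
    using C_right[of k l m] C_right[of l j m] C_right[of k j m] assms m c
    by (auto simp: m_assoc inv_cancel_left)
qed

lemma C_commute_chain:
  assumes "k \<in> I" "l \<in> I" "j \<in> I" "distinct [k, l, j]"
  shows "C k l \<otimes> C l j = C l j \<otimes> C k l"
  using C_chain[OF assms] by simp

lemma C_commute_source:
  assumes "k \<in> I" "l \<in> I" "j \<in> I" "distinct [k, l, j]"
  shows "C k l \<otimes> C k j = C k j \<otimes> C k l"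
  unfolding C_chain(1)[OF assms, symmetric]
  by (rule commute_mult) (use assms C_closed C_commute_chain[OF assms] in auto)

lemma C_commute_target:
  assumes "k \<in> I" "l \<in> I" "j \<in> I" "distinct [k, l, j]"
  shows "C k j \<otimes> C l j = C l j \<otimes> C k j"
  unfolding C_chain(1)[OF assms, symmetric]
  by (rule commute_mult[symmetric]) (use assms C_closed C_commute_chain[OF assms] in auto)

lemma C_commute_disjoint:
  assumes "i \<in> I" "j \<in> I" "k \<in> I" "l \<in> I" "distinct [i, j, k, l]"
  shows "C i j \<otimes> C k l = C k l \<otimes> C i j"
proof -
  have e: "C k l = C k i \<otimes> C i l" using C_chain(1)[of k i l] assms by auto
  show ?thesis unfolding e
    by (rule commute_mult)
      (use assms C_closed C_commute_chain[of k i j] C_commute_source[of i j l] in auto)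
qed

text \<open>The triangle relations for \<open>n\<close> and \<open>n + 1\<close> hold for elements that differ by factors \<open>A i j\<close>;
  comparing them expresses how these factors are conjugated.\<close>

lemma Y_conj:
  assumes "i \<in> I" "j \<in> I" "k \<in> I" "distinct [i, j, k]"
  shows "conjugate (Y n k j) (A i j) = C i j" "conjugate (Y n k j) (A k i) = C k i"
proof -
  have c: "Y n i j \<in> carrier G" "Y n j k \<in> carrier G" "Y n k i \<in> carrier G" "Y n j i \<in> carrier G"
    "A i j \<in> carrier G" "A j k \<in> carrier G" "A i k \<in> carrier G" "A k i \<in> carrier G" "A j i \<in> carrier G"
    using assms by (auto intro: Y_closed A_closed)
  have kj: "Y n k j = inv (Y n j k)" using Y_flip[of j k] assms by simp
  have "Y n i j \<otimes> (A i j \<otimes> Y n j k \<otimes> A j k) = Y (n + 1) i j \<otimes> Y (n + 1) j k"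
    using Y_step[of i j n] Y_step[of j k n] assms c by (simp add: m_assoc)
  also have "\<dots> = Y n i j \<otimes> (Y n j k \<otimes> A i k)"
    using Y_chain(1)[OF assms, of "n + 1"] Y_chain(1)[OF assms, of n] Y_step[of i k n] assms c
    by (simp add: m_assoc[symmetric])
  finally have "A i j \<otimes> Y n j k \<otimes> A j k = Y n j k \<otimes> A i k" using c by simp
  then have "inv (Y n j k) \<otimes> (A i j \<otimes> Y n j k \<otimes> A j k) \<otimes> inv A j k =
      inv (Y n j k) \<otimes> (Y n j k \<otimes> A i k) \<otimes> inv A j k" by simp
  then have "inv (Y n j k) \<otimes> A i j \<otimes> Y n j k = A i k \<otimes> inv A j k"
    using c by (simp add: m_assoc inv_cancel_left)
  then show "conjugate (Y n k j) (A i j) = C i j"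
    using C_left[of i j k] assms c unfolding kj by (simp add: conjugate_def)
  have p: "j \<in> I" "k \<in> I" "i \<in> I" "distinct [j, k, i]" using assms by auto
  have "Y n k i \<otimes> (A k i \<otimes> Y n j k \<otimes> A j k) = Y (n + 1) k i \<otimes> Y (n + 1) j k"
    using Y_step[of k i n] Y_step[of j k n] assms c by (auto simp: m_assoc)
  also have "\<dots> = Y n k i \<otimes> (Y n j k \<otimes> A j i)"
    using Y_chain(2)[OF p, of "n + 1"] Y_chain(2)[OF p, of n] Y_step[of j i n] assms c
    by (auto simp: m_assoc[symmetric])
  finally have "A k i \<otimes> Y n j k \<otimes> A j k = Y n j k \<otimes> A j i" using c by simp
  then have "inv (Y n j k) \<otimes> (A k i \<otimes> Y n j k \<otimes> A j k) \<otimes> inv A j k =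
      inv (Y n j k) \<otimes> (Y n j k \<otimes> A j i) \<otimes> inv A j k" by simp
  then have "inv (Y n j k) \<otimes> A k i \<otimes> Y n j k = A j i \<otimes> inv A j k"
    using c by (simp add: m_assoc inv_cancel_left)
  then show "conjugate (Y n k j) (A k i) = C k i"
    using C_right[of k i j] assms c unfolding kj by (auto simp: conjugate_def)
qed

lemma Y_conj_C:
  assumes "i \<in> I" "j \<in> I" "k \<in> I" "distinct [i, j, k]"
  shows "conjugate (Y n k j) (C i k) = A i k" "conjugate (Y n k j) (C j i) = A j i"
proof -
  have c: "Y n k j \<in> carrier G" "Y n j k \<in> carrier G" "A i k \<in> carrier G" "A j i \<in> carrier G"
    using assms by (auto intro: Y_closed A_closed)
  have one: "Y n k j \<otimes> Y n j k = \<one>" using Y_flip[of j k] assms c by simp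
  show "conjugate (Y n k j) (C i k) = A i k"
    using conjugate_by_inverse[OF c(2,1,3) one] Y_conj(1)[of i k j n] assms by auto
  show "conjugate (Y n k j) (C j i) = A j i"
    using conjugate_by_inverse[OF c(2,1,4) one] Y_conj(2)[of i k j n] assms by auto
qed

text \<open>The elements \<open>A i j\<close> and \<open>A i k\<close> are simultaneously conjugate to two of the commuting
  quotients.\<close>

lemma A_commute_source:
  assumes "i \<in> I" "j \<in> I" "k \<in> I" "distinct [i, j, k]"
  shows "A i j \<otimes> A i k = A i k \<otimes> A i j"
proof -
  obtain m where m: "m \<in> I" "m \<noteq> i" "m \<noteq> j" "m \<noteq> k" using fresh[of i j k k] by blast
  have "A i j = conjugate (Y 0 m i) (C i j)" "A i k = conjugate (Y 0 m i) (C i k)"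
    using Y_conj_C(2)[of j i m 0] Y_conj_C(2)[of k i m 0] assms m by auto
  moreover have "C i j \<otimes> C i k = C i k \<otimes> C i j" using C_commute_source[of i j k] assms by simp
  moreover have "C i j \<in> carrier G" "C i k \<in> carrier G" "Y 0 m i \<in> carrier G"
    using assms m by (auto intro: C_closed Y_closed)
  ultimately show ?thesis by (simp add: conjugate_mult[symmetric])
qed

lemma A_commute_target:
  assumes "i \<in> I" "j \<in> I" "k \<in> I" "distinct [i, j, k]"
  shows "A i k \<otimes> A j k = A j k \<otimes> A i k"
proof -
  obtain m where m: "m \<in> I" "m \<noteq> i" "m \<noteq> j" "m \<noteq> k" using fresh[of i j k k] by blast
  have "A i k = conjugate (Y 0 k m) (C i k)" "A j k = conjugate (Y 0 k m) (C j k)"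
    using Y_conj_C(1)[of i m k 0] Y_conj_C(1)[of j m k 0] assms m by auto
  moreover have "C i k \<otimes> C j k = C j k \<otimes> C i k" using C_commute_target[of i j k] assms by simp
  moreover have "C i k \<in> carrier G" "C j k \<in> carrier G" "Y 0 k m \<in> carrier G"
    using assms m by (auto intro: C_closed Y_closed)
  ultimately show ?thesis by (simp add: conjugate_mult[symmetric])
qed

text \<open>Writing \<open>Y n k j\<close> as a product through \<open>i\<close> turns \<open>A l i\<close> into \<open>C l i\<close> and back.\<close>

lemma Y_fixes_A:
  assumes "i \<in> I" "j \<in> I" "k \<in> I" "l \<in> I" "distinct [i, j, k, l]"
  shows "conjugate (Y n k j) (A l i) = A l i"
proof -
  have c: "Y n i j \<in> carrier G" "Y n k i \<in> carrier G" "A l i \<in> carrier G"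
    using assms by (auto intro: Y_closed A_closed)
  have "Y n k j = Y n i j \<otimes> Y n k i" using Y_chain(2)[of k i j n] assms by auto
  then have "conjugate (Y n k j) (A l i) = conjugate (Y n i j) (conjugate (Y n k i) (A l i))"
    using c by (simp add: conjugate_conjugate)
  then show ?thesis using Y_conj(1)[of l i k n] Y_conj_C(1)[of l j i n] assms by auto
qed

lemma Y_commute_C:
  assumes "i \<in> I" "j \<in> I" "k \<in> I" "l \<in> I" "distinct [i, j, k, l]"
  shows "Y n k j \<otimes> C l i = C l i \<otimes> Y n k j"
proof -
  obtain m where m: "m \<in> I" "m \<noteq> i" "m \<noteq> j" "m \<noteq> k" "m \<noteq> l" using fresh[of i j k l] by blast
  have c: "Y n k j \<in> carrier G" "A l m \<in> carrier G" "A i m \<in> carrier G" "C l i \<in> carrier G"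
    using assms m by (auto intro: Y_closed A_closed C_closed)
  have "C l i = A l m \<otimes> inv A i m" using C_left[of l i m] assms m by auto
  then have "conjugate (Y n k j) (C l i) = C l i"
    using Y_fixes_A[of m j k l n] Y_fixes_A[of m j k i n] assms m c
    by (auto simp: conjugate_mult conjugate_inv)
  then have "C l i \<otimes> Y n k j = Y n k j \<otimes> C l i \<otimes> inv (Y n k j) \<otimes> Y n k j"
    by (simp add: conjugate_def)
  then show ?thesis using c by (simp add: m_assoc)
qed

end

section \<open>Semidirect products\<close>

definition semidirect ::
  "('k, 'm) monoid_scheme \<Rightarrow> ('p, 'n) monoid_scheme \<Rightarrow> ('p \<Rightarrow> 'k \<Rightarrow> 'k) \<Rightarrow> ('k \<times> 'p) monoid" where
  "semidirect K S \<alpha> = \<lparr> carrier = carrier K \<times> carrier S,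
     monoid.mult = (\<lambda>(x, p) (y, q). (x \<otimes>\<^bsub>K\<^esub> \<alpha> p y, p \<otimes>\<^bsub>S\<^esub> q)),
     one = (\<one>\<^bsub>K\<^esub>, \<one>\<^bsub>S\<^esub>) \<rparr>"

lemma semidirect_simps [simp]:
  "carrier (semidirect K S \<alpha>) = carrier K \<times> carrier S"
  "(x, p) \<otimes>\<^bsub>semidirect K S \<alpha>\<^esub> (y, q) = (x \<otimes>\<^bsub>K\<^esub> \<alpha> p y, p \<otimes>\<^bsub>S\<^esub> q)"
  "\<one>\<^bsub>semidirect K S \<alpha>\<^esub> = (\<one>\<^bsub>K\<^esub>, \<one>\<^bsub>S\<^esub>)"
  by (simp_all add: semidirect_def)

lemma group_semidirect:
  assumes K: "group K" and S: "group S"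
    and hom: "\<And>p. p \<in> carrier S \<Longrightarrow> \<alpha> p \<in> hom K K"
    and one: "\<And>x. x \<in> carrier K \<Longrightarrow> \<alpha> \<one>\<^bsub>S\<^esub> x = x"
    and mult: "\<And>p q x. \<lbrakk>p \<in> carrier S; q \<in> carrier S; x \<in> carrier K\<rbrakk> \<Longrightarrow>
      \<alpha> (p \<otimes>\<^bsub>S\<^esub> q) x = \<alpha> p (\<alpha> q x)"
  shows "group (semidirect K S \<alpha>)"
proof -
  interpret K: group K by fact
  interpret S: group S by fact
  have c: "\<alpha> p x \<in> carrier K" if "p \<in> carrier S" "x \<in> carrier K" for p x
    using hom_in_carrier[OF hom] that by blast
  have m: "\<alpha> p (x \<otimes>\<^bsub>K\<^esub> y) = \<alpha> p x \<otimes>\<^bsub>K\<^esub> \<alpha> p y"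
    if "p \<in> carrier S" "x \<in> carrier K" "y \<in> carrier K" for p x y
    using hom_mult[OF hom] that by blast
  have o: "\<alpha> p \<one>\<^bsub>K\<^esub> = \<one>\<^bsub>K\<^esub>" if "p \<in> carrier S" for p
    using hom_one[OF hom K K] that by blast
  show ?thesis
  proof (rule groupI)
    fix u assume "u \<in> carrier (semidirect K S \<alpha>)"
    then obtain x p where u: "u = (x, p)" "x \<in> carrier K" "p \<in> carrier S" by auto
    let ?v = "(\<alpha> (inv\<^bsub>S\<^esub> p) (inv\<^bsub>K\<^esub> x), inv\<^bsub>S\<^esub> p)"
    have "?v \<otimes>\<^bsub>semidirect K S \<alpha>\<^esub> u = \<one>\<^bsub>semidirect K S \<alpha>\<^esub>"
      using u m[of "inv\<^bsub>S\<^esub> p" "inv\<^bsub>K\<^esub> x" x] o by simp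
    moreover have "?v \<in> carrier (semidirect K S \<alpha>)" using u c by simp
    ultimately show "\<exists>v\<in>carrier (semidirect K S \<alpha>).
        v \<otimes>\<^bsub>semidirect K S \<alpha>\<^esub> u = \<one>\<^bsub>semidirect K S \<alpha>\<^esub>" by blast
  qed (auto simp: c m o one mult K.m_assoc S.m_assoc)
qed

section \<open>The semidirect product as a model of the relations between the generators\<close>

declare One_nat_def [simp del]

lemma psi_transp_values [simp]:
  "psi_transp 1 1 = 3" "psi_transp 1 2 = 2" "psi_transp 1 3 = 1" "psi_transp 1 4 = 4" "psi_transp 1 5 = 5" "psi_transp 1 6 = 6"
  "psi_transp 2 1 = 5" "psi_transp 2 2 = 2" "psi_transp 2 3 = 3" "psi_transp 2 4 = 4" "psi_transp 2 5 = 1" "psi_transp 2 6 = 6"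
  "psi_transp 3 1 = 1" "psi_transp 3 2 = 3" "psi_transp 3 3 = 2" "psi_transp 3 4 = 4" "psi_transp 3 5 = 5" "psi_transp 3 6 = 6"
  "psi_transp 4 1 = 1" "psi_transp 4 2 = 6" "psi_transp 4 3 = 3" "psi_transp 4 4 = 4" "psi_transp 4 5 = 5" "psi_transp 4 6 = 2"
  "psi_transp 5 1 = 1" "psi_transp 5 2 = 2" "psi_transp 5 3 = 3" "psi_transp 5 4 = 6" "psi_transp 5 5 = 5" "psi_transp 5 6 = 4"
  "psi_transp 6 1 = 1" "psi_transp 6 2 = 2" "psi_transp 6 3 = 3" "psi_transp 6 4 = 5" "psi_transp 6 5 = 4" "psi_transp 6 6 = 6"
  by (simp_all add: psi_transp_def transpose_def)

text \<open>An action of \<open>S\<^sub>6\<close> that relabels the indices by the inverse permutation. It is stated without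
  inverses, on the members with indices in the image of \<open>p\<close>.\<close>

locale xa_action = xa_family_large G idx X A for G (structure) and X A :: "nat \<Rightarrow> nat \<Rightarrow> 'a" +
  fixes \<alpha> :: "(nat \<Rightarrow> nat) \<Rightarrow> 'a \<Rightarrow> 'a"
  assumes \<alpha>_hom: "p \<in> carrier S6 \<Longrightarrow> \<alpha> p \<in> hom G G"
    and \<alpha>_one: "x \<in> carrier G \<Longrightarrow> \<alpha> \<one>\<^bsub>S6\<^esub> x = x"
    and \<alpha>_mult: "\<lbrakk>p \<in> carrier S6; q \<in> carrier S6; x \<in> carrier G\<rbrakk> \<Longrightarrow>
      \<alpha> (p \<otimes>\<^bsub>S6\<^esub> q) x = \<alpha> p (\<alpha> q x)"
    and \<alpha>_X: "\<lbrakk>p \<in> carrier S6; i \<in> idx; j \<in> idx; i \<noteq> j\<rbrakk> \<Longrightarrow> \<alpha> p (X (p i) (p j)) = X i j"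
    and \<alpha>_A: "\<lbrakk>p \<in> carrier S6; i \<in> idx; j \<in> idx; i \<noteq> j\<rbrakk> \<Longrightarrow> \<alpha> p (A (p i) (p j)) = A i j"
begin

abbreviation SD where "SD \<equiv> semidirect G S6 \<alpha>"

lemma group_SD: "group SD"
  using group_semidirect[OF is_group group_S6] \<alpha>_hom \<alpha>_one \<alpha>_mult by blast

lemma \<alpha>_closed: "\<lbrakk>p \<in> carrier S6; x \<in> carrier G\<rbrakk> \<Longrightarrow> \<alpha> p x \<in> carrier G"
  using hom_in_carrier[OF \<alpha>_hom] by blast

lemma \<alpha>_times:
  "\<lbrakk>p \<in> carrier S6; x \<in> carrier G; y \<in> carrier G\<rbrakk> \<Longrightarrow> \<alpha> p (x \<otimes> y) = \<alpha> p x \<otimes> \<alpha> p y"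
  using hom_mult[OF \<alpha>_hom] by blast

lemma \<alpha>_unit: "p \<in> carrier S6 \<Longrightarrow> \<alpha> p \<one> = \<one>"
  using hom_one[OF \<alpha>_hom is_group is_group] by blast

lemma \<alpha>_pow:
  "\<lbrakk>p \<in> carrier S6; x \<in> carrier G\<rbrakk> \<Longrightarrow> \<alpha> p (x [^] (n::int)) = \<alpha> p x [^] n"
  using hom_int_pow[OF \<alpha>_hom, of p x n] is_group by simp

lemma \<alpha>_inv:
  assumes "p \<in> carrier S6" "x \<in> carrier G"
  shows "\<alpha> p (inv x) = inv (\<alpha> p x)"
  using group_hom.hom_inv[of G G "\<alpha> p" x] assms \<alpha>_hom is_group
  by (simp add: group_hom_def group_hom_axioms_def)

lemma S6_idx:
  assumes "p \<in> carrier S6"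
  shows "p i \<in> idx \<longleftrightarrow> i \<in> idx" "p i = p j \<longleftrightarrow> i = j"
proof -
  have p: "p permutes idx" using assms by (simp add: S6_def)
  show "p i \<in> idx \<longleftrightarrow> i \<in> idx" using permutes_in_image[OF p] by blast
  show "p i = p j \<longleftrightarrow> i = j" using permutes_inj[OF p] by (simp add: inj_eq)
qed

lemma \<alpha>_C:
  assumes p: "p \<in> carrier S6" and kj: "k \<in> idx" "j \<in> idx" "k \<noteq> j"
  shows "\<alpha> p (C (p k) (p j)) = C k j"
proof -
  obtain l where l: "l \<in> idx" "l \<noteq> j" "l \<noteq> k" using fresh[of j k k k] by blast
  have "C (p k) (p j) = A (p k) (p l) \<otimes> inv A (p j) (p l)"
    using C_left[of "p k" "p j" "p l"] kj l S6_idx[OF p] by simp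
  moreover have "A (p k) (p l) \<in> carrier G" "A (p j) (p l) \<in> carrier G"
    using kj l S6_idx[OF p] by (auto intro!: A_closed simp del: atLeastAtMost_iff)
  moreover have "C k j = A k l \<otimes> inv A j l" using C_left[of k j l] kj l by simp
  ultimately show ?thesis
    using \<alpha>_A[OF p, of k l] \<alpha>_A[OF p, of j l] kj l p by (simp add: \<alpha>_times \<alpha>_inv)
qed

lemma \<alpha>_Y:
  assumes p: "p \<in> carrier S6" and kj: "k \<in> idx" "j \<in> idx" "k \<noteq> j"
  shows "\<alpha> p (Y n (p k) (p j)) = Y n k j"
proof -
  have "A (p k) (p j) \<in> carrier G" "X (p k) (p j) \<in> carrier G"
    using kj S6_idx[OF p] by (auto intro!: A_closed X_closed simp del: atLeastAtMost_iff)
  then show ?thesis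
    unfolding Y_def using \<alpha>_A[OF p kj] \<alpha>_X[OF p kj] p by (simp add: \<alpha>_times \<alpha>_pow)
qed

lemma \<alpha>_transp:
  assumes "k \<in> idx" "l \<in> idx" "k \<noteq> l"
  shows "\<alpha> (psi_transp j) (A k l) = A (psi_transp j k) (psi_transp j l)"
    "\<alpha> (psi_transp j) (C k l) = C (psi_transp j k) (psi_transp j l)"
    "\<alpha> (psi_transp j) (Y n k l) = Y n (psi_transp j k) (psi_transp j l)"
proof -
  let ?s = "psi_transp j"
  have s: "?s \<in> carrier S6" by (rule psi_transp_closed)
  have ss: "?s (?s i) = i" for i by (simp add: psi_transp_def)
  have kl: "?s k \<in> idx" "?s l \<in> idx" "?s k \<noteq> ?s l" using assms S6_idx[OF s] by simp_all
  show "\<alpha> ?s (A k l) = A (?s k) (?s l)" using \<alpha>_A[OF s kl] unfolding ss .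
  show "\<alpha> ?s (C k l) = C (?s k) (?s l)" using \<alpha>_C[OF s kl] unfolding ss .
  show "\<alpha> ?s (Y n k l) = Y n (?s k) (?s l)" using \<alpha>_Y[OF s kl] unfolding ss .
qed

text \<open>The elements \<open>e j p\<close> of the semidirect product are the intended images of
  \<open>(\<Gamma>\<^sub>j \<Gamma>\<^sub>j\<^sub>')\<^sup>p \<Gamma>\<^sub>j\<close>. In particular \<open>e j 0\<close> and \<open>e j (- 1)\<close> are the images of \<open>\<Gamma>\<^sub>j\<close> and
  \<open>\<Gamma>\<^sub>j\<^sub>'\<close>, and \<open>D j\<close> is that of \<open>\<Gamma>\<^sub>j \<Gamma>\<^sub>j\<^sub>'\<close>. The orientation of the pairs of indices is that of the
  path \<open>3, 2, 6, 4, 5, 1\<close>.\<close>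

definition P :: "nat \<Rightarrow> int \<Rightarrow> 'a" where
  "P j p = (if j = 1 then Y (- p) 3 1 else
    (if j = 2 then C 5 1 else if j = 3 then C 3 2 else if j = 4 then C 2 6
     else if j = 5 then C 6 4 else C 4 5) [^] p)"

definition D :: "nat \<Rightarrow> 'a" where
  "D j = (if j = 1 then A 1 3 else P j 1)"

definition e :: "nat \<Rightarrow> int \<Rightarrow> 'a \<times> (nat \<Rightarrow> nat)" where
  "e j p = (P j p, psi_transp j)"

lemma closeds:
  "i \<in> idx \<Longrightarrow> j \<in> idx \<Longrightarrow> i \<noteq> j \<Longrightarrow> A i j \<in> carrier G \<and> X i j \<in> carrier G \<and> C i j \<in> carrier G \<and>
    Y n i j \<in> carrier G"
  using A_closed X_closed C_closed Y_closed by blast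

lemma P_closed [simp]: "P j p \<in> carrier G"
  by (simp add: P_def closeds)

lemma D_closed [simp]: "D j \<in> carrier G"
  by (simp add: D_def closeds)

lemma e_closed [simp]: "e j p \<in> carrier SD"
  by (simp add: e_def psi_transp_closed)

lemma idx_cases: "j \<in> idx \<Longrightarrow> j = 1 \<or> j = 2 \<or> j = 3 \<or> j = 4 \<or> j = 5 \<or> j = 6"
  by auto

lemma P_0: "j \<noteq> 1 \<Longrightarrow> P j 0 = \<one>"
  by (simp add: P_def)

lemma C_pow_flip: "k \<in> idx \<Longrightarrow> j \<in> idx \<Longrightarrow> k \<noteq> j \<Longrightarrow> C k j [^] (- p::int) = C j k [^] p"
  using C_flip[of k j] closeds[of k j] by (simp add: int_pow_neg int_pow_inv)

lemma \<alpha>_P: "j \<in> idx \<Longrightarrow> \<alpha> (psi_transp j) (P j p) = inv (P j p)"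
proof -
  assume "j \<in> idx"
  then consider "j = 1" | "j = 2" | "j = 3" | "j = 4" | "j = 5" | "j = 6" using idx_cases by blast
  then show ?thesis
  proof cases
    case 1
    then show ?thesis using Y_flip[of 3 1 "- p"] by (simp add: P_def \<alpha>_transp)
  next
    case 2
    then show ?thesis using C_flip[of 5 1] closeds[of 5 1]
      by (simp add: P_def \<alpha>_pow \<alpha>_transp psi_transp_closed int_pow_inv)
  next
    case 3
    then show ?thesis using C_flip[of 3 2] closeds[of 3 2]
      by (simp add: P_def \<alpha>_pow \<alpha>_transp psi_transp_closed int_pow_inv)
  next
    case 4
    then show ?thesis using C_flip[of 2 6] closeds[of 2 6]
      by (simp add: P_def \<alpha>_pow \<alpha>_transp psi_transp_closed int_pow_inv)
  next
    case 5
    then show ?thesis using C_flip[of 6 4] closeds[of 6 4]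
      by (simp add: P_def \<alpha>_pow \<alpha>_transp psi_transp_closed int_pow_inv)
  next
    case 6
    then show ?thesis using C_flip[of 4 5] closeds[of 4 5]
      by (simp add: P_def \<alpha>_pow \<alpha>_transp psi_transp_closed int_pow_inv)
  qed
qed

lemma e_square: "j \<in> idx \<Longrightarrow> e j p \<otimes>\<^bsub>SD\<^esub> e j p = \<one>\<^bsub>SD\<^esub>"
  by (simp add: e_def \<alpha>_P del: atLeastAtMost_iff)

lemma P_pow: "j \<in> idx \<Longrightarrow> D j [^] (p::int) \<otimes> P j 0 = P j p"
proof (cases "j = 1")
  case True
  have "A 1 3 [^] p \<otimes> inv (X 1 3) = inv (X 1 3 \<otimes> A 1 3 [^] (- p))"
    using closeds[of 1 3] by (simp add: inv_mult_group int_pow_neg)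
  then show ?thesis
    using True Y_flip[of 1 3 0] Y_flip[of 1 3 "- p"] closeds[of 1 3] by (simp add: P_def D_def Y_def)
next
  case False
  then show ?thesis by (simp add: P_def D_def closeds)
qed

lemma e_pair: "j \<in> idx \<Longrightarrow> e j 0 \<otimes>\<^bsub>SD\<^esub> e j (- 1) = (D j, \<one>\<^bsub>S6\<^esub>)"
proof (cases "j = 1")
  case True
  have "P 1 0 \<otimes> inv (P 1 (- 1)) = D 1"
    using Y_flip[of 1 3 0] Y_flip[of 1 3 1] closeds[of 1 3]
    by (simp add: P_def D_def Y_step[of 1 3 0, simplified] m_assoc inv_cancel_left)
  then show ?thesis using True by (simp add: e_def \<alpha>_P)
next
  case False
  assume "j \<in> idx"
  moreover have "inv (P j (- 1)) = D j"
    using False closeds by (simp add: P_def D_def int_pow_neg)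
  ultimately show ?thesis using False by (simp add: e_def \<alpha>_P P_0 del: atLeastAtMost_iff)
qed

lemma SD_pow: "x \<in> carrier G \<Longrightarrow> (x, \<one>\<^bsub>S6\<^esub>) [^]\<^bsub>SD\<^esub> (p::int) = (x [^] p, \<one>\<^bsub>S6\<^esub>)"
proof -
  assume x: "x \<in> carrier G"
  interpret S: group S6 by (rule group_S6)
  have "(\<lambda>y. (y, \<one>\<^bsub>S6\<^esub>)) \<in> hom G SD" by (auto simp: hom_def \<alpha>_one)
  then show ?thesis using hom_int_pow[of _ G SD x p] x group_SD is_group by fastforce
qed

lemma e_pow: "j \<in> idx \<Longrightarrow> (D j, \<one>\<^bsub>S6\<^esub>) [^]\<^bsub>SD\<^esub> (p::int) \<otimes>\<^bsub>SD\<^esub> e j 0 = e j p"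
proof -
  assume j: "j \<in> idx"
  interpret S: group S6 by (rule group_S6)
  show ?thesis using P_pow[OF j, of p] by (simp add: SD_pow e_def \<alpha>_one psi_transp_closed)
qed

text \<open>The indices form a consistently oriented pair of adjacent edges. Both sides have the first
  component \<open>(C k j C j l)\<^sup>p\<^sup>+\<^sup>q\<close>, because \<open>C k l = C k j C j l\<close> and these commute.\<close>

lemma C_braid:
  assumes kjl: "k \<in> idx" "j \<in> idx" "l \<in> idx" "distinct [k, j, l]"
    and a: "psi_transp a k = j" "psi_transp a j = k" "psi_transp a l = l"
    and b: "psi_transp b j = l" "psi_transp b l = j" "psi_transp b k = k"
    and ab: "{a, b} \<in> pi_edges"
  shows "(C k j [^] (p::int), psi_transp a) \<otimes>\<^bsub>SD\<^esub> (C j l [^] (q::int), psi_transp b)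
        \<otimes>\<^bsub>SD\<^esub> (C k j [^] p, psi_transp a) =
      (C j l [^] q, psi_transp b) \<otimes>\<^bsub>SD\<^esub> (C k j [^] p, psi_transp a)
        \<otimes>\<^bsub>SD\<^esub> (C j l [^] q, psi_transp b)"
proof -
  interpret S: group S6 by (rule group_S6)
  note t [simp] = psi_transp_closed
  have ne: "k \<noteq> j" "j \<noteq> k" "k \<noteq> l" "l \<noteq> k" "j \<noteq> l" "l \<noteq> j" using kjl by auto
  have c [simp]: "C k j \<in> carrier G" "C j l \<in> carrier G" "C k l \<in> carrier G"
    using kjl ne closeds by blast+
  have act: "\<alpha> (psi_transp a) (C j l) = C k l" "\<alpha> (psi_transp b) (C k j) = C k l"
    "\<alpha> (psi_transp a) (C k l) = C j l" "\<alpha> (psi_transp b) (C k l) = C k j"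
    using \<alpha>_transp(2)[OF kjl(2,3) ne(5), of a] \<alpha>_transp(2)[OF kjl(1,2) ne(1), of b]
      \<alpha>_transp(2)[OF kjl(1,3) ne(3), of a] \<alpha>_transp(2)[OF kjl(1,3) ne(3), of b] a b by simp_all
  have comm: "C k j \<otimes> C j l = C j l \<otimes> C k j" using C_commute_chain[OF kjl] .
  have pow: "C k l [^] m = C k j [^] m \<otimes> C j l [^] m" for m :: int
    using int_pow_mult_distrib[OF comm, of m] C_chain(1)[OF kjl] by simp
  have pc: "C j l [^] m \<otimes> C k j [^] n = C k j [^] n \<otimes> C j l [^] m" for m n :: int
    by (intro commute_int_pow commute_int_pow[symmetric]) (simp_all add: comm)
  have pc': "C j l [^] m \<otimes> (C k j [^] n \<otimes> z) = C k j [^] n \<otimes> (C j l [^] m \<otimes> z)"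
    if "z \<in> carrier G" for m n :: int and z
    using pc[of m n] that by (simp add: m_assoc[symmetric])
  have add: "C k j [^] m \<otimes> (C k j [^] n \<otimes> z) = C k j [^] (m + n) \<otimes> z"
    "C j l [^] m \<otimes> C j l [^] n = C j l [^] (m + n)"
    if "z \<in> carrier G" for m n :: int and z
    using that by (simp_all add: int_pow_mult m_assoc)
  have "C k j [^] p \<otimes> C k l [^] q \<otimes> C j l [^] p = C j l [^] q \<otimes> C k l [^] p \<otimes> C k j [^] q"
    unfolding pow by (simp add: m_assoc pc pc' add add.commute)
  then show ?thesis
    using psi_transp_braid[OF ab]
    by (simp add: \<alpha>_mult \<alpha>_pow act S.m_assoc)
qed

text \<open>For \<open>q = 0\<close> this is a chain relation for the elements \<open>Y\<close>; the general case follows from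
  \<open>braid_shift\<close>, since \<open>e i q\<close> is a conjugate of \<open>e i 0\<close> by a power of \<open>A 1 3\<close>.\<close>

lemma e_braid_1:
  assumes i: "i \<in> {2, 3}"
  shows "e 1 p \<otimes>\<^bsub>SD\<^esub> e i q \<otimes>\<^bsub>SD\<^esub> e 1 p = e i q \<otimes>\<^bsub>SD\<^esub> e 1 p \<otimes>\<^bsub>SD\<^esub> e i q"
proof -
  interpret S: group S6 by (rule group_S6)
  interpret SD: group SD by (rule group_SD)
  note t [simp] = psi_transp_closed
  let ?b = "(D 1, \<one>\<^bsub>S6\<^esub>)"
  have b: "?b \<in> carrier SD" by simp
  have D1: "D 1 = A 1 3" by (simp add: D_def)
  have cl: "A 1 3 \<in> carrier G" "A 1 2 \<in> carrier G" "A 5 3 \<in> carrier G" "X 3 1 \<in> carrier G"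
    "A 3 1 \<in> carrier G"
    using closeds by simp_all
  have flip: "e 1 0 \<otimes>\<^bsub>SD\<^esub> ?b [^]\<^bsub>SD\<^esub> n = ?b [^]\<^bsub>SD\<^esub> (- n) \<otimes>\<^bsub>SD\<^esub> e 1 0" for n :: int
  proof -
    have "e 1 0 \<otimes>\<^bsub>SD\<^esub> ?b [^]\<^bsub>SD\<^esub> n = e 1 (- n)"
      unfolding SD_pow[OF D_closed] using cl
      by (simp add: e_def P_def D_def Y_def \<alpha>_pow \<alpha>_transp)
    then show ?thesis using e_pow[of 1 "- n"] by simp
  qed
  have base: "e 1 m \<otimes>\<^bsub>SD\<^esub> e i 0 \<otimes>\<^bsub>SD\<^esub> e 1 m = e i 0 \<otimes>\<^bsub>SD\<^esub> e 1 m \<otimes>\<^bsub>SD\<^esub> e i 0" for m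
  proof -
    have "\<alpha> (psi_transp 1) \<one> = \<one>" "\<alpha> (psi_transp i) \<one> = \<one>" by (simp_all add: \<alpha>_unit)
    moreover have "Y (- m) 3 1 \<otimes> Y (- m) 2 3 = Y (- m) 2 1" "Y (- m) 3 1 \<otimes> Y (- m) 1 5 = Y (- m) 3 5"
      using Y_chain(2)[of 2 3 1] Y_chain(1)[of 3 1 5] by simp_all
    moreover have "psi_transp 1 \<otimes>\<^bsub>S6\<^esub> (psi_transp i \<otimes>\<^bsub>S6\<^esub> psi_transp 1) =
        psi_transp i \<otimes>\<^bsub>S6\<^esub> (psi_transp 1 \<otimes>\<^bsub>S6\<^esub> psi_transp i)"
      using i psi_transp_braid[of 1 i] by auto
    ultimately show ?thesis
      using i closeds by (auto simp: e_def P_def \<alpha>_mult \<alpha>_transp S.m_assoc \<alpha>_unit)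
  qed
  have "P i q = A 1 3 [^] (- q) \<otimes> \<alpha> (psi_transp i) (A 1 3 [^] q)"
  proof (cases "i = 3")
    case True
    have "A 1 2 \<otimes> inv A 1 3 = inv A 1 3 \<otimes> A 1 2"
      using A_commute_source[of 1 2 3] cl by (intro commute_inv) simp_all
    then have "C 3 2 [^] q = A 1 2 [^] q \<otimes> inv A 1 3 [^] q"
      using int_pow_mult_distrib[of "A 1 2" "inv A 1 3" q] C_right[of 3 2 1] cl by simp
    moreover have "A 1 2 [^] q \<otimes> inv A 1 3 [^] q = inv A 1 3 [^] q \<otimes> A 1 2 [^] q"
      using \<open>A 1 2 \<otimes> inv A 1 3 = inv A 1 3 \<otimes> A 1 2\<close> cl
      by (intro commute_int_pow commute_int_pow[symmetric]) simp_all
    ultimately show ?thesis using True cl by (simp add: P_def \<alpha>_pow \<alpha>_transp int_pow_neg int_pow_inv)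
  next
    case False
    then have i2: "i = 2" using i by simp
    have "A 5 3 \<otimes> inv A 1 3 = inv A 1 3 \<otimes> A 5 3"
      using A_commute_target[of 5 1 3] cl by (intro commute_inv) simp_all
    then have "C 5 1 [^] q = A 5 3 [^] q \<otimes> inv A 1 3 [^] q"
      using int_pow_mult_distrib[of "A 5 3" "inv A 1 3" q] C_left[of 5 1 3] cl by simp
    moreover have "A 5 3 [^] q \<otimes> inv A 1 3 [^] q = inv A 1 3 [^] q \<otimes> A 5 3 [^] q"
      using \<open>A 5 3 \<otimes> inv A 1 3 = inv A 1 3 \<otimes> A 5 3\<close> cl
      by (intro commute_int_pow commute_int_pow[symmetric]) simp_all
    ultimately show ?thesis using i2 cl by (simp add: P_def \<alpha>_pow \<alpha>_transp int_pow_neg int_pow_inv)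
  qed
  then have v: "e i q = ?b [^]\<^bsub>SD\<^esub> (- q) \<otimes>\<^bsub>SD\<^esub> e i 0 \<otimes>\<^bsub>SD\<^esub> ?b [^]\<^bsub>SD\<^esub> q"
    unfolding SD_pow[OF D_closed] using i cl by (auto simp: e_def P_0 D1 \<alpha>_one)
  show ?thesis
  proof (rule SD.braid_shift[OF _ b _ flip _ _ v])
    show "?b [^]\<^bsub>SD\<^esub> m \<otimes>\<^bsub>SD\<^esub> e 1 0 \<otimes>\<^bsub>SD\<^esub> e i 0 \<otimes>\<^bsub>SD\<^esub> (?b [^]\<^bsub>SD\<^esub> m \<otimes>\<^bsub>SD\<^esub> e 1 0) =
        e i 0 \<otimes>\<^bsub>SD\<^esub> (?b [^]\<^bsub>SD\<^esub> m \<otimes>\<^bsub>SD\<^esub> e 1 0) \<otimes>\<^bsub>SD\<^esub> e i 0" for m :: int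
      using base[of m] e_pow[of 1 m] by simp
    show "e 1 p = ?b [^]\<^bsub>SD\<^esub> p \<otimes>\<^bsub>SD\<^esub> e 1 0" using e_pow[of 1 p] by simp
  qed (rule e_closed)+
qed

lemma e_braid:
  assumes "{i, j} \<in> pi_edges"
  shows "e i p \<otimes>\<^bsub>SD\<^esub> e j q \<otimes>\<^bsub>SD\<^esub> e i p = e j q \<otimes>\<^bsub>SD\<^esub> e i p \<otimes>\<^bsub>SD\<^esub> e j q"
proof -
  let ?E = "{(1, 3), (1, 2), (3, 4), (4, 5), (5, 6), (6, 2)} :: (nat \<times> nat) set"
  have *: "e i p \<otimes>\<^bsub>SD\<^esub> e j q \<otimes>\<^bsub>SD\<^esub> e i p = e j q \<otimes>\<^bsub>SD\<^esub> e i p \<otimes>\<^bsub>SD\<^esub> e j q"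
    if "(i, j) \<in> ?E" for i j p q
    using that e_braid_1[of 3 p q] e_braid_1[of 2 p q] C_braid[of 3 2 6 3 4 p q]
      C_braid[of 2 6 4 4 5 p q] C_braid[of 6 4 5 5 6 p q] C_braid[of 4 5 1 6 2 p q]
    by (elim insertE emptyE) (simp_all add: e_def P_def insert_commute[of 6 2])
  have "(i, j) \<in> ?E \<or> (j, i) \<in> ?E"
    using assms unfolding pi_edges_def insert_iff doubleton_eq_iff
    by (elim disjE conjE; simp)
  then show ?thesis using *[of i j p q] *[of j i q p] by metis
qed

lemma e_far:
  assumes ij: "i \<in> idx" "j \<in> idx" "i \<noteq> j" "{i, j} \<notin> pi_edges"
  shows "e i p \<otimes>\<^bsub>SD\<^esub> e j q = e j q \<otimes>\<^bsub>SD\<^esub> e i p"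
proof -
  let ?N = "{(1, 4), (1, 5), (1, 6), (2, 3), (2, 4), (2, 5), (3, 5), (3, 6), (4, 6)} :: (nat \<times> nat) set"
  have *: "P i p \<otimes> \<alpha> (psi_transp i) (P j q) = P j q \<otimes> \<alpha> (psi_transp j) (P i p)"
    if "(i, j) \<in> ?N" for i j p q
  proof -
    have YC: "Y n 3 1 \<otimes> C k l [^] m = C k l [^] m \<otimes> Y n 3 1"
      if "k \<in> idx" "l \<in> idx" "distinct [k, l, 3, 1]" for k l n and m :: int
      using that closeds[of k l] closeds[of 3 1] Y_commute_C[of l 1 3 k n]
      by (intro commute_int_pow) auto
    have CC: "C a b [^] n \<otimes> C k l [^] m = C k l [^] m \<otimes> C a b [^] n"
      if "a \<in> idx" "b \<in> idx" "k \<in> idx" "l \<in> idx" "distinct [a, b, k, l]" for a b k l and n m :: int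
      using that closeds[of k l] closeds[of a b] C_commute_disjoint[of a b k l]
      by (intro commute_int_pow commute_int_pow[symmetric]) auto
    show ?thesis
      using that closeds
      by (elim insertE emptyE) (simp_all add: P_def \<alpha>_pow \<alpha>_transp psi_transp_closed YC CC)
  qed
  have "i \<in> {1,2,3,4,5,6}" "j \<in> {1,2,3,4,5,6}" using ij(1,2) by auto
  then have "(i, j) \<in> ?N \<or> (j, i) \<in> ?N"
    using ij(3,4) unfolding pi_edges_def by (elim insertE emptyE; simp add: insert_commute)
  then have "P i p \<otimes> \<alpha> (psi_transp i) (P j q) = P j q \<otimes> \<alpha> (psi_transp j) (P i p)"
    using *[of i j p q] *[of j i q p] by metis
  then show ?thesis using psi_transp_commute[OF ij] by (simp add: e_def)
qed

lemma e_pair_back: "j \<in> idx \<Longrightarrow> e j (- 1) \<otimes>\<^bsub>SD\<^esub> e j 0 = (inv D j, \<one>\<^bsub>S6\<^esub>)"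
proof -
  assume j: "j \<in> idx"
  interpret S: group S6 by (rule group_S6)
  interpret SD: group SD by (rule group_SD)
  have "(inv D j, \<one>\<^bsub>S6\<^esub>) = inv\<^bsub>SD\<^esub> (e j 0 \<otimes>\<^bsub>SD\<^esub> e j (- 1))"
    unfolding e_pair[OF j] by (rule SD.inv_equality[symmetric]) (simp_all add: \<alpha>_one)
  then show ?thesis
    using SD.inv_mult_group[OF e_closed e_closed, of j 0 j "- 1"]
      SD.involution_inv[OF e_closed e_square[OF j]] by simp
qed

lemma e_twist:
  assumes j: "j \<in> idx" and x: "x \<in> carrier G"
  shows "e j 0 \<otimes>\<^bsub>SD\<^esub> e j (- 1) \<otimes>\<^bsub>SD\<^esub> (x, psi_transp i) \<otimes>\<^bsub>SD\<^esub> e j (- 1) \<otimes>\<^bsub>SD\<^esub> e j 0 =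
      (D j \<otimes> x \<otimes> \<alpha> (psi_transp i) (inv D j), psi_transp i)"
    "e j (- 1) \<otimes>\<^bsub>SD\<^esub> e j 0 \<otimes>\<^bsub>SD\<^esub> (x, psi_transp i) \<otimes>\<^bsub>SD\<^esub> e j 0 \<otimes>\<^bsub>SD\<^esub> e j (- 1) =
      (inv D j \<otimes> x \<otimes> \<alpha> (psi_transp i) (D j), psi_transp i)"
proof -
  interpret S: group S6 by (rule group_S6)
  interpret SD: group SD by (rule group_SD)
  have c: "(x, psi_transp i) \<in> carrier SD" using x by (simp add: psi_transp_closed)
  have "e j 0 \<otimes>\<^bsub>SD\<^esub> e j (- 1) \<otimes>\<^bsub>SD\<^esub> (x, psi_transp i) \<otimes>\<^bsub>SD\<^esub> e j (- 1) \<otimes>\<^bsub>SD\<^esub> e j 0 =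
      (e j 0 \<otimes>\<^bsub>SD\<^esub> e j (- 1)) \<otimes>\<^bsub>SD\<^esub> (x, psi_transp i) \<otimes>\<^bsub>SD\<^esub> (e j (- 1) \<otimes>\<^bsub>SD\<^esub> e j 0)"
    using c by (simp only: SD.m_assoc SD.m_closed e_closed)
  then show "e j 0 \<otimes>\<^bsub>SD\<^esub> e j (- 1) \<otimes>\<^bsub>SD\<^esub> (x, psi_transp i) \<otimes>\<^bsub>SD\<^esub> e j (- 1) \<otimes>\<^bsub>SD\<^esub> e j 0 =
      (D j \<otimes> x \<otimes> \<alpha> (psi_transp i) (inv D j), psi_transp i)"
    unfolding e_pair[OF j] e_pair_back[OF j] using x by (simp add: \<alpha>_one psi_transp_closed)
  have "e j (- 1) \<otimes>\<^bsub>SD\<^esub> e j 0 \<otimes>\<^bsub>SD\<^esub> (x, psi_transp i) \<otimes>\<^bsub>SD\<^esub> e j 0 \<otimes>\<^bsub>SD\<^esub> e j (- 1) =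
      (e j (- 1) \<otimes>\<^bsub>SD\<^esub> e j 0) \<otimes>\<^bsub>SD\<^esub> (x, psi_transp i) \<otimes>\<^bsub>SD\<^esub> (e j 0 \<otimes>\<^bsub>SD\<^esub> e j (- 1))"
    using c by (simp only: SD.m_assoc SD.m_closed e_closed)
  then show "e j (- 1) \<otimes>\<^bsub>SD\<^esub> e j 0 \<otimes>\<^bsub>SD\<^esub> (x, psi_transp i) \<otimes>\<^bsub>SD\<^esub> e j 0 \<otimes>\<^bsub>SD\<^esub> e j (- 1) =
      (inv D j \<otimes> x \<otimes> \<alpha> (psi_transp i) (D j), psi_transp i)"
    unfolding e_pair[OF j] e_pair_back[OF j] using x by (simp add: \<alpha>_one psi_transp_closed)
qed

lemma DP_values:
  "D 1 = A 1 3" "D 2 = C 5 1" "D 3 = C 3 2" "D 4 = C 2 6" "D 5 = C 6 4" "D 6 = C 4 5"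
  "P 2 (- 1) = C 1 5" "P 3 (- 1) = C 2 3" "P 4 (- 1) = C 6 2" "P 5 (- 1) = C 4 6" "P 6 (- 1) = C 5 4"
  using closeds by (simp_all add: D_def P_def C_pow_flip)

text \<open>The twisting relations reduce, by \<open>e_twist\<close>, to identities between two or three of the elements
  \<open>A\<close> and \<open>C\<close>.\<close>

theorem pi_family_SD: "pi_family SD (\<lambda>j. e j 0) (\<lambda>j. e j (- 1))"
proof -
  interpret S: group S6 by (rule group_S6)
  interpret SD: group SD by (rule group_SD)
  have inv_C: "inv C k j = C j k" if "k \<in> idx" "j \<in> idx" "k \<noteq> j" for k j
    using C_flip[OF that] by simp
  have C_cancel: "C k j \<otimes> C j k = \<one>" if "k \<in> idx" "j \<in> idx" "k \<noteq> j" for k j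
    using C_flip[OF that] closeds[OF that] by simp
  show ?thesis
  proof unfold_locales
    fix j :: nat assume j: "j \<in> idx"
    show "e j 0 \<in> carrier SD" "e j (- 1) \<in> carrier SD" by (rule e_closed)+
    show "e j 0 \<otimes>\<^bsub>SD\<^esub> e j 0 = \<one>\<^bsub>SD\<^esub>" "e j (- 1) \<otimes>\<^bsub>SD\<^esub> e j (- 1) = \<one>\<^bsub>SD\<^esub>"
      using e_square[OF j] by blast+
  next
    show "e 3 (- 1) = e 1 0 \<otimes>\<^bsub>SD\<^esub> e 1 (- 1) \<otimes>\<^bsub>SD\<^esub> e 3 0 \<otimes>\<^bsub>SD\<^esub> e 1 (- 1) \<otimes>\<^bsub>SD\<^esub> e 1 0"
      using e_twist(1)[of 1 "P 3 0" 3] closeds C_right[of 2 3 1]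
      by (simp add: e_def[of 3] DP_values P_0 \<alpha>_inv \<alpha>_transp psi_transp_closed)
    show "e 2 (- 1) = e 1 0 \<otimes>\<^bsub>SD\<^esub> e 1 (- 1) \<otimes>\<^bsub>SD\<^esub> e 2 0 \<otimes>\<^bsub>SD\<^esub> e 1 (- 1) \<otimes>\<^bsub>SD\<^esub> e 1 0"
      using e_twist(1)[of 1 "P 2 0" 2] closeds C_left[of 1 5 3]
      by (simp add: e_def[of 2] DP_values P_0 \<alpha>_inv \<alpha>_transp psi_transp_closed)
    show "e 5 (- 1) = e 4 0 \<otimes>\<^bsub>SD\<^esub> e 4 (- 1) \<otimes>\<^bsub>SD\<^esub> e 5 0 \<otimes>\<^bsub>SD\<^esub> e 4 (- 1) \<otimes>\<^bsub>SD\<^esub> e 4 0"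
      using e_twist(1)[of 4 "P 5 0" 5] closeds C_chain(2)[of 4 2 6]
      by (simp add: e_def[of 5] DP_values P_0 inv_C \<alpha>_transp psi_transp_closed)
    \<comment> \<open>the first component is \<open>C 5 4 \<otimes> C 1 5 \<otimes> C 4 1\<close>, a closed chain\<close>
    show "e 2 0 = e 6 (- 1) \<otimes>\<^bsub>SD\<^esub> e 6 0 \<otimes>\<^bsub>SD\<^esub> e 2 (- 1) \<otimes>\<^bsub>SD\<^esub> e 6 0 \<otimes>\<^bsub>SD\<^esub> e 6 (- 1)"
      using e_twist(2)[of 6 "P 2 (- 1)" 2] closeds C_chain(2)[of 1 5 4] C_cancel[of 1 4]
      by (simp add: e_def[of 2] DP_values P_0 inv_C \<alpha>_transp psi_transp_closed)
    show "e 3 0 = e 4 (- 1) \<otimes>\<^bsub>SD\<^esub> e 4 0 \<otimes>\<^bsub>SD\<^esub> e 3 (- 1) \<otimes>\<^bsub>SD\<^esub> e 4 0 \<otimes>\<^bsub>SD\<^esub> e 4 (- 1)"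
      using e_twist(2)[of 4 "P 3 (- 1)" 3] closeds C_chain(1)[of 6 2 3] C_cancel[of 6 3]
      by (simp add: e_def[of 3] DP_values P_0 inv_C \<alpha>_transp psi_transp_closed)
    show "e 5 0 = e 6 (- 1) \<otimes>\<^bsub>SD\<^esub> e 6 0 \<otimes>\<^bsub>SD\<^esub> e 5 (- 1) \<otimes>\<^bsub>SD\<^esub> e 6 0 \<otimes>\<^bsub>SD\<^esub> e 6 (- 1)"
      using e_twist(2)[of 6 "P 5 (- 1)" 5] closeds C_chain(1)[of 5 4 6] C_cancel[of 5 6]
      by (simp add: e_def[of 5] DP_values P_0 inv_C \<alpha>_transp psi_transp_closed)
  next
    fix i j :: nat and a b and p q :: int
    assume ij: "i \<in> idx" "j \<in> idx" "{i, j} \<in> pi_edges"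
      and ab: "a = (e i 0 \<otimes>\<^bsub>SD\<^esub> e i (- 1)) [^]\<^bsub>SD\<^esub> p \<otimes>\<^bsub>SD\<^esub> e i 0"
        "b = (e j 0 \<otimes>\<^bsub>SD\<^esub> e j (- 1)) [^]\<^bsub>SD\<^esub> q \<otimes>\<^bsub>SD\<^esub> e j 0"
    have "a = e i p" "b = e j q" using ab e_pair ij(1,2) e_pow by simp_all
    then show "a \<otimes>\<^bsub>SD\<^esub> b \<otimes>\<^bsub>SD\<^esub> a = b \<otimes>\<^bsub>SD\<^esub> a \<otimes>\<^bsub>SD\<^esub> b" using e_braid[OF ij(3)] by simp
  next
    fix i j :: nat and a b
    assume "i \<in> idx" "j \<in> idx" "i \<noteq> j" "{i, j} \<notin> pi_edges"
      "a \<in> {e i 0, e i (- 1)}" "b \<in> {e j 0, e j (- 1)}"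
    then show "a \<otimes>\<^bsub>SD\<^esub> b = b \<otimes>\<^bsub>SD\<^esub> a" using e_far by blast
  qed
qed

end

section \<open>The action of the symmetric group on the presented group\<close>

abbreviation K :: "xa_gen word set monoid" where "K \<equiv> pres_group xa_gens xa_rels"

abbreviation KX :: "nat \<Rightarrow> nat \<Rightarrow> xa_gen word set" where
  "KX i j \<equiv> pres_class xa_gens xa_rels (letter (Xg i j))"

abbreviation KA :: "nat \<Rightarrow> nat \<Rightarrow> xa_gen word set" where
  "KA i j \<equiv> pres_class xa_gens xa_rels (letter (Ag i j))"

lemma K_closed:
  "\<lbrakk>i \<in> idx; j \<in> idx; i \<noteq> j\<rbrakk> \<Longrightarrow> KX i j \<in> carrier K"
  "\<lbrakk>i \<in> idx; j \<in> idx; i \<noteq> j\<rbrakk> \<Longrightarrow> KA i j \<in> carrier K"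
  by (simp_all add: pres_group_letter_closed)

lemma xa_family_K: "xa_family K idx KX KA"
proof (rule xa_family_of_rels[OF group_pres_group K_closed])
  fix l r assume "(l, r) \<in> xa_rels" "l \<in> words xa_gens" "r \<in> words xa_gens"
  moreover have "xa_val KX KA = (\<lambda>g. pres_class xa_gens xa_rels (letter g))"
    by (rule ext) (simp split: xa_gen.split)
  ultimately show "word_eval K (xa_val KX KA) l = word_eval K (xa_val KX KA) r"
    using word_eval_pres_group_rel by metis
qed

lemma xa_family_relabel:
  assumes "xa_family G I X A" and q: "q permutes I"
  shows "xa_family G I (\<lambda>i j. X (q i) (q j)) (\<lambda>i j. A (q i) (q j))"
proof -
  interpret xa_family G I X A by fact
  have q1: "q i \<in> I \<longleftrightarrow> i \<in> I" "q i = q j \<longleftrightarrow> i = j" for i j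
    using permutes_in_image[OF q] permutes_inj[OF q] by (auto simp: inj_eq)
  show ?thesis
  proof unfold_locales
    fix i j and n :: int assume "i \<in> I" "j \<in> I" "i \<noteq> j"
    then show "X (q i) (q j) \<in> carrier G" "A (q i) (q j) \<in> carrier G"
      "X (q j) (q i) \<otimes>\<^bsub>G\<^esub> A (q j) (q i) [^]\<^bsub>G\<^esub> n = inv\<^bsub>G\<^esub> (X (q i) (q j) \<otimes>\<^bsub>G\<^esub> A (q i) (q j) [^]\<^bsub>G\<^esub> n)"
      by (intro X_closed A_closed flip; simp add: q1)+
  next
    fix i j k and n :: int assume "i \<in> I" "j \<in> I" "k \<in> I" "distinct [i, j, k]"
    then show "X (q i) (q j) \<otimes>\<^bsub>G\<^esub> A (q i) (q j) [^]\<^bsub>G\<^esub> n \<otimes>\<^bsub>G\<^esub> (X (q j) (q k) \<otimes>\<^bsub>G\<^esub> A (q j) (q k) [^]\<^bsub>G\<^esub> n)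
        \<otimes>\<^bsub>G\<^esub> (X (q k) (q i) \<otimes>\<^bsub>G\<^esub> A (q k) (q i) [^]\<^bsub>G\<^esub> n) = \<one>\<^bsub>G\<^esub>"
      "X (q j) (q k) \<otimes>\<^bsub>G\<^esub> A (q j) (q k) [^]\<^bsub>G\<^esub> n \<otimes>\<^bsub>G\<^esub> (X (q i) (q j) \<otimes>\<^bsub>G\<^esub> A (q i) (q j) [^]\<^bsub>G\<^esub> n)
        \<otimes>\<^bsub>G\<^esub> (X (q k) (q i) \<otimes>\<^bsub>G\<^esub> A (q k) (q i) [^]\<^bsub>G\<^esub> n) = \<one>\<^bsub>G\<^esub>"
      using triangle[of "q i" "q j" "q k" n] triangle'[of "q i" "q j" "q k" n] by (simp_all add: q1)
  next
    fix i j k l assume "i \<in> I" "j \<in> I" "k \<in> I" "l \<in> I" "distinct [i, j, k, l]"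
    then show "A (q i) (q j) \<otimes>\<^bsub>G\<^esub> inv\<^bsub>G\<^esub> A (q i) (q k) = A (q k) (q l) \<otimes>\<^bsub>G\<^esub> inv\<^bsub>G\<^esub> A (q j) (q l)"
      using quad[of "q i" "q j" "q k" "q l"] by (simp add: q1)
  qed
qed

definition K_relabel :: "(nat \<Rightarrow> nat) \<Rightarrow> xa_gen word set \<Rightarrow> xa_gen word set" where
  "K_relabel q = pres_lift K (xa_val (\<lambda>i j. KX (q i) (q j)) (\<lambda>i j. KA (q i) (q j)))"

lemma pres_lift_xa:
  assumes F: "xa_family H idx X A"
  shows "pres_lift H (xa_val X A) \<in> hom K H"
    "\<lbrakk>i \<in> idx; j \<in> idx; i \<noteq> j\<rbrakk> \<Longrightarrow> pres_lift H (xa_val X A) (KX i j) = X i j"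
    "\<lbrakk>i \<in> idx; j \<in> idx; i \<noteq> j\<rbrakk> \<Longrightarrow> pres_lift H (xa_val X A) (KA i j) = A i j"
proof -
  interpret F: xa_family H idx X A by fact
  have c: "\<And>x. x \<in> xa_gens \<Longrightarrow> xa_val X A x \<in> carrier H"
    using xa_val_closed[of H X A] F.is_group F.X_closed F.A_closed by blast
  have R: "\<And>l r. (l, r) \<in> xa_rels \<Longrightarrow> word_eval H (xa_val X A) l = word_eval H (xa_val X A) r"
    using xa_family_rels[of H X A] F.is_group F.X_closed F.A_closed F by blast
  show "pres_lift H (xa_val X A) \<in> hom K H"
    by (rule pres_lift_hom) (use F.is_group c R in auto)
  have l: "pres_lift H (xa_val X A) (pres_class xa_gens xa_rels (letter x)) = xa_val X A x"
    if "x \<in> xa_gens" for x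
    using pres_lift_class[of H xa_gens "xa_val X A" xa_rels "letter x"] F.is_group c R that
    by (simp add: letter_words word_eval_letter)
  show "\<lbrakk>i \<in> idx; j \<in> idx; i \<noteq> j\<rbrakk> \<Longrightarrow> pres_lift H (xa_val X A) (KX i j) = X i j"
    "\<lbrakk>i \<in> idx; j \<in> idx; i \<noteq> j\<rbrakk> \<Longrightarrow> pres_lift H (xa_val X A) (KA i j) = A i j"
    using l[of "Xg i j"] l[of "Ag i j"] by simp_all
qed

lemma K_hom_eqI:
  assumes H: "group H" and h: "h \<in> hom K H" "h' \<in> hom K H"
    and X: "\<And>i j. \<lbrakk>i \<in> idx; j \<in> idx; i \<noteq> j\<rbrakk> \<Longrightarrow> h (KX i j) = h' (KX i j)"
    and A: "\<And>i j. \<lbrakk>i \<in> idx; j \<in> idx; i \<noteq> j\<rbrakk> \<Longrightarrow> h (KA i j) = h' (KA i j)"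
    and x: "x \<in> carrier K"
  shows "h x = h' x"
proof (rule pres_group_hom_eqI[OF H h _ x])
  fix g assume "g \<in> xa_gens"
  then show "h (pres_class xa_gens xa_rels (letter g)) = h' (pres_class xa_gens xa_rels (letter g))"
    by (cases rule: xa_gens_cases) (simp_all add: X A del: atLeastAtMost_iff)
qed

lemma K_relabel_hom:
  assumes "q permutes idx"
  shows "K_relabel q \<in> hom K K"
    "\<lbrakk>i \<in> idx; j \<in> idx; i \<noteq> j\<rbrakk> \<Longrightarrow> K_relabel q (KX i j) = KX (q i) (q j)"
    "\<lbrakk>i \<in> idx; j \<in> idx; i \<noteq> j\<rbrakk> \<Longrightarrow> K_relabel q (KA i j) = KA (q i) (q j)"
  unfolding K_relabel_def
  using pres_lift_xa[OF xa_family_relabel[OF xa_family_K assms]] by blast+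

text \<open>A permutation has to act through its inverse, to turn the left-to-right product of
  permutations into a left action.\<close>

definition K_act :: "(nat \<Rightarrow> nat) \<Rightarrow> xa_gen word set \<Rightarrow> xa_gen word set" where
  "K_act p = K_relabel (inv\<^bsub>S6\<^esub> p)"

lemma S6_inv_apply:
  assumes "p \<in> carrier S6"
  shows "(inv\<^bsub>S6\<^esub> p) (p i) = i" "inv\<^bsub>S6\<^esub> p permutes idx"
proof -
  interpret S: group S6 by (rule group_S6)
  have "p \<otimes>\<^bsub>S6\<^esub> inv\<^bsub>S6\<^esub> p = \<one>\<^bsub>S6\<^esub>" using assms by simp
  then have "inv\<^bsub>S6\<^esub> p \<circ> p = id" by (simp add: S6_def)
  then show "(inv\<^bsub>S6\<^esub> p) (p i) = i" by (metis comp_apply id_apply)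
  show "inv\<^bsub>S6\<^esub> p permutes idx" using S.inv_closed[OF assms] by (simp add: S6_def)
qed

lemma xa_action_K: "xa_action K KX KA K_act"
proof -
  interpret F: xa_family K idx KX KA by (rule xa_family_K)
  interpret S: group S6 by (rule group_S6)
  have perm: "q permutes idx" if "q \<in> carrier S6" for q using that by (simp add: S6_def)
  have range: "i \<in> idx \<Longrightarrow> q i \<in> idx" "i \<noteq> j \<Longrightarrow> q i \<noteq> q j" if "q permutes idx" for q i j
    using permutes_in_image[OF that] permutes_inj[OF that] by (auto simp: inj_eq)
  show ?thesis
  proof unfold_locales
    show "\<exists>m\<in>idx. m \<noteq> a \<and> m \<noteq> b \<and> m \<noteq> c \<and> m \<noteq> d" for a b c d
      using idx_fresh[of a b c d d] by blast
    fix p assume p: "p \<in> carrier S6"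
    show "K_act p \<in> hom K K" unfolding K_act_def using K_relabel_hom S6_inv_apply(2)[OF p] by blast
    show "K_act p (KX (p i) (p j)) = KX i j" if "i \<in> idx" "j \<in> idx" "i \<noteq> j" for i j
      using range[OF perm[OF p]] that K_relabel_hom(2)[OF S6_inv_apply(2)[OF p], of "p i" "p j"]
      unfolding K_act_def by (simp add: S6_inv_apply(1)[OF p] del: atLeastAtMost_iff)
    show "K_act p (KA (p i) (p j)) = KA i j" if "i \<in> idx" "j \<in> idx" "i \<noteq> j" for i j
      using range[OF perm[OF p]] that K_relabel_hom(3)[OF S6_inv_apply(2)[OF p], of "p i" "p j"]
      unfolding K_act_def by (simp add: S6_inv_apply(1)[OF p] del: atLeastAtMost_iff)
  next
    fix x assume x: "x \<in> carrier K"
    have id: "inv\<^bsub>S6\<^esub> \<one>\<^bsub>S6\<^esub> = id" unfolding S.inv_one by (simp add: S6_def)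
    have "K_relabel id x = (\<lambda>x. x) x"
    proof (rule K_hom_eqI[OF F.is_group _ _ _ _ x])
      show "K_relabel id \<in> hom K K" by (rule K_relabel_hom[OF permutes_id])
      show "(\<lambda>x. x) \<in> hom K K" by (simp add: hom_def)
      show "K_relabel id (KX i j) = KX i j" "K_relabel id (KA i j) = KA i j"
        if "i \<in> idx" "j \<in> idx" "i \<noteq> j" for i j
        using K_relabel_hom(2,3)[OF permutes_id that] by (simp_all only: id_apply)
    qed
    then show "K_act \<one>\<^bsub>S6\<^esub> x = x" unfolding K_act_def id by simp
  next
    fix p q x assume p: "p \<in> carrier S6" and q: "q \<in> carrier S6" and x: "x \<in> carrier K"
    let ?p = "inv\<^bsub>S6\<^esub> p" and ?q = "inv\<^bsub>S6\<^esub> q"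
    have pq: "inv\<^bsub>S6\<^esub> (p \<otimes>\<^bsub>S6\<^esub> q) = ?p \<circ> ?q"
      using p q by (simp add: S.inv_mult_group) (simp add: S6_def)
    have ip: "?p permutes idx" "?q permutes idx" "?p \<circ> ?q permutes idx"
      using S6_inv_apply(2) p q by (auto intro: permutes_compose)
    have "K_relabel (?p \<circ> ?q) x = (K_relabel ?p \<circ> K_relabel ?q) x"
    proof (rule K_hom_eqI[OF F.is_group _ _ _ _ x])
      show "K_relabel (?p \<circ> ?q) \<in> hom K K" by (rule K_relabel_hom[OF ip(3)])
      show "K_relabel ?p \<circ> K_relabel ?q \<in> hom K K"
        by (rule hom_compose) (rule K_relabel_hom ip)+
    next
      fix i j assume ij: "i \<in> idx" "j \<in> idx" "i \<noteq> j"
      note q = range(1)[OF ip(2) ij(1)] range(1)[OF ip(2) ij(2)] range(2)[OF ip(2) ij(3)]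
      show "K_relabel (?p \<circ> ?q) (KX i j) = (K_relabel ?p \<circ> K_relabel ?q) (KX i j)"
        "K_relabel (?p \<circ> ?q) (KA i j) = (K_relabel ?p \<circ> K_relabel ?q) (KA i j)"
        unfolding K_relabel_hom(2,3)[OF ip(3) ij] comp_apply K_relabel_hom(2,3)[OF ip(2) ij]
          K_relabel_hom(2,3)[OF ip(1) q] by simp_all
    qed
    then show "K_act (p \<otimes>\<^bsub>S6\<^esub> q) x = K_act p (K_act q x)"
      unfolding K_act_def pq by simp
  qed
qed

section \<open>The presented group Pi1 as a cover of the symmetric group\<close>

abbreviation gP :: "nat \<Rightarrow> pi_gen word set" where "gP j \<equiv> pi_elem (gam j)"
abbreviation gP' :: "nat \<Rightarrow> pi_gen word set" where "gP' j \<equiv> pi_elem (gam' j)"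

lemma group_Pi1: "group Pi1"
  by (simp add: Pi1_def group_pres_group)

lemma gP_closed: "j \<in> idx \<Longrightarrow> gP j \<in> carrier Pi1" "j \<in> idx \<Longrightarrow> gP' j \<in> carrier Pi1"
  by (simp_all add: Pi1_def pi_elem_def pres_group_letter_closed)

lemma pi_val_gP: "pi_val gP gP' = (\<lambda>g. pres_class pi_gens pi_rels (letter g))"
  by (rule ext) (simp add: pi_elem_def split: pi_gen.split)

lemma pi_family_Pi1: "pi_family Pi1 gP gP'"
proof (rule pi_family_of_rels[OF group_Pi1 gP_closed])
  show "\<And>l r. \<lbrakk>(l, r) \<in> pi_rels; l \<in> words pi_gens; r \<in> words pi_gens\<rbrakk> \<Longrightarrow>
      word_eval Pi1 (pi_val gP gP') l = word_eval Pi1 (pi_val gP gP') r"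
    unfolding pi_val_gP Pi1_def by (rule word_eval_pres_group_rel)
qed

lemma pi_elem_eval: "w \<in> words pi_gens \<Longrightarrow> pi_elem w = word_eval Pi1 (pi_val gP gP') w"
  unfolding pi_val_gP unfolding Pi1_def pi_elem_def by (simp add: word_eval_pres_group)

lemma Pi1_generated: "carrier Pi1 \<subseteq> generate Pi1 (gP ` idx \<union> gP' ` idx)"
proof
  interpret P: group Pi1 by (rule group_Pi1)
  let ?S = "gP ` idx \<union> gP' ` idx"
  fix x assume "x \<in> carrier Pi1"
  then obtain w where w: "w \<in> words pi_gens" "x = pi_elem w"
    by (auto simp: Pi1_def pres_group_carrier pi_elem_def)
  have "word_eval Pi1 (pi_val gP gP') w \<in> generate Pi1 ?S" using w(1)
  proof (induction w)
    case Nil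
    then show ?case by (simp add: generate.one)
  next
    case (Cons x w)
    then have "fst x \<in> pi_gens" by simp
    then have "pi_val gP gP' (fst x) \<in> ?S" by (cases rule: pi_gens_cases) auto
    then show ?case using Cons by (auto intro!: generate.eng intro: generate.incl generate.inv)
  qed
  then show "x \<in> generate Pi1 ?S" using w pi_elem_eval by simp
qed

lemma pi_cover_Pi1: "pi_cover Pi1 gP gP' psi"
proof -
  interpret pi_family Pi1 gP gP' by (rule pi_family_Pi1)
  show ?thesis
  proof unfold_locales
    show "psi \<one>\<^bsub>Pi1\<^esub> = id"
      using hom_one[OF psi_hom group_Pi1 group_S6] by (simp add: S6_def)
    show "psi (x \<otimes>\<^bsub>Pi1\<^esub> y) = psi y \<circ> psi x" if "x \<in> carrier Pi1" "y \<in> carrier Pi1" for x y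
      using hom_mult[OF psi_hom that] by (simp add: S6_def)
    show "psi x permutes idx" if "x \<in> carrier Pi1" for x
      using hom_in_carrier[OF psi_hom that] by (simp add: S6_def)
  qed (rule psi_values; assumption)+
qed

interpretation Pi: pi_cover Pi1 gP gP' psi by (rule pi_cover_Pi1)
interpretation KK: xa_action K KX KA K_act by (rule xa_action_K)

section \<open>The comparison homomorphisms\<close>

definition to_Pi1 :: "xa_gen word set \<Rightarrow> pi_gen word set" where
  "to_Pi1 = pres_lift Pi1 (xa_val (Pi.transport Pi.X13) (Pi.transport (Pi.B 1)))"

definition to_model :: "pi_gen word set \<Rightarrow> xa_gen word set \<times> (nat \<Rightarrow> nat)" where
  "to_model = pres_lift KK.SD (pi_val (\<lambda>j. KK.e j 0) (\<lambda>j. KK.e j (- 1)))"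

lemma to_Pi1: "to_Pi1 \<in> hom K Pi1"
  "\<lbrakk>i \<in> idx; j \<in> idx; i \<noteq> j\<rbrakk> \<Longrightarrow> to_Pi1 (KX i j) = Pi.transport Pi.X13 i j"
  "\<lbrakk>i \<in> idx; j \<in> idx; i \<noteq> j\<rbrakk> \<Longrightarrow> to_Pi1 (KA i j) = Pi.transport (Pi.B 1) i j"
  unfolding to_Pi1_def using pres_lift_xa[OF Pi.kernel_family] by blast+

lemma to_model: "to_model \<in> hom Pi1 KK.SD"
  "j \<in> idx \<Longrightarrow> to_model (gP j) = KK.e j 0" "j \<in> idx \<Longrightarrow> to_model (gP' j) = KK.e j (- 1)"
proof -
  let ?f = "pi_val (\<lambda>j. KK.e j 0) (\<lambda>j. KK.e j (- 1))"
  have c: "\<And>x. x \<in> pi_gens \<Longrightarrow> ?f x \<in> carrier KK.SD"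
    using KK.e_closed by (simp split: pi_gen.split del: semidirect_simps)
  have R: "\<And>l r. (l, r) \<in> pi_rels \<Longrightarrow> word_eval KK.SD ?f l = word_eval KK.SD ?f r"
    by (rule pi_family_rels[OF KK.group_SD KK.e_closed KK.e_closed KK.pi_family_SD])
  show "to_model \<in> hom Pi1 KK.SD"
    unfolding to_model_def Pi1_def by (rule pres_lift_hom[OF KK.group_SD]) (use c R in blast)+
  have l: "to_model (pi_elem (letter x)) = ?f x" if "x \<in> pi_gens" for x
    unfolding to_model_def pi_elem_def
    using pres_lift_class[of KK.SD pi_gens ?f pi_rels "letter x"] KK.group_SD c R that
    by (simp add: letter_words word_eval_letter del: semidirect_simps)
  show "j \<in> idx \<Longrightarrow> to_model (gP j) = KK.e j 0" "j \<in> idx \<Longrightarrow> to_model (gP' j) = KK.e j (- 1)"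
    using l[of "Gam j"] l[of "Gam' j"] by simp_all
qed

lemma to_model_H: "h \<in> Pi.H \<Longrightarrow> to_model h = (\<one>\<^bsub>K\<^esub>, psi h)"
proof (erule Pi.generate_involutions_induct)
  show "gP ` {2..6} \<subseteq> carrier Pi1" using gP_closed by auto
  show "\<And>s. s \<in> gP ` {2..6} \<Longrightarrow> s \<otimes>\<^bsub>Pi1\<^esub> s = \<one>\<^bsub>Pi1\<^esub>" using Pi.g_square by auto
  show "to_model \<one>\<^bsub>Pi1\<^esub> = (\<one>\<^bsub>K\<^esub>, psi \<one>\<^bsub>Pi1\<^esub>)"
    using hom_one[OF to_model(1) group_Pi1 KK.group_SD] hom_one[OF psi_hom group_Pi1 group_S6] by simp
next
  fix y s assume y: "y \<in> Pi.H" "s \<in> gP ` {2..6}" "to_model y = (\<one>\<^bsub>K\<^esub>, psi y)"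
  then obtain j where j: "j \<in> {2..6}" "s = gP j" by blast
  have c: "y \<in> carrier Pi1" "s \<in> carrier Pi1" using y j Pi.H_closed gP_closed by auto
  have "to_model s = (\<one>\<^bsub>K\<^esub>, psi_transp j)" using to_model(2)[of j] j by (simp add: KK.e_def KK.P_0)
  moreover have "psi s = psi_transp j" using Pi.\<theta>_g[of j] j by simp
  moreover have "psi y \<in> carrier S6" using hom_in_carrier[OF psi_hom c(1)] .
  ultimately show "to_model (y \<otimes>\<^bsub>Pi1\<^esub> s) = (\<one>\<^bsub>K\<^esub>, psi (y \<otimes>\<^bsub>Pi1\<^esub> s))"
    using hom_mult[OF to_model(1) c] hom_mult[OF psi_hom c] y(3) by (simp add: KK.\<alpha>_unit)
qed

lemma to_model_transport:
  assumes x: "Pi.stab_commuting x" "to_model x = (k, \<one>\<^bsub>S6\<^esub>)" and k: "k \<in> carrier K"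
    and ij: "i \<in> idx" "j \<in> idx" "i \<noteq> j"
  obtains h where "h \<in> carrier S6" "h i = 1" "h j = 3"
    "to_model (Pi.transport x i j) = (K_act h k, \<one>\<^bsub>S6\<^esub>)"
proof -
  interpret S: group S6 by (rule group_S6)
  obtain s where s: "s \<in> Pi.H" "psi s i = 1" "psi s j = 3" using Pi.ex_H2[OF ij] by blast
  have c: "s \<in> carrier Pi1" "x \<in> carrier Pi1" using s Pi.H_closed x by (auto simp: Pi.stab_commuting_def)
  have p: "psi s \<in> carrier S6" using hom_in_carrier[OF psi_hom c(1)] .
  have "to_model (Pi.transport x i j) \<otimes>\<^bsub>KK.SD\<^esub> to_model s = to_model (s \<otimes>\<^bsub>Pi1\<^esub> x)"
    using Pi.transport_eq[OF x(1) s] c hom_mult[OF to_model(1), of "Pi.conjugate s x" s]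
    by (simp add: Pi.conjugate_def Pi.m_assoc)
  also have "\<dots> = (K_act (psi s) k, psi s)"
    using hom_mult[OF to_model(1) c] to_model_H[OF s(1)] x(2) p k KK.\<alpha>_closed[OF p k] by simp
  also have "\<dots> = (K_act (psi s) k, \<one>\<^bsub>S6\<^esub>) \<otimes>\<^bsub>KK.SD\<^esub> to_model s"
    using to_model_H[OF s(1)] p KK.\<alpha>_closed[OF p k] by (simp add: KK.\<alpha>_unit)
  finally have "to_model (Pi.transport x i j) \<otimes>\<^bsub>KK.SD\<^esub> to_model s =
      (K_act (psi s) k, \<one>\<^bsub>S6\<^esub>) \<otimes>\<^bsub>KK.SD\<^esub> to_model s" .
  moreover have "to_model s \<in> carrier KK.SD" "to_model (Pi.transport x i j) \<in> carrier KK.SD"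
    using hom_in_carrier[OF to_model(1)] c(1) Pi.transport_closed[OF x(1) ij] by blast+
  moreover have "(K_act (psi s) k, \<one>\<^bsub>S6\<^esub>) \<in> carrier KK.SD" using KK.\<alpha>_closed[OF p k] by simp
  ultimately have "to_model (Pi.transport x i j) = (K_act (psi s) k, \<one>\<^bsub>S6\<^esub>)"
    using group.right_cancel[OF KK.group_SD] by blast
  then show ?thesis using that p s by blast
qed

text \<open>It suffices to follow the generators. The images of \<open>X\<^sub>1\<^sub>3\<close> and \<open>A\<^sub>1\<^sub>3\<close> are computed
  directly, and conjugation by an element of \<open>H\<close> becomes relabelling in the semidirect product.\<close>

lemma to_model_to_Pi1: "x \<in> carrier K \<Longrightarrow> to_model (to_Pi1 x) = (x, \<one>\<^bsub>S6\<^esub>)"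
proof -
  assume x: "x \<in> carrier K"
  interpret S: group S6 by (rule group_S6)
  have X: "to_model Pi.X13 = (KX 1 3, \<one>\<^bsub>S6\<^esub>)"
  proof -
    have "to_model Pi.X13 = (\<one>\<^bsub>K\<^esub>, psi_transp 1) \<otimes>\<^bsub>KK.SD\<^esub> KK.e 1 0"
      using hom_mult[OF to_model(1), of Pi.\<tau> "gP 1"] to_model_H[OF Pi.\<tau>_H] to_model(2)[of 1]
      by (simp add: Pi.X13_def Pi.\<theta>_\<tau> psi_transp_def)
    also have "\<dots> = (KK.Y 0 1 3, \<one>\<^bsub>S6\<^esub>)"
      using KK.closeds[of 1 3] by (simp add: KK.e_def KK.P_def KK.\<alpha>_transp)
    also have "KK.Y 0 1 3 = KX 1 3" using KK.closeds[of 1 3] by (simp add: KK.Y_def)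
    finally show ?thesis .
  qed
  have A: "to_model (Pi.B 1) = (KA 1 3, \<one>\<^bsub>S6\<^esub>)"
    using hom_mult[OF to_model(1), of "gP 1" "gP' 1"] to_model(2,3)[of 1] KK.e_pair[of 1]
    by (simp add: Pi.B_def KK.D_def)
  have act: "K_act p (KX 1 3) = KX i j" "K_act p (KA 1 3) = KA i j"
    if "p \<in> carrier S6" "p i = 1" "p j = 3" "i \<in> idx" "j \<in> idx" "i \<noteq> j" for p i j
    using KK.\<alpha>_X[of p i j] KK.\<alpha>_A[of p i j] that by simp_all
  have "(to_model \<circ> to_Pi1) x = (\<lambda>x. (x, \<one>\<^bsub>S6\<^esub>)) x"
  proof (rule K_hom_eqI[OF KK.group_SD _ _ _ _ x])
    show "to_model \<circ> to_Pi1 \<in> hom K KK.SD" using hom_compose[OF to_Pi1(1) to_model(1)] .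
    show "(\<lambda>x. (x, \<one>\<^bsub>S6\<^esub>)) \<in> hom K KK.SD" by (auto simp: hom_def KK.\<alpha>_one)
  next
    fix i j assume ij: "i \<in> idx" "j \<in> idx" "i \<noteq> j"
    obtain p where "p \<in> carrier S6" "p i = 1" "p j = 3"
      "to_model (Pi.transport Pi.X13 i j) = (K_act p (KX 1 3), \<one>\<^bsub>S6\<^esub>)"
      using to_model_transport[OF Pi.stab_commuting_base(4) X _ ij] K_closed(1)[of 1 3] by auto
    then show "(to_model \<circ> to_Pi1) (KX i j) = (KX i j, \<one>\<^bsub>S6\<^esub>)"
      using act ij to_Pi1(2)[OF ij] by simp
    obtain p where "p \<in> carrier S6" "p i = 1" "p j = 3"
      "to_model (Pi.transport (Pi.B 1) i j) = (K_act p (KA 1 3), \<one>\<^bsub>S6\<^esub>)"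
      using to_model_transport[OF Pi.stab_commuting_base(2) A _ ij] K_closed(2)[of 1 3] by auto
    then show "(to_model \<circ> to_Pi1) (KA i j) = (KA i j, \<one>\<^bsub>S6\<^esub>)"
      using act ij to_Pi1(3)[OF ij] by simp
  qed
  then show ?thesis by simp
qed

lemma to_Pi1_inj: "inj_on to_Pi1 (carrier K)"
  by (rule inj_onI) (metis to_model_to_Pi1 prod.inject)

lemma N_eq_kernel: "Pi.N = kernel Pi1 S6 psi"
proof
  have one: "\<one>\<^bsub>S6\<^esub> = id" by (simp add: S6_def)
  show "Pi.N \<subseteq> kernel Pi1 S6 psi"
    using Pi.N_closed Pi.N_kernel by (auto simp: kernel_def one)
  show "kernel Pi1 S6 psi \<subseteq> Pi.N"
    using Pi.kernel_generated Pi1_generated by (auto simp: kernel_def one)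
qed

lemma to_Pi1_image: "to_Pi1 ` carrier K = Pi.N"
proof
  interpret gh: group_hom K Pi1 to_Pi1
    using group_pres_group group_Pi1 to_Pi1(1) by (simp add: group_hom_def group_hom_axioms_def)
  show "Pi.N \<subseteq> to_Pi1 ` carrier K"
  proof (rule Pi.generate_subgroup_incl[OF _ gh.img_is_subgroup], safe)
    fix i j assume ij: "i \<in> idx" "j \<in> idx" "(i::nat) \<noteq> j"
    show "Pi.transport Pi.X13 i j \<in> to_Pi1 ` carrier K" "Pi.transport (Pi.B 1) i j \<in> to_Pi1 ` carrier K"
      using to_Pi1(2,3)[OF ij] K_closed[OF ij] by (metis imageI)+
  qed
  have "carrier K \<subseteq> to_Pi1 -` Pi.N"
  proof
    fix x assume "x \<in> carrier K"
    then obtain w where w: "w \<in> words xa_gens" "x = pres_class xa_gens xa_rels w"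
      by (auto simp: pres_group_carrier)
    then have "x = word_eval K (\<lambda>g. pres_class xa_gens xa_rels (letter g)) w"
      using word_eval_pres_group by metis
    then have "to_Pi1 x = word_eval Pi1 (\<lambda>g. to_Pi1 (pres_class xa_gens xa_rels (letter g))) w"
      using hom_word_eval[OF group_pres_group group_Pi1 to_Pi1(1) pres_group_letter_closed w(1)] by simp
    also have "\<dots> \<in> Pi.N" using w(1)
    proof (induction w)
      case Nil
      then show ?case by (simp add: generate.one)
    next
      case (Cons y w)
      then have "fst y \<in> xa_gens" by simp
      then have "to_Pi1 (pres_class xa_gens xa_rels (letter (fst y))) \<in> Pi.N"
        by (cases rule: xa_gens_cases) (simp_all add: to_Pi1 Pi.N_incl del: atLeastAtMost_iff)
      then show ?case using Cons by (auto intro!: generate.eng Pi.N_inv simp del: atLeastAtMost_iff)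
    qed
    finally show "x \<in> to_Pi1 -` Pi.N" by simp
  qed
  then show "to_Pi1 ` carrier K \<subseteq> Pi.N" by blast
qed

lemma X_elem_eq:
  assumes "is_sigma k l s"
  shows "X_elem s = Pi.transport Pi.X13 k l" "A_elem s = Pi.transport (Pi.B 1) k l"
proof -
  have s: "s \<in> Pi.H" "psi s k = 1" "psi s l = 3" using assms by (auto simp: is_sigma_def S6_lift_def)
  let ?x = "gam 2 @ gam 6 @ gam 5 @ gam 4 @ gam 3 @ gam 4 @ gam 5 @ gam 6 @ gam 2 @ gam 1"
  have append: "\<And>u v. u \<in> words pi_gens \<Longrightarrow> v \<in> words pi_gens \<Longrightarrow> word_eval Pi1 (pi_val gP gP') (u @ v) =
      word_eval Pi1 (pi_val gP gP') u \<otimes>\<^bsub>Pi1\<^esub> word_eval Pi1 (pi_val gP gP') v"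
    by (rule pi_eval_append[OF group_Pi1 gP_closed]) assumption+
  have letters: "\<And>j. j \<in> idx \<Longrightarrow> word_eval Pi1 (pi_val gP gP') (gam j) = gP j"
    "\<And>j. j \<in> idx \<Longrightarrow> word_eval Pi1 (pi_val gP gP') (gam' j) = gP' j"
    by (rule pi_eval_letter[OF group_Pi1 gP_closed], assumption+)+
  note eval = letter_words append letters
  have "pi_elem ?x = word_eval Pi1 (pi_val gP gP') ?x"
    by (rule pi_elem_eval) (simp add: letter_words)
  also have "\<dots> = Pi.X13" by (simp add: eval Pi.X13_def Pi.\<tau>_def Pi.m_assoc)
  finally show "X_elem s = Pi.transport Pi.X13 k l"
    unfolding X_elem_def Pi.transport_eq[OF Pi.stab_commuting_base(4) s] by (simp add: Pi.conjugate_def)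
  have "pi_elem (gam 1 @ gam' 1) = word_eval Pi1 (pi_val gP gP') (gam 1 @ gam' 1)"
    by (rule pi_elem_eval) (simp add: letter_words)
  also have "\<dots> = Pi.B 1" by (simp add: eval Pi.B_def)
  finally show "A_elem s = Pi.transport (Pi.B 1) k l"
    unfolding A_elem_def Pi.transport_eq[OF Pi.stab_commuting_base(2) s] by (simp add: Pi.conjugate_def)
qed

theorem theorem8p10:
  fixes \<sigma> :: "nat \<Rightarrow> nat \<Rightarrow> pi_gen word set"
  assumes "\<And>k l. k \<in> {1..6} \<Longrightarrow> l \<in> {1..6} \<Longrightarrow> k \<noteq> l \<Longrightarrow> is_sigma k l (\<sigma> k l)"
  shows "generate Pi1 ({X_elem (\<sigma> i j) | i j. i \<in> {1..6} \<and> j \<in> {1..6} \<and> i \<noteq> j}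
                     \<union> {A_elem (\<sigma> i j) | i j. i \<in> {1..6} \<and> j \<in> {1..6} \<and> i \<noteq> j})
           = carrier A_group
       \<and> has_presentation A_group xa_gens xa_rels
           (\<lambda>x. case x of Xg i j \<Rightarrow> X_elem (\<sigma> i j) | Ag i j \<Rightarrow> A_elem (\<sigma> i j))"
proof
  have XA: "X_elem (\<sigma> i j) = Pi.transport Pi.X13 i j" "A_elem (\<sigma> i j) = Pi.transport (Pi.B 1) i j"
    if "i \<in> idx" "j \<in> idx" "i \<noteq> j" for i j
    using X_elem_eq[OF assms[OF that]] by auto
  have cong: "{f i j | i j. i \<in> idx \<and> j \<in> idx \<and> i \<noteq> j} = {f' i j | i j. i \<in> idx \<and> j \<in> idx \<and> i \<noteq> j}"
    if "\<And>i j. i \<in> idx \<Longrightarrow> j \<in> idx \<Longrightarrow> i \<noteq> j \<Longrightarrow> f i j = f' i j"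
    for f f' :: "nat \<Rightarrow> nat \<Rightarrow> pi_gen word set"
    by (rule Collect_cong, rule ex_cong1, rule ex_cong1) (use that in \<open>auto simp del: atLeastAtMost_iff\<close>)
  have "{X_elem (\<sigma> i j) | i j. i \<in> idx \<and> j \<in> idx \<and> i \<noteq> j} =
      {Pi.transport Pi.X13 i j | i j. i \<in> idx \<and> j \<in> idx \<and> i \<noteq> j}"
    "{A_elem (\<sigma> i j) | i j. i \<in> idx \<and> j \<in> idx \<and> i \<noteq> j} =
      {Pi.transport (Pi.B 1) i j | i j. i \<in> idx \<and> j \<in> idx \<and> i \<noteq> j}"
    by (rule cong[OF XA(1)], assumption+) (rule cong[OF XA(2)], assumption+)
  then show "generate Pi1 ({X_elem (\<sigma> i j) | i j. i \<in> {1..6} \<and> j \<in> {1..6} \<and> i \<noteq> j}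
        \<union> {A_elem (\<sigma> i j) | i j. i \<in> {1..6} \<and> j \<in> {1..6} \<and> i \<noteq> j}) = carrier A_group"
    using N_eq_kernel by (simp add: A_group_def del: atLeastAtMost_iff)
  have "to_Pi1 \<in> hom K A_group"
    using to_Pi1(1) to_Pi1_image N_eq_kernel unfolding hom_def A_group_def by auto
  then have "to_Pi1 \<in> iso K A_group"
    using to_Pi1_inj to_Pi1_image N_eq_kernel by (simp add: iso_def bij_betw_def A_group_def)
  moreover have "to_Pi1 (pres_class xa_gens xa_rels (letter g)) =
      (case g of Xg i j \<Rightarrow> X_elem (\<sigma> i j) | Ag i j \<Rightarrow> A_elem (\<sigma> i j))" if "g \<in> xa_gens" for g
    using that by (cases rule: xa_gens_cases) (simp_all add: to_Pi1 XA del: atLeastAtMost_iff)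
  ultimately show "has_presentation A_group xa_gens xa_rels
      (\<lambda>x. case x of Xg i j \<Rightarrow> X_elem (\<sigma> i j) | Ag i j \<Rightarrow> A_elem (\<sigma> i j))"
    unfolding has_presentation_def by blast
qed

end
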